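(* There exist a constant $\kappa$ depending only on $(C_L,C_{\mathcal A})$ and a universal constant $C>0$ such that the following holds. Consider the general deformation model with templates $f_0,f_1$ and deformation class $\mathcal A$, and suppose that Assumptions 1, 2-(i) and 3 of the context hold. Let $0<\alpha\le1$, let $\mathcal A_{d_\alpha}$ be the finite subset of $\mathcal A$ from Assumption 3, and let $\widehat{\mathbf p}^{\mathrm{CE}}=(\widehat p_1^{\mathrm{CE}},\widehat p_2^{\mathrm{CE}})$ be the cross-entropy empirical risk minimizer $$\widehat{\mathbf p}^{\mathrm{CE}}\in\arg\min_{\mathbf q=(q_1,q_2)\in\widetilde{\mathcal G}(\alpha,|\mathcal A_{d_\alpha}|)}-\frac1n\sum_{i=1}^n\Big[k_i\log\big(q_2(\overline{\mathbf X}_i)\big)+(1-k_i)\log\big(1-q_2(\overline{\mathbf X}_i)\big)\Big]$$ over the CNN class $\widetilde{\mathcal G}(\alpha,|\mathcal A_{d_\alpha}|)$, based on i.i.d. data $(\mathbf X_1,k_1),\dots,(\mathbf X_n,k_n)$. Suppose a new data point $(\mathbf X,k)$ is independently drawn from the same distribution. If $|\mathcal A_{d_\alpha}|\ge(d^\alpha\vee2)$ and the separation quantity satisfies $D\ge\sqrt{\kappa/d^\alpha}$, then for any $\gamma>0$ and any sufficiently large $n$, the classifier $\widehat k^{\mathrm{CE}}(\mathbf X)=\mathbf 1(\widehat p_2^{\mathrm{CE}}(\overline{\mathbf X})>1/2)$ satisfies $$\mathbf P\big(\widehat k^{\mathrm{CE}}(\mathbf X)\ne k\big)\le C\,\frac{|\mathcal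 A_{d_\alpha}|\,(d^{2\alpha}+|\mathcal A_{d_\alpha}|)}{n}\,\log(|\mathcal A_{d_\alpha}|)\,\log^{1+\gamma}n,$$ where $\mathbf P$ is the distribution over all randomness in the data and the new sample $\mathbf X$.
   Context: Notation: $\|\cdot\|_p$ is the $L^p$-norm on $[0,1]^2$; for $A=(a_1,a_2)$, $\|A\|_\infty=\max_i\sup_{z\in[0,1]^2}|a_i(z)|$; the support of $g$ is $\{x:g(x)\ne0\}$; $x\vee y=\max$, $x\wedge y=\min$; $I_{j,\ell}=[\frac{j-1}d,\frac jd)\times[\frac{\ell-1}d,\frac\ell d)$. Deformation model and data: $f_0,f_1:\mathbb R^2\to[0,\infty)$ are template functions, not identically zero; $\mathcal A$ is a class of maps $A=(a_1,a_2):\mathbb R^2\to\mathbb R^2$. A data point $(\mathbf X,k)$ is generated by drawing $k\in\{0,1\}$ Bernoulli with success probability $\pi\in[0,1]$, $A$ from a distribution $Q_{\mathcal A}$ on $\mathcal A$, $\eta$ from a distribution $Q_\eta$ on $(0,\infty)$, with $\eta$ and $A$ independent, and setting $\mathbf X=(X_{j,\ell})_{j,\ell=1,\dots,d}$, $X_{j,\ell}=d^2\eta\int_{I_{j,\ell}}f_k(A(u,v))\,du\,dv$. The normalized image is $\overline{\mathbf X}$ with entries $\overline X_{j,\ell}=X_{j,\ell}/\sqrt{\sum_{j,\ell=1}^dX_{j,\ell}^2}$. Assumption 1: the supports of $f_0,f_1$ are contained in a rectangle $R=[\beta_{\mathrm{left}},\beta_{\mathrm{right}}]\times[\beta_{\mathrm{down}},\beta_{\mathrm{up}}]\subseteq[0,1]^2$,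 and for a constant $C_L>0$, $|f_k(u,v)-f_k(u',v')|\le C_L\|f_k\|_1(|u-u'|+|v-v'|)$ for all reals $u,v,u',v'$, $k=0,1$. Assumption 2-(i): $\mathcal A$ contains the identity; every $A=(a_1,a_2)\in\mathcal A$ satisfies $R\subseteq A([0,1]^2)$, and $a_1,a_2$ have continuous partial derivatives on $\mathbb R^2$ bounded in supremum norm by $C_{\mathcal A}$. The inclusion encodes full visibility of the deformed object: it is understood that the supports of $f_0\circ A,f_1\circ A$ are contained in $[0,1]^2$. A single map $A$ is said to satisfy Assumption 2-(i) if it has these properties (inclusion, full visibility, derivative bounds). Assumption 3: for any $\alpha\in(0,1]$, $\mathcal A$ contains a finite subset $\mathcal A_{d_\alpha}$ such that for any $A\in\mathcal A$ there are $A'\in\mathcal A_{d_\alpha}$ and $j,\ell\in\{1,\dots,d\}$ such that $A'(\cdot+j/d,\cdot+\ell/d)$ satisfies Assumption 2-(i) and $\|A'(\cdot+\frac jd,\cdot+\frac\ell d)-A\|_\infty\le d^{-\alpha}$. Separation quantity: $D=D(f_0,f_1)\vee D(f_1,f_0)$ with $D(f,g)=\inf_{a,s,s'\in\mathbb R,\,A,A'\in\mathcal A}\|a\,f\circ A(\cdot+s,\cdot+s')-g\circ A'\|_{L^2(\mathbb R^2)}/\|g\|_{L^2(\mathbb R^2)}$. CNN class. $\sigma(x)=\max\{x,0\}$, applied entrywise. For a $d\times d$ matrix $\mathbf W$, its quadratic support $[\mathbf W]$ (the filter) is the smallest square (contiguous) submatrix containing all non-zero entries of $\mathbf W$. If $[\mathbf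 W]$ is $\ell\times\ell$, let $\mathbf X'$ be the $(d+2\ell)\times(d+2\ell)$ matrix obtained by padding the $d\times d$ matrix $\mathbf X$ by $\ell$ rows/columns of zeros on all sides; $[\mathbf W]\star\mathbf X$ is the matrix whose $(i,j)$ entry is the sum of the entries of the Hadamard product of $[\mathbf W]$ with the $\ell\times\ell$ patch $(X'_{i+a,j+b})_{a,b=0,\dots,\ell-1}$, over all patches. $|\cdot|_\infty$ is the maximum absolute entry. For $\alpha\in(0,1)$ let $\mathcal K(i)=\{\lfloor d^{1-\alpha}+1\rfloor(i-1)+1,\dots,(\lfloor d^{1-\alpha}+1\rfloor i)\wedge d\}$; $\mathbf W$ has an $(\alpha,d)$-block structure if $W_{j,\ell}=W_{j',\ell'}$ whenever $j,j'\in\mathcal K(i)$, $\ell,\ell'\in\mathcal K(i')$ for some $i,i'$; every $d\times d$ matrix has a $(1,d)$-block structure. $\mathcal F^C(\alpha,r)$ is the class of maps $\mathbf X\mapsto(|\sigma([\mathbf W_s]\star\mathbf X)|_\infty)_{s=1,\dots,r}$ where each $\mathbf W_s$ has an $(\alpha,d)$-block structure and entries in $[-1,1]$. For $\mathbf v,\mathbf y\in\mathbb R^r$ let $\sigma_{\mathbf v}\mathbf y=(\sigma(y_1-v_1),\dots,\sigma(y_r-v_r))^\top$. Let $\Phi(x_1,x_2)=(\frac{e^{x_1}}{e^{x_1}+e^{x_2}},\frac{e^{x_2}}{e^{x_1}+e^{x_2}})$. $\mathcal F_\psi(L,\mathbf m)$, $\mathbf m=(m_0,\dots,m_{L+1})$,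 is the class of functions $\mathbf x\mapsto\psi\,\sigma_{\mathbf v_{L+1}}\mathbf W_L\sigma_{\mathbf v_L}\mathbf W_{L-1}\cdots\mathbf W_1\sigma_{\mathbf v_1}\mathbf W_0\mathbf x$ from $\mathbb R^{m_0}$ to $\mathbb R^{m_{L+1}}$ with weight matrices $\mathbf W_j\in\mathbb R^{m_{j+1}\times m_j}$ and bias vectors $\mathbf v_j\in\mathbb R^{m_j}$, all entries bounded by $1$ in absolute value, and $\psi$ the identity or $\Phi$. Then $$\mathcal G(\alpha,m)=\{f\circ g:\ f\in\mathcal F_\Phi(1+2\lceil\log_2m\rceil,(2m,4m,\dots,4m,2)),\ g\in\mathcal F^C(\alpha,2m)\},$$ and, with $\rho(z)=1/(1+e^z)$, $$\widetilde{\mathcal G}(\alpha,m)=\{(1-\widetilde g,\widetilde g):\ \widetilde g=(g\vee\rho(1))\wedge\rho(-1),\ (1-g,g)\in\mathcal G(\alpha,m)\}.$$ *)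

theory Defs
  imports "HOL-Probability.Probability"
begin

type_synonym template = "real \<times> real \<Rightarrow> real"
type_synonym deformation = "real \<times> real \<Rightarrow> real \<times> real"

(* d x d matrices and images; only the entries (j, l) with 1 <= j, l <= d are meaningful. *)
type_synonym image = "nat \<times> nat \<Rightarrow> real"

definition unit_square :: "(real \<times> real) set" where
  "unit_square = {0..1} \<times> {0..1}"

definition support :: "template \<Rightarrow> (real \<times> real) set" where
  "support g = {x. g x \<noteq> 0}"

definition L1_norm :: "template \<Rightarrow> real" where
  "L1_norm f = (LINT z:unit_square|lborel. \<bar>f z\<bar>)"

definition L2_norm_plane :: "template \<Rightarrow> real" where
  "L2_norm_plane f = sqrt (LINT z|lborel. (f z)\<^sup>2)"

(* Only used for maps that are continuous, so that both suprema are finite. *)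
definition sup_norm :: "deformation \<Rightarrow> real" where
  "sup_norm A = max (SUP z\<in>unit_square. \<bar>fst (A z)\<bar>) (SUP z\<in>unit_square. \<bar>snd (A z)\<bar>)"

definition shift :: "real \<Rightarrow> real \<Rightarrow> deformation \<Rightarrow> deformation" where
  "shift s s' A = (\<lambda>(u, v). A (u + s, v + s'))"

definition separation1 :: "deformation set \<Rightarrow> template \<Rightarrow> template \<Rightarrow> real" where
  "separation1 \<A> f g =
     Inf {L2_norm_plane (\<lambda>z. a * f (shift s s' A z) - g (A' z)) / L2_norm_plane g
          | a s s' A A'. A \<in> \<A> \<and> A' \<in> \<A>}"

definition separation :: "deformation set \<Rightarrow> template \<Rightarrow> template \<Rightarrow> real" where
  "separation \<A> f0 f1 = max (separation1 \<A> f0 f1) (separation1 \<A> f1 f0)"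

definition is_template :: "template \<Rightarrow> bool" where
  "is_template f \<longleftrightarrow> (\<forall>z. 0 \<le> f z) \<and> (\<exists>z. f z \<noteq> 0)"

definition assumption1 ::
    "template \<Rightarrow> template \<Rightarrow> real \<Rightarrow> real \<Rightarrow> real \<Rightarrow> real \<Rightarrow> real \<Rightarrow> bool" where
  "assumption1 f0 f1 \<beta>left \<beta>right \<beta>down \<beta>up C\<^sub>L \<longleftrightarrow>
     {\<beta>left..\<beta>right} \<times> {\<beta>down..\<beta>up} \<subseteq> unit_square \<and> 0 < C\<^sub>L \<and>
     (\<forall>f\<in>{f0, f1}.
        support f \<subseteq> {\<beta>left..\<beta>right} \<times> {\<beta>down..\<beta>up} \<and>
        (\<forall>u v u' v'. \<bar>f (u, v) - f (u', v')\<bar> \<le> C\<^sub>L * L1_norm f * (\<bar>u - u'\<bar> + \<bar>v - v'\<bar>)))"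

definition bounded_C1 :: "real \<Rightarrow> (real \<times> real \<Rightarrow> real) \<Rightarrow> bool" where
  "bounded_C1 B g \<longleftrightarrow>
     (\<exists>g1 g2. continuous_on UNIV g1 \<and> continuous_on UNIV g2 \<and>
        (\<forall>u v. ((\<lambda>t. g (t, v)) has_real_derivative g1 (u, v)) (at u)) \<and>
        (\<forall>u v. ((\<lambda>t. g (u, t)) has_real_derivative g2 (u, v)) (at v)) \<and>
        (\<forall>z. \<bar>g1 z\<bar> \<le> B) \<and> (\<forall>z. \<bar>g2 z\<bar> \<le> B))"

definition assumption2i_map ::
    "template \<Rightarrow> template \<Rightarrow> (real \<times> real) set \<Rightarrow> real \<Rightarrow> deformation \<Rightarrow> bool" where
  "assumption2i_map f0 f1 R C\<^sub>A A \<longleftrightarrow>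
     R \<subseteq> A ` unit_square \<and>
     support (f0 \<circ> A) \<subseteq> unit_square \<and> support (f1 \<circ> A) \<subseteq> unit_square \<and>
     bounded_C1 C\<^sub>A (fst \<circ> A) \<and> bounded_C1 C\<^sub>A (snd \<circ> A)"

definition assumption2i ::
    "template \<Rightarrow> template \<Rightarrow> (real \<times> real) set \<Rightarrow> real \<Rightarrow> deformation set \<Rightarrow> bool" where
  "assumption2i f0 f1 R C\<^sub>A \<A> \<longleftrightarrow> id \<in> \<A> \<and> (\<forall>A\<in>\<A>. assumption2i_map f0 f1 R C\<^sub>A A)"

(* The family Ad collects, for every exponent \<alpha>, the finite subset provided by the assumption. *)
definition assumption3 ::
    "template \<Rightarrow> template \<Rightarrow> (real \<times> real) set \<Rightarrow> real \<Rightarrow> nat \<Rightarrow> deformation set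
      \<Rightarrow> (real \<Rightarrow> deformation set) \<Rightarrow> bool" where
  "assumption3 f0 f1 R C\<^sub>A d \<A> Ad \<longleftrightarrow>
     (\<forall>\<alpha>. 0 < \<alpha> \<and> \<alpha> \<le> 1 \<longrightarrow>
        finite (Ad \<alpha>) \<and> Ad \<alpha> \<subseteq> \<A> \<and>
        (\<forall>A\<in>\<A>. \<exists>A'\<in>Ad \<alpha>. \<exists>j\<in>{1..d}. \<exists>l\<in>{1..d}.
           assumption2i_map f0 f1 R C\<^sub>A (shift (j / d) (l / d) A') \<and>
           sup_norm (\<lambda>z. shift (j / d) (l / d) A' z - A z) \<le> real d powr (- \<alpha>)))"

definition image_space :: "nat \<Rightarrow> image measure" where
  "image_space d = (\<Pi>\<^sub>M p\<in>{1..d} \<times> {1..d}. borel)"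

definition label_space :: "bool measure" where
  "label_space = count_space UNIV"

definition pixel :: "nat \<Rightarrow> nat \<Rightarrow> nat \<Rightarrow> (real \<times> real) set" where
  "pixel d j l = {(real j - 1) / d ..< j / d} \<times> {(real l - 1) / d ..< l / d}"

definition deformed_image :: "nat \<Rightarrow> template \<Rightarrow> deformation \<Rightarrow> real \<Rightarrow> image" where
  "deformed_image d f A \<eta> =
     (\<lambda>(j, l) \<in> {1..d} \<times> {1..d}. (real d)\<^sup>2 * \<eta> * (LINT z:pixel d j l|lborel. f (A z)))"

definition normalize_image :: "nat \<Rightarrow> image \<Rightarrow> image" where
  "normalize_image d X =
     (\<lambda>p \<in> {1..d} \<times> {1..d}. X p / sqrt (\<Sum>q\<in>{1..d} \<times> {1..d}. (X q)\<^sup>2))"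

(* Any sigma-algebra on the class for which the point evaluations are measurable is allowed. *)
definition deformation_distribution :: "deformation set \<Rightarrow> deformation measure \<Rightarrow> bool" where
  "deformation_distribution \<A> QA \<longleftrightarrow>
     prob_space QA \<and> space QA = \<A> \<and> (\<forall>z. (\<lambda>A. A z) \<in> borel_measurable QA)"

definition brightness_distribution :: "real measure \<Rightarrow> bool" where
  "brightness_distribution Q\<eta> \<longleftrightarrow>
     prob_space Q\<eta> \<and> sets Q\<eta> = sets borel \<and> (AE \<eta> in Q\<eta>. 0 < \<eta>)"

(* J is a joint law of (k, A, \<eta>), where the label k is True for class 1 and False for class 0:
   k is Bernoulli, and A and \<eta> are independent with laws QA and Q\<eta>. No assumption is made on the
   dependence between k and (A, \<eta>); the fully independent case is the product measure. *)
definition latent_law ::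
    "real \<Rightarrow> deformation measure \<Rightarrow> real measure \<Rightarrow> (bool \<times> deformation \<times> real) measure \<Rightarrow> bool"
    where
  "latent_law \<pi> QA Q\<eta> J \<longleftrightarrow>
     prob_space J \<and> sets J = sets (label_space \<Otimes>\<^sub>M (QA \<Otimes>\<^sub>M Q\<eta>)) \<and>
     distr J label_space fst = measure_pmf (bernoulli_pmf \<pi>) \<and>
     distr J (QA \<Otimes>\<^sub>M Q\<eta>) snd = QA \<Otimes>\<^sub>M Q\<eta>"

definition data_law ::
    "nat \<Rightarrow> template \<Rightarrow> template \<Rightarrow> (bool \<times> deformation \<times> real) measure
      \<Rightarrow> (image \<times> bool) measure" where
  "data_law d f0 f1 J =
     distr J (image_space d \<Otimes>\<^sub>M label_space)
       (\<lambda>(k, A, \<eta>). (deformed_image d (if k then f1 else f0) A \<eta>, k))"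

definition relu :: "real \<Rightarrow> real" where
  "relu x = max x 0"

definition covers_support :: "nat \<Rightarrow> image \<Rightarrow> nat \<times> nat \<times> nat \<Rightarrow> bool" where
  "covers_support d W = (\<lambda>(l, a, b).
     1 \<le> l \<and> a + l \<le> d \<and> b + l \<le> d \<and>
     (\<forall>i\<in>{1..d}. \<forall>j\<in>{1..d}. W (i, j) \<noteq> 0 \<longrightarrow> i \<in> {a+1..a+l} \<and> j \<in> {b+1..b+l}))"

(* (l, a, b) encodes the l x l submatrix of W with rows a+1..a+l and columns b+1..b+l.
   A smallest submatrix need not be unique, e.g. if the nonzero entries fill a single row; the
   maximum in conv_feature does not depend on which one is taken. For W = 0, l = 1. *)
definition quadratic_support :: "nat \<Rightarrow> image \<Rightarrow> nat \<times> nat \<times> nat \<Rightarrow> bool" where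
  "quadratic_support d W = (\<lambda>(l, a, b).
     covers_support d W (l, a, b) \<and>
     (\<forall>l' a' b'. covers_support d W (l', a', b') \<longrightarrow> l \<le> l'))"

definition pad :: "nat \<Rightarrow> nat \<Rightarrow> image \<Rightarrow> image" where
  "pad d l X = (\<lambda>(i, j). if i \<in> {l+1..l+d} \<and> j \<in> {l+1..l+d} then X (i - l, j - l) else 0)"

definition convolution :: "nat \<Rightarrow> image \<Rightarrow> nat \<times> nat \<times> nat \<Rightarrow> image \<Rightarrow> image" where
  "convolution d W = (\<lambda>(l, a, b) X (i, j).
     \<Sum>p<l. \<Sum>q<l. W (a + 1 + p, b + 1 + q) * pad d l X (i + p, j + q))"

(* The l x l patches of the (d+2l) x (d+2l) padded image start at rows and columns 1..d+l+1. *)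
definition conv_feature :: "nat \<Rightarrow> image \<Rightarrow> nat \<times> nat \<times> nat \<Rightarrow> image \<Rightarrow> real" where
  "conv_feature d W = (\<lambda>(l, a, b) X.
     Max ((\<lambda>ij. \<bar>relu (convolution d W (l, a, b) X ij)\<bar>) ` ({1..d+l+1} \<times> {1..d+l+1})))"

definition block :: "real \<Rightarrow> nat \<Rightarrow> nat \<Rightarrow> nat set" where
  "block \<alpha> d i = (let w = nat \<lfloor>real d powr (1 - \<alpha>) + 1\<rfloor> in {w * (i - 1) + 1 .. min (w * i) d})"

definition block_structure :: "real \<Rightarrow> nat \<Rightarrow> image \<Rightarrow> bool" where
  "block_structure \<alpha> d W \<longleftrightarrow> \<alpha> = 1 \<or>
     (\<forall>i\<ge>1. \<forall>i'\<ge>1. \<forall>j\<in>block \<alpha> d i. \<forall>j'\<in>block \<alpha> d i.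
        \<forall>l\<in>block \<alpha> d i'. \<forall>l'\<in>block \<alpha> d i'. W (j, l) = W (j', l'))"

(* Vectors in R^r are functions on {1..r}. *)
definition conv_class :: "nat \<Rightarrow> real \<Rightarrow> nat \<Rightarrow> (image \<Rightarrow> nat \<Rightarrow> real) set" where
  "conv_class d \<alpha> r =
     {(\<lambda>X. \<lambda>s\<in>{1..r}. conv_feature d (W s) (q s) X) | W q.
        \<forall>s\<in>{1..r}. quadratic_support d (W s) (q s) \<and> block_structure \<alpha> d (W s) \<and>
          (\<forall>p\<in>{1..d} \<times> {1..d}. \<bar>W s p\<bar> \<le> 1)}"

(* Output after layer k: W i is the i-th weight matrix and v i the i-th bias vector. *)
primrec relu_net ::
    "(nat \<Rightarrow> nat) \<Rightarrow> (nat \<Rightarrow> nat \<Rightarrow> nat \<Rightarrow> real) \<Rightarrow> (nat \<Rightarrow> nat \<Rightarrow> real) \<Rightarrow> nat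
      \<Rightarrow> (nat \<Rightarrow> real) \<Rightarrow> nat \<Rightarrow> real" where
  "relu_net m W v 0 x = x"
| "relu_net m W v (Suc k) x =
     (\<lambda>i\<in>{1..m (Suc k)}. relu ((\<Sum>j=1..m k. W k i j * relu_net m W v k x j) - v (Suc k) i))"

definition fc_class ::
    "((nat \<Rightarrow> real) \<Rightarrow> 'a) \<Rightarrow> nat \<Rightarrow> (nat \<Rightarrow> nat) \<Rightarrow> ((nat \<Rightarrow> real) \<Rightarrow> 'a) set" where
  "fc_class \<psi> L m =
     {(\<lambda>x. \<psi> (relu_net m W v (L + 1) x)) | W v.
        (\<forall>k\<le>L. \<forall>i\<in>{1..m (k + 1)}. \<forall>j\<in>{1..m k}. \<bar>W k i j\<bar> \<le> 1) \<and>
        (\<forall>k\<in>{1..L+1}. \<forall>i\<in>{1..m k}. \<bar>v k i\<bar> \<le> 1)}"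

definition softmax :: "(nat \<Rightarrow> real) \<Rightarrow> real \<times> real" where
  "softmax x = (exp (x 1) / (exp (x 1) + exp (x 2)), exp (x 2) / (exp (x 1) + exp (x 2)))"

definition cnn_depth :: "nat \<Rightarrow> nat" where
  "cnn_depth m = 1 + 2 * nat \<lceil>log 2 (real m)\<rceil>"

definition cnn_widths :: "nat \<Rightarrow> nat \<Rightarrow> nat" where
  "cnn_widths m k = (if k = 0 then 2 * m else if k \<le> cnn_depth m then 4 * m else 2)"

definition cnn_class :: "nat \<Rightarrow> real \<Rightarrow> nat \<Rightarrow> (image \<Rightarrow> real \<times> real) set" where
  "cnn_class d \<alpha> m =
     {f \<circ> g | f g. f \<in> fc_class softmax (cnn_depth m) (cnn_widths m) \<and>
                   g \<in> conv_class d \<alpha> (2 * m)}"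

definition rho :: "real \<Rightarrow> real" where
  "rho z = 1 / (1 + exp z)"

definition clip :: "real \<Rightarrow> real" where
  "clip t = min (max t (rho 1)) (rho (-1))"

definition clipped_cnn_class :: "nat \<Rightarrow> real \<Rightarrow> nat \<Rightarrow> (image \<Rightarrow> real \<times> real) set" where
  "clipped_cnn_class d \<alpha> m =
     {(\<lambda>X. (1 - clip (g X), clip (g X))) | g. (\<lambda>X. (1 - g X, g X)) \<in> cnn_class d \<alpha> m}"

type_synonym sample = "nat \<Rightarrow> image \<times> bool"

definition sample_space :: "nat \<Rightarrow> nat \<Rightarrow> sample measure" where
  "sample_space d n = (\<Pi>\<^sub>M i\<in>{1..n}. image_space d \<Otimes>\<^sub>M label_space)"

definition ce_risk :: "nat \<Rightarrow> nat \<Rightarrow> sample \<Rightarrow> (image \<Rightarrow> real \<times> real) \<Rightarrow> real" where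
  "ce_risk d n S q = - (1 / real n) *
     (\<Sum>i=1..n. let p = snd (q (normalize_image d (fst (S i)))); k = of_bool (snd (S i)) in
        k * ln p + (1 - k) * ln (1 - p))"

(* An estimator maps the sample to a function of the image. Joint measurability makes the
   misclassification event below measurable. *)
definition ce_minimizer ::
    "nat \<Rightarrow> real \<Rightarrow> nat \<Rightarrow> nat \<Rightarrow> (sample \<Rightarrow> image \<Rightarrow> real \<times> real) \<Rightarrow> bool" where
  "ce_minimizer d \<alpha> m n p \<longleftrightarrow>
     (\<forall>S\<in>space (sample_space d n).
        is_arg_min (ce_risk d n S) (\<lambda>q. q \<in> clipped_cnn_class d \<alpha> m) (p S)) \<and>
     (\<lambda>(S, X). snd (p S X)) \<in> borel_measurable (sample_space d n \<Otimes>\<^sub>M image_space d)"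

definition plug_in_classifier ::
    "nat \<Rightarrow> (sample \<Rightarrow> image \<Rightarrow> real \<times> real) \<Rightarrow> sample \<Rightarrow> image \<Rightarrow> bool" where
  "plug_in_classifier d p S X \<longleftrightarrow> snd (p S (normalize_image d X)) > 1 / 2"

definition misclassification_prob ::
    "nat \<Rightarrow> (image \<times> bool) measure \<Rightarrow> nat \<Rightarrow> (sample \<Rightarrow> image \<Rightarrow> real \<times> real) \<Rightarrow> real" where
  "misclassification_prob d \<mu> n p =
     \<P>((S, X, k) in (\<Pi>\<^sub>M i\<in>{1..n}. \<mu>) \<Otimes>\<^sub>M \<mu>. plug_in_classifier d p S X \<noteq> k)"

end

theory Submission
  imports Defs
begin

text \<open>
  The model is realizable with a margin. For each deformation in the finite cover and each of the two
  templates take as filter the normalized deformed template, sampled on blocks. Up to the constant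
  factors that depend on the Lipschitz bounds only, every deformed template is within
  \<open>d powr (- \<alpha>)\<close> of a shift of a deformed template in the cover, so the largest normalized correlation
  with the filters of the correct class is at least \<open>1 - c * d powr (- \<alpha>)\<close>, while by the separation
  condition all correlations with filters of the wrong class stay below this by at least
  \<open>d powr (- \<alpha>) \<ge> 1 / m\<close>. Thresholding the features between the two levels and summing over classes in
  the remaining layers amplifies this gap to at least 1, so the class contains a network whose logit
  has the right sign with margin 1 on every image.

  Hence the minimal clipped cross entropy is attained and every empirical risk minimizer reaches the
  clipping value on all sample points. The logits of all networks in the class share a Lipschitz
  constant, so after cutting the cube of normalized images into finitely many small cells the
  classifier is right on every cell that contains a sample point. The risk is therefore at most the
  expected mass of the cells missed by the sample, which is of order \<open>1 / n\<close>.
\<close>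

section \<open>Cells missed by a sample\<close>

text \<open>The threshold for \<open>n\<close> may depend on the whole model, on \<open>d\<close>
  and on the network class. A bound \<open>c / n\<close> with an enormous \<open>c\<close> therefore
  suffices, since the factor \<open>ln n powr (1 + \<gamma>)\<close> eventually exceeds every
  constant; this is also why the universal constant can be 1. The obstacle is that the minimizer is
  an arbitrary member of the class, selected by the sample, so everything said about its logit must
  hold uniformly over the class. Clipping is what makes interpolation quantitative: reaching the
  clipping value forces a logit of absolute value at least 1.

  The separation hypothesis is used twice. It keeps the correlations with the wrong class down, and,
  since the separation quantity never exceeds 1, it forces \<open>d powr (- \<alpha>)\<close> below
  the inverse of the constant, from which all smallness conditions on the resolution follow. In both
  correlation estimates the discretization enters through a squared distance, hence with order
  \<open>d powr (- 2 * \<alpha>)\<close>, against a separation of order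
  \<open>d powr (- \<alpha>)\<close>.\<close>

lemma mult_one_minus_power_le:
  fixes p :: real
  assumes "0 \<le> p" "p \<le> 1"
  shows "p * (1 - p) ^ n \<le> 1 / (real n + 1)"
proof -
  let ?q = "1 - p"
  \<comment> \<open>The last power is the smallest of the geometric sum, which becomes at most 1
    after multiplication by p.\<close>
  have "(real n + 1) * ?q ^ n = (\<Sum>k<Suc n. ?q ^ n)" by simp
  also have "\<dots> \<le> (\<Sum>k<Suc n. ?q ^ k)"
    by (intro sum_mono power_decreasing) (use assms in auto)
  finally have "p * ((real n + 1) * ?q ^ n) \<le> p * (\<Sum>k<Suc n. ?q ^ k)"
    using assms by (intro mult_left_mono) auto
  also have "\<dots> = 1 - ?q ^ Suc n"
    using one_diff_power_eq[of ?q "Suc n"] by simp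
  also have "\<dots> \<le> 1" using assms by simp
  finally show ?thesis by (simp add: field_simps)
qed

text \<open>The new point falls into a cell of mass p that the whole sample avoids with probability
  \<open>p * (1 - p) ^ n\<close>. This is at most \<open>1 / (n + 1)\<close> for every p, so the
  bound involves only the number of cells and not their masses.\<close>

lemma missing_mass:
  fixes c :: "'a \<Rightarrow> 'c" and n :: nat
  assumes \<mu>: "prob_space \<mu>" and fin: "finite C" and c: "c \<in> \<mu> \<rightarrow>\<^sub>M count_space C"
  defines "M \<equiv> (\<Pi>\<^sub>M i\<in>{1..n}. \<mu>) \<Otimes>\<^sub>M \<mu>"
  defines "U \<equiv> {\<omega> \<in> space M. \<forall>i\<in>{1..n}. c (fst \<omega> i) \<noteq> c (snd \<omega>)}"
  shows "U \<in> sets M" and "measure M U \<le> real (card C) / (real n + 1)"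
proof -
  interpret \<mu>: prob_space \<mu> by fact
  interpret P: finite_product_prob_space "\<lambda>_. \<mu>" "{1..n}" by standard auto
  interpret PP: prob_space "\<Pi>\<^sub>M i\<in>{1..n}. \<mu>" by (intro prob_space_PiM \<mu>)
  interpret pair_prob_space "\<Pi>\<^sub>M i\<in>{1..n}. \<mu>" \<mu> by standard
  define E where "E y = c -` {y} \<inter> space \<mu>" for y
  define Z where "Z y = (\<Pi>\<^sub>E i\<in>{1..n}. space \<mu> - E y) \<times> E y" for y
  have E: "E y \<in> sets \<mu>" if "y \<in> C" for y
    unfolding E_def using c that by (intro measurable_sets[OF c]) auto
  have cC: "c x \<in> C" if "x \<in> space \<mu>" for x
    using measurable_space[OF c that] by simp
  have U: "U = (\<Union>y\<in>C. Z y)"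
    unfolding U_def M_def Z_def E_def space_pair_measure space_PiM
    by (auto simp: cC PiE_iff) 
  have box: "(\<Pi>\<^sub>E i\<in>{1..n}. space \<mu> - E y) \<in> sets (\<Pi>\<^sub>M i\<in>{1..n}. \<mu>)" if "y \<in> C" for y
    using E[OF that] by (intro sets_PiM_I_finite) auto
  have Z: "Z y \<in> sets M" if "y \<in> C" for y
    unfolding Z_def M_def using box E that by auto
  show "U \<in> sets M" unfolding U using Z fin by auto
  have mZ: "measure M (Z y) \<le> 1 / (real n + 1)" if y: "y \<in> C" for y
  proof -
    have "measure (\<Pi>\<^sub>M i\<in>{1..n}. \<mu>) (\<Pi>\<^sub>E i\<in>{1..n}. space \<mu> - E y)
        = (\<Prod>i\<in>{1..n}. measure \<mu> (space \<mu> - E y))"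
      using E[OF y] by (intro P.prob_times) auto
    also have "\<dots> = (1 - measure \<mu> (E y)) ^ n"
      by (simp add: \<mu>.prob_compl[OF E[OF y]])
    finally have "measure M (Z y) = (1 - measure \<mu> (E y)) ^ n * measure \<mu> (E y)"
      unfolding M_def Z_def using box[OF y] E[OF y]
      by (simp add: measure_def \<mu>.emeasure_pair_measure_Times enn2real_mult)
    then show ?thesis
      using mult_one_minus_power_le[of "measure \<mu> (E y)" n] by (simp add: mult.commute)
  qed
  have "measure M U \<le> (\<Sum>y\<in>C. measure M (Z y))"
    unfolding U using Z fin by (intro measure_UNION_le) auto
  also have "\<dots> \<le> (\<Sum>y\<in>C. 1 / (real n + 1))" by (intro sum_mono mZ)
  finally show "measure M U \<le> real (card C) / (real n + 1)" by simp
qed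

lemma AE_sample_and_new:
  fixes n :: nat
  assumes \<mu>: "prob_space \<mu>" and P: "AE x in \<mu>. P x"
  shows "AE \<omega> in (\<Pi>\<^sub>M i\<in>{1..n}. \<mu>) \<Otimes>\<^sub>M \<mu>. P (snd \<omega>) \<and> (\<forall>i\<in>{1..n}. P (fst \<omega> i))"
proof -
  interpret \<mu>: prob_space \<mu> by fact
  interpret PP: prob_space "\<Pi>\<^sub>M i\<in>{1..n}. \<mu>" by (intro prob_space_PiM \<mu>)
  interpret pair_prob_space "\<Pi>\<^sub>M i\<in>{1..n}. \<mu>" \<mu> by standard
  let ?Pi = "\<Pi>\<^sub>M i\<in>{1..n}. \<mu>"
  have "AE S in ?Pi. P (S i)" if "i \<in> {1..n}" for i
    using \<mu> that P by (rule AE_PiM_component)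
  then have "AE S in ?Pi. \<forall>i\<in>{1..n}. P (S i)"
    by (intro AE_finite_allI) auto
  then have 1: "AE \<omega> in ?Pi \<Otimes>\<^sub>M \<mu>. \<forall>i\<in>{1..n}. P (fst \<omega> i)"
    by (intro AE_distrD[of fst _ ?Pi]) (simp_all only: \<mu>.distr_pair_fst measurable_fst)
  obtain N where N: "N \<in> sets \<mu>" "emeasure \<mu> N = 0" "{x \<in> space \<mu>. \<not> P x} \<subseteq> N"
    using AE_E[OF P] by metis
  have "emeasure (?Pi \<Otimes>\<^sub>M \<mu>) (space ?Pi \<times> N) = 0"
    using N by (simp add: \<mu>.emeasure_pair_measure_Times)
  then have 2: "AE \<omega> in ?Pi \<Otimes>\<^sub>M \<mu>. P (snd \<omega>)"
    using N by (intro AE_I[where N = "space ?Pi \<times> N"]) (auto simp: space_pair_measure)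
  show ?thesis using 1 2 by eventually_elim auto
qed

section \<open>Lipschitz bounds for the networks\<close>

lemma relu_lipschitz: "\<bar>relu x - relu y\<bar> \<le> \<bar>x - y\<bar>"
  by (simp add: relu_def)

text \<open>Weights are bounded by 1, biases cancel and \<open>relu\<close> is 1-Lipschitz, so a
  layer multiplies the sup distance by at most its number of inputs. The constant involves neither
  \<open>W\<close> nor \<open>v\<close> and is thus common to the class.\<close>

lemma relu_net_lipschitz:
  assumes W: "\<And>k i j. k < K \<Longrightarrow> i \<in> {1..m (Suc k)} \<Longrightarrow> j \<in> {1..m k} \<Longrightarrow> \<bar>W k i j\<bar> \<le> 1"
    and x: "\<And>j. j \<in> {1..m 0} \<Longrightarrow> \<bar>x j - x' j\<bar> \<le> \<delta>"
    and "i \<in> {1..m K}"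
  shows "\<bar>relu_net m W v K x i - relu_net m W v K x' i\<bar> \<le> (\<Prod>k<K. real (m k)) * \<delta>"
  using W \<open>i \<in> {1..m K}\<close>
proof (induction K arbitrary: i)
  case 0
  then show ?case using x by simp
next
  case (Suc K)
  let ?y = "relu_net m W v K x" and ?y' = "relu_net m W v K x'"
  let ?\<epsilon> = "(\<Prod>k<K. real (m k)) * \<delta>"
  have IH: "\<bar>?y j - ?y' j\<bar> \<le> ?\<epsilon>" if "j \<in> {1..m K}" for j
    using Suc.prems that by (intro Suc.IH) auto
  have "\<bar>relu_net m W v (Suc K) x i - relu_net m W v (Suc K) x' i\<bar>
      \<le> \<bar>((\<Sum>j=1..m K. W K i j * ?y j) - v (Suc K) i) - ((\<Sum>j=1..m K. W K i j * ?y' j) - v (Suc K) i)\<bar>"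
    using Suc.prems(2) relu_lipschitz[of "(\<Sum>j=1..m K. W K i j * ?y j) - v (Suc K) i"
        "(\<Sum>j=1..m K. W K i j * ?y' j) - v (Suc K) i"] by simp
  also have "\<dots> = \<bar>\<Sum>j=1..m K. W K i j * (?y j - ?y' j)\<bar>"
    by (simp add: right_diff_distrib sum_subtractf)
  also have "\<dots> \<le> (\<Sum>j=1..m K. \<bar>W K i j * (?y j - ?y' j)\<bar>)" by (rule sum_abs)
  also have "\<dots> \<le> (\<Sum>j=1..m K. 1 * ?\<epsilon>)"
    unfolding abs_mult using Suc.prems IH by (intro sum_mono mult_mono) auto
  finally show ?case by (simp add: mult_ac)
qed

lemma Max_image_lipschitz:
  fixes f g :: "'a \<Rightarrow> real"
  assumes "finite A" "A \<noteq> {}" "\<And>x. x \<in> A \<Longrightarrow> \<bar>f x - g x\<bar> \<le> \<epsilon>"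
  shows "\<bar>Max (f ` A) - Max (g ` A)\<bar> \<le> \<epsilon>"
proof -
  have "Max (f ` A) \<le> Max (g ` A) + \<epsilon>" if fg: "\<And>x. x \<in> A \<Longrightarrow> \<bar>f x - g x\<bar> \<le> \<epsilon>" for f g :: "'a \<Rightarrow> real"
  proof -
    have "f x \<le> Max (g ` A) + \<epsilon>" if x: "x \<in> A" for x
    proof -
      have "g x \<le> Max (g ` A)" using x assms(1) by auto
      then show ?thesis using fg[OF x] by linarith
    qed
    then show ?thesis using assms by (subst Max_le_iff) auto
  qed
  from this[of f g] this[of g f] show ?thesis using assms(3) by (force simp: abs_minus_commute)
qed

lemma convolution_lipschitz:
  assumes cov: "covers_support d W (l, a, b)"
    and W: "\<And>p. p \<in> {1..d} \<times> {1..d} \<Longrightarrow> \<bar>W p\<bar> \<le> 1"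
    and X: "\<And>p. p \<in> {1..d} \<times> {1..d} \<Longrightarrow> \<bar>X p - X' p\<bar> \<le> \<delta>" and \<delta>: "0 \<le> \<delta>"
  shows "\<bar>convolution d W (l, a, b) X ij - convolution d W (l, a, b) X' ij\<bar> \<le> (real d)\<^sup>2 * \<delta>"
proof -
  obtain i j where ij: "ij = (i, j)" by force
  have l: "a + l \<le> d" "b + l \<le> d" using cov by (auto simp: covers_support_def)
  have pad: "\<bar>pad d l X r - pad d l X' r\<bar> \<le> \<delta>" for r
  proof (cases r)
    case (Pair r1 r2)
    then show ?thesis using X[of "(r1 - l, r2 - l)"] \<delta> by (auto simp: pad_def le_diff_conv le_diff_conv2)
  qed
  have "\<bar>convolution d W (l, a, b) X ij - convolution d W (l, a, b) X' ij\<bar>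
      = \<bar>\<Sum>p<l. \<Sum>q<l. W (a + 1 + p, b + 1 + q) * (pad d l X (i + p, j + q) - pad d l X' (i + p, j + q))\<bar>"
    by (simp add: convolution_def ij right_diff_distrib sum_subtractf)
  also have "\<dots> \<le> (\<Sum>p<l. \<Sum>q<l. \<bar>W (a + 1 + p, b + 1 + q) * (pad d l X (i + p, j + q) - pad d l X' (i + p, j + q))\<bar>)"
    by (intro order_trans[OF sum_abs] sum_mono sum_abs)
  also have "\<dots> \<le> (\<Sum>p<l. \<Sum>q<l. 1 * \<delta>)"
    unfolding abs_mult using l pad \<delta> by (intro sum_mono mult_mono W) auto
  also have "\<dots> = (real l)\<^sup>2 * \<delta>" by (simp add: power2_eq_square)
  \<comment> \<open>The filter size varies over the class; bounding it by d makes the constant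
    uniform.\<close>
  also have "\<dots> \<le> (real d)\<^sup>2 * \<delta>" using l \<delta> by (intro mult_right_mono power_mono) auto
  finally show ?thesis .
qed

lemma conv_feature_lipschitz:
  assumes "covers_support d W (l, a, b)"
    and "\<And>p. p \<in> {1..d} \<times> {1..d} \<Longrightarrow> \<bar>W p\<bar> \<le> 1"
    and "\<And>p. p \<in> {1..d} \<times> {1..d} \<Longrightarrow> \<bar>X p - X' p\<bar> \<le> \<delta>" and "0 \<le> \<delta>"
  shows "\<bar>conv_feature d W (l, a, b) X - conv_feature d W (l, a, b) X'\<bar> \<le> (real d)\<^sup>2 * \<delta>"
proof -
  have "\<bar>\<bar>relu (convolution d W (l, a, b) X ij)\<bar> - \<bar>relu (convolution d W (l, a, b) X' ij)\<bar>\<bar>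
      \<le> (real d)\<^sup>2 * \<delta>" for ij
  proof -
    have "\<bar>convolution d W (l, a, b) X ij - convolution d W (l, a, b) X' ij\<bar> \<le> (real d)\<^sup>2 * \<delta>"
      using assms by (rule convolution_lipschitz)
    then show ?thesis
      using relu_lipschitz[of "convolution d W (l, a, b) X ij" "convolution d W (l, a, b) X' ij"]
      by linarith
  qed
  then show ?thesis
    unfolding conv_feature_def by (auto intro!: Max_image_lipschitz)
qed

text \<open>\<open>rho\<close> is the reflected, decreasing logistic function, so class 1 is
  predicted where the logit \<open>y 1 - y 2\<close> is negative. All later signs follow this
  orientation.\<close>

lemma snd_softmax: "snd (softmax y) = rho (y 1 - y 2)"
proof -
  have "exp (y 1) = exp (y 2) * exp (y 1 - y 2)" by (simp flip: exp_add)
  then have "exp (y 1) + exp (y 2) = exp (y 2) * (1 + exp (y 1 - y 2))"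
    by (simp add: algebra_simps)
  then show ?thesis by (simp add: softmax_def rho_def)
qed

lemma rho_le_iff: "rho x \<le> rho y \<longleftrightarrow> y \<le> x"
  by (simp add: rho_def field_simps add_pos_pos)

lemma rho_0: "rho 0 = 1 / 2" by (simp add: rho_def)

lemma one_minus_rho: "1 - rho x = rho (- x)"
proof -
  have "1 + exp x \<noteq> 0" using exp_gt_zero[of x] by linarith
  then show ?thesis by (simp add: rho_def exp_minus field_simps)
qed

text \<open>The constant is obtained before g, hence valid for the whole class. The logit is tracked
  instead of g because a change by less than 1 cannot carry it from distance 1 across 0.\<close>

lemma cnn_class_logit_lipschitz:
  obtains \<Lambda> where "0 \<le> \<Lambda>"
    and "\<And>g. (\<lambda>X. (1 - g X, g X)) \<in> cnn_class d \<alpha> m \<Longrightarrow>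
      \<exists>z. (\<forall>X. g X = rho (z X)) \<and>
        (\<forall>X X' \<delta>. 0 \<le> \<delta> \<longrightarrow> (\<forall>p\<in>{1..d} \<times> {1..d}. \<bar>X p - X' p\<bar> \<le> \<delta>) \<longrightarrow> \<bar>z X - z X'\<bar> \<le> \<Lambda> * \<delta>)"
proof -
  let ?L = "cnn_depth m + 1" and ?w = "cnn_widths m"
  let ?P = "\<Prod>k<?L. real (?w k)"
  have *: "\<exists>z. (\<forall>X. g X = rho (z X)) \<and>
        (\<forall>X X' \<delta>. 0 \<le> \<delta> \<longrightarrow> (\<forall>p\<in>{1..d} \<times> {1..d}. \<bar>X p - X' p\<bar> \<le> \<delta>) \<longrightarrow>
          \<bar>z X - z X'\<bar> \<le> (2 * ?P * (real d)\<^sup>2) * \<delta>)"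
    if g: "(\<lambda>X. (1 - g X, g X)) \<in> cnn_class d \<alpha> m" for g
  proof -
    obtain F G where FG: "(\<lambda>X. (1 - g X, g X)) = F \<circ> G"
      "F \<in> fc_class softmax (cnn_depth m) ?w" "G \<in> conv_class d \<alpha> (2 * m)"
      using g unfolding cnn_class_def by auto
    obtain W v where F: "F = (\<lambda>x. softmax (relu_net ?w W v ?L x))"
      and W: "\<And>k i j. k \<le> cnn_depth m \<Longrightarrow> i \<in> {1..?w (Suc k)} \<Longrightarrow> j \<in> {1..?w k} \<Longrightarrow> \<bar>W k i j\<bar> \<le> 1"
      using FG(2) unfolding fc_class_def by auto
    obtain V q where G: "G = (\<lambda>X. \<lambda>s\<in>{1..2*m}. conv_feature d (V s) (q s) X)"
      and q: "\<And>s. s \<in> {1..2*m} \<Longrightarrow> quadratic_support d (V s) (q s)"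
      and V: "\<And>s p. s \<in> {1..2*m} \<Longrightarrow> p \<in> {1..d} \<times> {1..d} \<Longrightarrow> \<bar>V s p\<bar> \<le> 1"
      using FG(3) unfolding conv_class_def by blast
    define y where "y X = relu_net ?w W v ?L (G X)" for X
    define z where "z X = y X 1 - y X 2" for X
    have "g X = rho (z X)" for X
    proof -
      have "g X = snd ((F \<circ> G) X)" unfolding FG(1)[symmetric] by simp
      then show ?thesis by (simp add: F y_def z_def snd_softmax)
    qed
    moreover have "\<bar>z X - z X'\<bar> \<le> (2 * ?P * (real d)\<^sup>2) * \<delta>"
      if \<delta>: "0 \<le> \<delta>" and X: "\<forall>p\<in>{1..d} \<times> {1..d}. \<bar>X p - X' p\<bar> \<le> \<delta>" for X X' \<delta>
    proof -
      have G_diff: "\<bar>G X s - G X' s\<bar> \<le> (real d)\<^sup>2 * \<delta>" if s: "s \<in> {1..?w 0}" for s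
      proof -
        have s: "s \<in> {1..2*m}" using s by (simp add: cnn_widths_def)
        obtain l a b where lab: "q s = (l, a, b)" by (cases "q s")
        have "covers_support d (V s) (l, a, b)" using q[OF s] lab by (simp add: quadratic_support_def)
        then have "\<bar>conv_feature d (V s) (q s) X - conv_feature d (V s) (q s) X'\<bar> \<le> (real d)\<^sup>2 * \<delta>"
          unfolding lab using V[OF s] X \<delta> by (intro conv_feature_lipschitz) auto
        then show ?thesis using s by (simp add: G)
      qed
      have "\<bar>y X i - y X' i\<bar> \<le> ?P * ((real d)\<^sup>2 * \<delta>)" if i: "i \<in> {1, 2}" for i
        unfolding y_def using W G_diff i
        by (intro relu_net_lipschitz) (auto simp: cnn_widths_def)
      from this[of 1] this[of 2] show ?thesis by (simp add: z_def algebra_simps)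
    qed
    ultimately show ?thesis by blast
  qed
  show ?thesis by (rule that[OF _ *]) (auto intro!: mult_nonneg_nonneg prod_nonneg)
qed

section \<open>A thresholding network\<close>

text \<open>Each parity class has \<open>2 * m\<close> members; \<open>m\<close> is already the
  growth factor that compensates a gap of \<open>1 / m\<close>.\<close>

lemma card_parity_ge: "m \<le> card {j \<in> {1..4 * m}. even j = b}"
proof -
  have "card ((\<lambda>t. 2 * t - of_bool (\<not> b)) ` {1..m}) = m"
    by (subst card_image) (auto simp: inj_on_def)
  moreover have "(\<lambda>t. 2 * t - of_bool (\<not> b)) ` {1..m} \<subseteq> {j \<in> {1..4 * m}. even j = b}"
    by auto
  ultimately show ?thesis
    using card_mono[of "{j \<in> {1..4 * m}. even j = b}" "(\<lambda>t. 2 * t - of_bool (\<not> b)) ` {1..m}"] by simp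
qed

text \<open>Units of equal parity are summed in every layer after the first, so as soon as only
  one parity survives the thresholding, its activations grow with the width.\<close>

definition parity_weights :: "nat \<Rightarrow> nat \<Rightarrow> nat \<Rightarrow> real" where
  "parity_weights k i j = (if k = 0 then of_bool (i = j) else of_bool (even i = even j))"

definition threshold_bias :: "real \<Rightarrow> nat \<Rightarrow> nat \<Rightarrow> real" where
  "threshold_bias \<tau> k i = (if k = 1 then \<tau> else 0)"

text \<open>A unit with index beyond the input width receives 0 and outputs
  \<open>relu (- \<tau>)\<close>, which vanishes as \<open>0 \<le> \<tau>\<close>.\<close>

lemma parity_net_first:
  assumes "i \<in> {1..m 1}" "0 \<le> \<tau>"
  shows "relu_net m parity_weights (threshold_bias \<tau>) 1 x i = (if i \<le> m 0 then relu (x i - \<tau>) else 0)"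
proof -
  have "(\<Sum>j=1..m 0. parity_weights 0 i j * x j) = (if i \<le> m 0 then x i else 0)"
    using assms by (simp add: parity_weights_def of_bool_def if_distrib[of "\<lambda>t. t * _"] cong: if_cong)
  then show ?thesis using assms by (simp add: threshold_bias_def relu_def)
qed

lemma parity_net_step:
  assumes "i \<in> {1..m (Suc k)}" "1 \<le> k"
  shows "relu_net m parity_weights (threshold_bias \<tau>) (Suc k) x i
    = relu (\<Sum>j\<in>{j \<in> {1..m k}. even j = even i}. relu_net m parity_weights (threshold_bias \<tau>) k x j)"
proof -
  have "(\<Sum>j=1..m k. parity_weights k i j * y j) = (\<Sum>j=1..m k. if even j = even i then y j else 0)" for y
    using assms by (intro sum.cong) (auto simp: parity_weights_def)
  then have "(\<Sum>j=1..m k. parity_weights k i j * y j) = (\<Sum>j\<in>{j \<in> {1..m k}. even j = even i}. y j)" for y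
    by (simp only: sum.inter_filter[OF finite_atLeastAtMost])
  then show ?thesis using assms by (simp add: threshold_bias_def)
qed

text \<open>After the first layer no weight connects different parities, so a parity switched off by
  the threshold stays at 0, whatever the other one does.\<close>

lemma parity_net_silent:
  assumes "0 \<le> \<tau>" and silent: "\<And>j. j \<in> {1..m 0} \<Longrightarrow> even j = b \<Longrightarrow> x j \<le> \<tau>"
    and "1 \<le> k" "i \<in> {1..m k}" "even i = b"
  shows "relu_net m parity_weights (threshold_bias \<tau>) k x i = 0"
  using \<open>1 \<le> k\<close> \<open>i \<in> {1..m k}\<close> \<open>even i = b\<close>
proof (induction k arbitrary: i rule: dec_induct)
  case base
  then show ?case using assms(1) silent[of i] by (subst parity_net_first) (auto simp: relu_def)
next
  case (step k)
  then have "(\<Sum>j\<in>{j \<in> {1..m k}. even j = even i}. relu_net m parity_weights (threshold_bias \<tau>) k x j) = 0"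
    by (intro sum.neutral) auto
  then show ?case using step by (subst parity_net_step) (auto simp: relu_def)
qed

lemma relu_nonneg: "0 \<le> relu x"
  by (simp add: relu_def)

lemma relu_net_nonneg:
  assumes "1 \<le> k" "i \<in> {1..m k}"
  shows "0 \<le> relu_net m W v k x i"
  using assms by (cases k) (auto simp: relu_nonneg)

text \<open>The second layer may find a single active unit in the first one and so inherits only
  \<open>e\<close>; every further layer sums at least \<open>m\<close> units of that size. Hence the
  exponent \<open>K - 1\<close>. The width of layer \<open>Suc K\<close> is left open because the
  output layer is narrow.\<close>

lemma parity_net_active:
  fixes m :: nat
  assumes "0 \<le> \<tau>" "0 < m" and w: "w 0 = 2 * m" "\<And>k. k \<in> {1..K} \<Longrightarrow> w k = 4 * m"
    and s: "s \<in> {1..2 * m}" "even s = b" "\<tau> + e \<le> x s" and e: "0 \<le> e"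
    and K: "1 \<le> K" and i: "i \<in> {1..w (Suc K)}" "even i = b"
  shows "real m ^ (K - 1) * e \<le> relu_net w parity_weights (threshold_bias \<tau>) (Suc K) x i"
  using K w(2) i
proof (induction K arbitrary: i rule: dec_induct)
  case base
  let ?y = "relu_net w parity_weights (threshold_bias \<tau>) 1 x"
  have w1: "w 1 = 4 * m" using base by auto
  have "e \<le> ?y s"
    using s w(1) w1 \<open>0 \<le> \<tau>\<close> by (subst parity_net_first) (auto simp: relu_def)
  also have "\<dots> \<le> (\<Sum>j\<in>{j \<in> {1..w 1}. even j = even i}. ?y j)"
    using s w1 base by (intro member_le_sum) (auto intro!: relu_net_nonneg simp del: relu_net.simps)
  finally show ?case
    using base by (subst parity_net_step) (auto simp: relu_def simp del: relu_net.simps)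
next
  case (step k)
  let ?y = "relu_net w parity_weights (threshold_bias \<tau>) (Suc k) x"
  let ?J = "{j \<in> {1..w (Suc k)}. even j = even i}"
  have wk: "w (Suc k) = 4 * m" using step by auto
  have IH: "real m ^ (k - 1) * e \<le> ?y j" if "j \<in> ?J" for j
    using that step by (intro step.IH) auto
  have "real m ^ (Suc k - 1) * e = real m * (real m ^ (k - 1) * e)"
    using step by (cases k) auto
  also have "\<dots> \<le> real (card ?J) * (real m ^ (k - 1) * e)"
    unfolding wk using card_parity_ge[of m "even i"] e by (intro mult_right_mono) auto
  also have "\<dots> = (\<Sum>j\<in>?J. real m ^ (k - 1) * e)" by simp
  also have "\<dots> \<le> (\<Sum>j\<in>?J. ?y j)" by (intro sum_mono IH)
  finally show ?case
    using step by (subst parity_net_step) (auto simp: relu_def simp del: relu_net.simps)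
qed

text \<open>Even features vote for class 1 through output 2, odd ones for class 0 through output 1.
  In both situations one output is 0 and the other at least 1, which puts the logit at or beyond -1
  or 1.\<close>

lemma cnn_class_threshold:
  fixes m :: nat and \<tau> e :: real
  assumes m: "2 \<le> m" and \<tau>: "0 \<le> \<tau>" "\<tau> \<le> 1" and e: "1 / real m \<le> e"
    and W: "\<And>s. s \<in> {1..2 * m} \<Longrightarrow> quadratic_support d (W s) (q s) \<and> block_structure \<alpha> d (W s) \<and>
          (\<forall>p\<in>{1..d} \<times> {1..d}. \<bar>W s p\<bar> \<le> 1)"
  obtains g where "(\<lambda>X. (1 - g X, g X)) \<in> cnn_class d \<alpha> m"
    and "\<And>X. (\<And>s. s \<in> {1..2 * m} \<Longrightarrow> odd s \<Longrightarrow> conv_feature d (W s) (q s) X \<le> \<tau>) \<Longrightarrow>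
          (\<exists>s\<in>{1..2 * m}. even s \<and> \<tau> + e \<le> conv_feature d (W s) (q s) X) \<Longrightarrow> rho (-1) \<le> g X"
    and "\<And>X. (\<And>s. s \<in> {1..2 * m} \<Longrightarrow> even s \<Longrightarrow> conv_feature d (W s) (q s) X \<le> \<tau>) \<Longrightarrow>
          (\<exists>s\<in>{1..2 * m}. odd s \<and> \<tau> + e \<le> conv_feature d (W s) (q s) X) \<Longrightarrow> g X \<le> rho 1"
proof -
  let ?K = "cnn_depth m" and ?w = "cnn_widths m"
  define G where "G = (\<lambda>X. \<lambda>s\<in>{1..2*m}. conv_feature d (W s) (q s) X)"
  define y where "y X = relu_net ?w parity_weights (threshold_bias \<tau>) (?K + 1) (G X)" for X
  define g where "g X = rho (y X 1 - y X 2)" for X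
  \<comment> \<open>Depth at least 2 means at least one multiplication by m, which raises the gap
    \<open>1 / m\<close> to 1.\<close>
  have K: "2 \<le> ?K"
  proof -
    have "1 \<le> log 2 (real m)" using m by (simp add: le_log_iff)
    then have "1 \<le> nat \<lceil>log 2 (real m)\<rceil>" by linarith
    then show ?thesis by (simp add: cnn_depth_def)
  qed
  have "1 \<le> real m * e" using e m by (simp add: field_simps)
  also have "\<dots> \<le> real m ^ (?K - 1) * e"
    using K m e by (intro mult_right_mono) (auto intro!: self_le_power order_trans[OF _ e])
  finally have amp: "1 \<le> real m ^ (?K - 1) * e" .
  have "0 \<le> e" using e by (meson divide_nonneg_nonneg of_nat_0_le_iff order_trans zero_le_one)
  have wK: "?w (?K + 1) = 2" by (auto simp: cnn_widths_def)
  have active: "1 \<le> y X i"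
    if "s \<in> {1..2*m}" "even s = even i" "\<tau> + e \<le> conv_feature d (W s) (q s) X" "i \<in> {1, 2}" for X s i
    unfolding y_def Suc_eq_plus1[symmetric] using that K m \<tau> \<open>0 \<le> e\<close> wK
    by (intro order_trans[OF amp] parity_net_active[where s = s and b = "even i"]) (auto simp: cnn_widths_def G_def)
  have silent: "y X i = 0"
    if "\<And>s. s \<in> {1..2*m} \<Longrightarrow> even s = even i \<Longrightarrow> conv_feature d (W s) (q s) X \<le> \<tau>" "i \<in> {1, 2}" for X i
    unfolding y_def using that \<tau> wK by (intro parity_net_silent) (auto simp: cnn_widths_def G_def)
  have "(\<lambda>X. (1 - g X, g X)) = (\<lambda>x. softmax (relu_net ?w parity_weights (threshold_bias \<tau>) (?K + 1) x)) \<circ> G"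
  proof
    fix X
    have "fst (softmax (y X)) + snd (softmax (y X)) = 1"
      using add_pos_pos[of "exp (y X 1)" "exp (y X 2)"] by (simp add: softmax_def add_divide_distrib[symmetric])
    then show "(1 - g X, g X) = ((\<lambda>x. softmax (relu_net ?w parity_weights (threshold_bias \<tau>) (?K + 1) x)) \<circ> G) X"
      unfolding o_def y_def[symmetric] g_def snd_softmax[symmetric] by (simp add: prod_eq_iff)
  qed
  moreover have "(\<lambda>x. softmax (relu_net ?w parity_weights (threshold_bias \<tau>) (?K + 1) x)) \<in> fc_class softmax ?K ?w"
    unfolding fc_class_def using \<tau>
    by (intro CollectI exI[of _ parity_weights] exI[of _ "threshold_bias \<tau>"])
       (auto simp: parity_weights_def threshold_bias_def)
  moreover have "G \<in> conv_class d \<alpha> (2 * m)"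
    unfolding conv_class_def G_def using W by blast
  ultimately have "(\<lambda>X. (1 - g X, g X)) \<in> cnn_class d \<alpha> m"
    unfolding cnn_class_def by blast
  moreover have "rho (-1) \<le> g X"
    if "\<And>s. s \<in> {1..2 * m} \<Longrightarrow> odd s \<Longrightarrow> conv_feature d (W s) (q s) X \<le> \<tau>"
      "\<exists>s\<in>{1..2 * m}. even s \<and> \<tau> + e \<le> conv_feature d (W s) (q s) X" for X
    using silent[of 1 X] active[of _ 2 X] that by (auto simp: g_def rho_le_iff)
  moreover have "g X \<le> rho 1"
    if "\<And>s. s \<in> {1..2 * m} \<Longrightarrow> even s \<Longrightarrow> conv_feature d (W s) (q s) X \<le> \<tau>"
      "\<exists>s\<in>{1..2 * m}. odd s \<and> \<tau> + e \<le> conv_feature d (W s) (q s) X" for X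
    using silent[of 2 X] active[of _ 1 X] that by (auto simp: g_def rho_le_iff)
  ultimately show ?thesis by (rule that)
qed

section \<open>Convolutional features as correlations\<close>

text \<open>Integer indices allow shifts across the border in both directions; \<open>pad\<close> is
  the same extension with its origin moved by the filter size.\<close>

definition zero_ext :: "nat \<Rightarrow> image \<Rightarrow> int \<Rightarrow> int \<Rightarrow> real" where
  "zero_ext d X i j = (if i \<in> {1..int d} \<and> j \<in> {1..int d} then X (nat i, nat j) else 0)"

definition correlation :: "nat \<Rightarrow> image \<Rightarrow> image \<Rightarrow> int \<Rightarrow> int \<Rightarrow> real" where
  "correlation d W X s t = (\<Sum>(i, j)\<in>{1..d} \<times> {1..d}. W (i, j) * zero_ext d X (int i + s) (int j + t))"

lemma pad_eq_zero_ext: "pad d l X (i, j) = zero_ext d X (int i - int l) (int j - int l)"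
  by (auto simp: pad_def zero_ext_def nat_diff_distrib' intro!: arg_cong[of _ _ X])

text \<open>A submatrix together with a patch position amounts to a relative shift, so the place of
  the filter inside \<open>W\<close> only relabels the shifts.\<close>

lemma convolution_eq_correlation:
  assumes cov: "covers_support d W (l, a, b)"
  shows "convolution d W (l, a, b) X (i, j)
    = correlation d W X (int i - int l - int a - 1) (int j - int l - int b - 1)"
proof -
  let ?s = "int i - int l - int a - 1" and ?t = "int j - int l - int b - 1"
  let ?g = "\<lambda>p q. W (p, q) * zero_ext d X (int p + ?s) (int q + ?t)"
  have reindex: "(\<Sum>p<l. h (c + 1 + p)) = (\<Sum>p\<in>{c+1..c+l}. h p)" for h :: "nat \<Rightarrow> real" and c
    by (rule sum.reindex_bij_witness[of _ "\<lambda>p. p - (c + 1)" "\<lambda>p. c + 1 + p"]) auto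
  have "convolution d W (l, a, b) X (i, j) = (\<Sum>p<l. \<Sum>q<l. ?g (a + 1 + p) (b + 1 + q))"
    by (auto simp: convolution_def pad_eq_zero_ext algebra_simps intro!: sum.cong)
  also have "\<dots> = (\<Sum>p\<in>{a+1..a+l}. \<Sum>q\<in>{b+1..b+l}. ?g p q)"
  proof -
    have "(\<Sum>q<l. ?g p (b + 1 + q)) = (\<Sum>q\<in>{b+1..b+l}. ?g p q)" for p by (rule reindex)
    then show ?thesis using reindex[of "\<lambda>p. \<Sum>q<l. ?g p (b + 1 + q)" a] by simp
  qed
  also have "\<dots> = (\<Sum>(p, q)\<in>{a+1..a+l} \<times> {b+1..b+l}. ?g p q)"
    by (simp add: sum.cartesian_product)
  \<comment> \<open>\<open>W\<close> vanishes off the covering submatrix, so the sum may run over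
    the full grid.\<close>
  also have "\<dots> = (\<Sum>(p, q)\<in>{1..d} \<times> {1..d}. ?g p q)"
    using cov by (intro sum.mono_neutral_left) (auto simp: covers_support_def)
  finally show ?thesis by (simp add: correlation_def)
qed

lemma conv_feature_le:
  assumes cov: "covers_support d W (l, a, b)" and "0 \<le> B"
    and B: "\<And>s t. \<bar>s\<bar> \<le> int d \<Longrightarrow> \<bar>t\<bar> \<le> int d \<Longrightarrow> correlation d W X s t \<le> B"
  shows "conv_feature d W (l, a, b) X \<le> B"
proof -
  have "\<bar>relu (convolution d W (l, a, b) X (i, j))\<bar> \<le> B" if "i \<in> {1..d+l+1}" "j \<in> {1..d+l+1}" for i j
  proof -
    have "a + l \<le> d" "b + l \<le> d" using cov by (auto simp: covers_support_def)
    \<comment> \<open>Patches start at 1 to d + l + 1, so the shift lies between -(a + l) and d -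
      a.\<close>
    then have "\<bar>int i - int l - int a - 1\<bar> \<le> int d" "\<bar>int j - int l - int b - 1\<bar> \<le> int d"
      using that by auto
    then show ?thesis using B[of "int i - int l - int a - 1" "int j - int l - int b - 1"] \<open>0 \<le> B\<close>
      by (simp add: convolution_eq_correlation[OF cov] relu_def)
  qed
  then show ?thesis unfolding conv_feature_def by auto
qed

text \<open>A shift that is not realized by a patch leaves no overlap between filter and image.\<close>

lemma conv_feature_ge:
  assumes cov: "covers_support d W (l, a, b)"
  shows "correlation d W X s t \<le> conv_feature d W (l, a, b) X"
proof -
  let ?I = "{1..d+l+1} \<times> {1..d+l+1}"
  have ge: "\<bar>relu (convolution d W (l, a, b) X ij)\<bar> \<le> conv_feature d W (l, a, b) X" if "ij \<in> ?I" for ij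
    unfolding conv_feature_def using that by (auto intro!: Max_ge)
  define i where "i = s + int l + int a + 1"
  define j where "j = t + int l + int b + 1"
  have l: "1 \<le> l" "a + l \<le> d" "b + l \<le> d"
    and supp: "\<And>p q. p \<in> {1..d} \<Longrightarrow> q \<in> {1..d} \<Longrightarrow> W (p, q) \<noteq> 0 \<Longrightarrow> p \<in> {a+1..a+l} \<and> q \<in> {b+1..b+l}"
    using cov by (auto simp: covers_support_def)
  show ?thesis
  proof (cases "i \<in> {1..int (d+l+1)} \<and> j \<in> {1..int (d+l+1)}")
    case True
    then have "correlation d W X s t = convolution d W (l, a, b) X (nat i, nat j)"
      by (simp add: convolution_eq_correlation[OF cov] i_def j_def)
    also have "\<dots> \<le> \<bar>relu (convolution d W (l, a, b) X (nat i, nat j))\<bar>" by (simp add: relu_def)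
    also have "\<dots> \<le> conv_feature d W (l, a, b) X" using True by (intro ge) auto
    finally show ?thesis .
  next
    case False
    have "W (p, q) * zero_ext d X (int p + s) (int q + t) = 0" if "p \<in> {1..d}" "q \<in> {1..d}" for p q
    proof (rule ccontr)
      assume nz: "W (p, q) * zero_ext d X (int p + s) (int q + t) \<noteq> 0"
      then have "p \<in> {a+1..a+l}" "q \<in> {b+1..b+l}" using supp that by auto
      moreover have "int p + s \<in> {1..int d}" "int q + t \<in> {1..int d}"
        using nz by (auto simp: zero_ext_def split: if_splits)
      ultimately show False using False by (auto simp: i_def j_def)
    qed
    then have "correlation d W X s t = 0" unfolding correlation_def by (intro sum.neutral) auto
    also have "0 \<le> \<bar>relu (convolution d W (l, a, b) X (1, 1))\<bar>" by simp
    also have "\<dots> \<le> conv_feature d W (l, a, b) X" by (intro ge) auto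
    finally show ?thesis .
  qed
qed

lemma quadratic_support_exists:
  assumes "1 \<le> d"
  obtains q where "quadratic_support d W q"
proof -
  let ?P = "\<lambda>l. \<exists>a b. covers_support d W (l, a, b)"
  have "?P d" using assms by (intro exI[of _ 0]) (auto simp: covers_support_def)
  then have "?P (LEAST l. ?P l)" by (rule LeastI)
  then obtain a b where "covers_support d W (LEAST l. ?P l, a, b)" by blast
  moreover have "(LEAST l. ?P l) \<le> l'" if "covers_support d W (l', a', b')" for l' a' b'
    using that by (intro Least_le) blast
  ultimately show ?thesis by (intro that[of "(LEAST l. ?P l, a, b)"]) (auto simp: quadratic_support_def)
qed

text \<open>A box containing the image and all of its shifts by at most \<^term>\<open>d\<close>.\<close>

definition big_box :: "nat \<Rightarrow> (int \<times> int) set" where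
  "big_box d = {1 - int d..2 * int d} \<times> {1 - int d..2 * int d}"

lemma finite_big_box [simp]: "finite (big_box d)" by (simp add: big_box_def)

lemma card_big_box: "card (big_box d) = (3 * d)\<^sup>2"
  by (simp add: big_box_def card_cartesian_product power2_eq_square nat_mult_distrib)

lemma sum_zero_ext_square:
  assumes "\<bar>s\<bar> \<le> int d" "\<bar>t\<bar> \<le> int d"
  shows "(\<Sum>(i, j)\<in>big_box d. (zero_ext d X (i + s) (j + t))\<^sup>2) = (\<Sum>p\<in>{1..d} \<times> {1..d}. (X p)\<^sup>2)"
proof -
  have "(\<Sum>(i, j)\<in>big_box d. (zero_ext d X (i + s) (j + t))\<^sup>2)
     = (\<Sum>(i, j)\<in>{1 - s..int d - s} \<times> {1 - t..int d - t}. (zero_ext d X (i + s) (j + t))\<^sup>2)"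
    using assms by (intro sum.mono_neutral_right) (auto simp: big_box_def zero_ext_def split: if_splits)
  also have "\<dots> = (\<Sum>p\<in>{1..d} \<times> {1..d}. (X p)\<^sup>2)"
    by (rule sum.reindex_bij_witness[of _ "\<lambda>(i, j). (int i - s, int j - t)" "\<lambda>(i, j). (nat (i + s), nat (j + t))"])
       (auto simp: zero_ext_def)
  finally show ?thesis .
qed

lemma correlation_big_box:
  "correlation d W X s t = (\<Sum>(i, j)\<in>big_box d. zero_ext d W i j * zero_ext d X (i + s) (j + t))"
proof -
  have "(\<Sum>(i, j)\<in>big_box d. zero_ext d W i j * zero_ext d X (i + s) (j + t))
     = (\<Sum>(i, j)\<in>{1..int d} \<times> {1..int d}. zero_ext d W i j * zero_ext d X (i + s) (j + t))"
    by (intro sum.mono_neutral_right) (auto simp: big_box_def zero_ext_def split: if_splits)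
  also have "\<dots> = correlation d W X s t"
    unfolding correlation_def
    by (rule sum.reindex_bij_witness[of _ "\<lambda>(i, j). (int i, int j)" "\<lambda>(i, j). (nat i, nat j)"])
       (auto simp: zero_ext_def)
  finally show ?thesis ..
qed

text \<open>Polarization: it translates between squared distances and correlations, and serves both
  the lower bound for matching and the upper bound for different templates.\<close>

lemma sum_square_diff_correlation:
  assumes "\<bar>s\<bar> \<le> int d" "\<bar>t\<bar> \<le> int d"
  shows "(\<Sum>(i, j)\<in>big_box d. (a * zero_ext d W i j - b * zero_ext d X (i + s) (j + t))\<^sup>2)
    = a\<^sup>2 * (\<Sum>p\<in>{1..d} \<times> {1..d}. (W p)\<^sup>2) + b\<^sup>2 * (\<Sum>p\<in>{1..d} \<times> {1..d}. (X p)\<^sup>2)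
      - 2 * a * b * correlation d W X s t"
proof -
  have "(\<Sum>(i, j)\<in>big_box d. (a * zero_ext d W i j - b * zero_ext d X (i + s) (j + t))\<^sup>2)
    = a\<^sup>2 * (\<Sum>(i, j)\<in>big_box d. (zero_ext d W (i + 0) (j + 0))\<^sup>2)
      + b\<^sup>2 * (\<Sum>(i, j)\<in>big_box d. (zero_ext d X (i + s) (j + t))\<^sup>2) - 2 * a * b * correlation d W X s t"
    unfolding correlation_big_box
    by (simp add: power2_diff sum.distrib sum_subtractf sum_distrib_left power_mult_distrib case_prod_beta mult_ac)
  then show ?thesis using sum_zero_ext_square[of 0 d 0 W] sum_zero_ext_square[OF assms, of X] by simp
qed

section \<open>Deformed templates\<close>

lemma emeasure_unit_square: "emeasure lborel unit_square = 1"
  unfolding unit_square_def lborel_prod[symmetric] by (subst lborel.emeasure_pair_measure_Times) auto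

lemma unit_square_sets [measurable]: "unit_square \<in> sets borel"
  unfolding unit_square_def by (intro borel_closed closed_Times) auto

lemma integrable_vanishing:
  fixes g :: "real \<times> real \<Rightarrow> real"
  assumes "g \<in> borel_measurable borel" "\<And>z. \<bar>g z\<bar> \<le> B" "\<And>z. z \<notin> unit_square \<Longrightarrow> g z = 0"
  shows "integrable lborel g"
proof (rule Bochner_Integration.integrable_bound)
  show "integrable lborel (\<lambda>z. B * indicator unit_square z :: real)"
    using emeasure_unit_square by (intro integrable_mult_right integrable_real_indicator) auto
  show "AE z in lborel. norm (g z) \<le> norm (B * indicator unit_square z :: real)"
  proof (rule AE_I2)
    fix z show "norm (g z) \<le> norm (B * indicator unit_square z :: real)"
      using assms(2)[of z] assms(3)[of z] by (auto simp: indicator_def)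
  qed
qed (use assms in simp)

section \<open>A single template: positivity, boundedness and comparison of norms\<close>

locale lipschitz_template =
  fixes f :: template and C :: real
  assumes nonneg: "0 \<le> f z" and nonzero: "\<exists>z. f z \<noteq> 0"
    and supp: "support f \<subseteq> unit_square" and C_pos: "0 < C"
    and lip: "\<bar>f (u, v) - f (u', v')\<bar> \<le> C * L1_norm f * (\<bar>u - u'\<bar> + \<bar>v - v'\<bar>)"
begin

lemma lip_pair: "\<bar>f z - f z'\<bar> \<le> C * L1_norm f * (\<bar>fst z - fst z'\<bar> + \<bar>snd z - snd z'\<bar>)"
  using lip[of "fst z" "snd z" "fst z'" "snd z'"] by simp

lemma outside: "z \<notin> unit_square \<Longrightarrow> f z = 0"
  using supp by (auto simp: support_def)

lemma L1_nonneg: "0 \<le> L1_norm f"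
  unfolding L1_norm_def set_lebesgue_integral_def by (intro integral_nonneg_AE) (auto simp: indicator_def)

lemma L1_pos: "0 < L1_norm f"
proof (rule ccontr)
  assume "\<not> 0 < L1_norm f"
  then have "L1_norm f = 0" using L1_nonneg by linarith
  \<comment> \<open>With L1 norm 0 the Lipschitz condition makes \<open>f\<close> constant, equal to
    its value outside the square.\<close>
  then have "f z = f (-1, 0)" for z using lip_pair[of z "(-1, 0)"] by simp
  moreover have "f (-1, 0) = 0" by (rule outside) (auto simp: unit_square_def)
  ultimately show False using nonzero by auto
qed

lemma le_bound: "f z \<le> 2 * C * L1_norm f"
proof (cases "z \<in> unit_square")
  case True
  \<comment> \<open>A zero of \<open>f\<close> at horizontal distance at most 2; this is the factor
    2 of the bound.\<close>
  have "f (-1, snd z) = 0" by (rule outside) (auto simp: unit_square_def)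
  then have "f z \<le> C * L1_norm f * (fst z + 1)"
    using lip_pair[of z "(-1, snd z)"] True by (auto simp: unit_square_def)
  also have "\<dots> \<le> C * L1_norm f * 2"
    using True C_pos L1_nonneg by (intro mult_left_mono) (auto simp: unit_square_def)
  finally show ?thesis by (simp add: mult_ac)
next
  case False
  then show ?thesis using outside C_pos L1_nonneg by simp
qed

lemma continuous: "continuous_on UNIV f"
proof -
  have "(2 * C * L1_norm f)-lipschitz_on UNIV f"
  proof (rule lipschitz_onI)
    fix z z' :: "real \<times> real"
    have "\<bar>fst z - fst z'\<bar> \<le> dist z z'" "\<bar>snd z - snd z'\<bar> \<le> dist z z'"
      using dist_fst_le[of z z'] dist_snd_le[of z z'] by (auto simp: dist_real_def)
    then have "\<bar>f z - f z'\<bar> \<le> C * L1_norm f * (dist z z' + dist z z')"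
      using C_pos L1_nonneg by (intro order_trans[OF lip_pair] mult_left_mono add_mono) auto
    then show "dist (f z) (f z') \<le> 2 * C * L1_norm f * dist z z'" by (simp add: dist_real_def)
  qed (use C_pos L1_nonneg in auto)
  then show ?thesis by (rule lipschitz_on_continuous_on)
qed

lemma measurable_f [measurable]: "f \<in> borel_measurable borel"
  using continuous by (rule borel_measurable_continuous_onI)

lemma integral_eq_L1: "(LINT z|lborel. f z) = L1_norm f"
  unfolding L1_norm_def set_lebesgue_integral_def
  by (intro Bochner_Integration.integral_cong) (auto simp: indicator_def outside nonneg)

lemma integrable_f: "integrable lborel f"
  by (rule integrable_vanishing[of _ "2 * C * L1_norm f"]) (auto simp: le_bound nonneg outside)

lemma integrable_f_square: "integrable lborel (\<lambda>z. (f z)\<^sup>2)"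
  by (rule integrable_vanishing[of _ "(2 * C * L1_norm f)\<^sup>2"]) (auto simp: le_bound nonneg outside power_mono)

text \<open>Jensen on a square of area 1. It connects the Lipschitz condition, scaled by the L1
  norm, with the separation quantity, scaled by the L2 norm.\<close>

lemma L1_le_L2: "(L1_norm f)\<^sup>2 \<le> (LINT z|lborel. (f z)\<^sup>2)"
proof -
  let ?N = "L1_norm f"
  have int: "integrable lborel (\<lambda>z. ?N\<^sup>2 * indicator unit_square z :: real)"
    using emeasure_unit_square by (intro integrable_mult_right integrable_real_indicator) auto
  have "0 \<le> (LINT z|lborel. (f z)\<^sup>2 - 2 * ?N * f z + ?N\<^sup>2 * indicator unit_square z)"
  proof (rule integral_nonneg_AE, rule AE_I2)
    fix z
    show "0 \<le> (f z)\<^sup>2 - 2 * ?N * f z + ?N\<^sup>2 * indicator unit_square z"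
      using zero_le_power2[of "f z - ?N"] outside[of z]
      by (cases "z \<in> unit_square") (auto simp: power2_diff algebra_simps)
  qed
  also have "\<dots> = (LINT z|lborel. (f z)\<^sup>2) - 2 * ?N * (LINT z|lborel. f z) + ?N\<^sup>2 * measure lborel unit_square"
    using int integrable_f integrable_f_square by simp
  also have "\<dots> = (LINT z|lborel. (f z)\<^sup>2) - ?N\<^sup>2"
    using emeasure_unit_square by (simp add: integral_eq_L1 measure_def power2_eq_square)
  finally show ?thesis by simp
qed

lemma L1_le_L2_norm: "L1_norm f \<le> L2_norm_plane f"
  unfolding L2_norm_plane_def by (intro real_le_rsqrt L1_le_L2)

lemma exists_large: "\<exists>z. L1_norm f / 2 \<le> f z"
proof (rule ccontr)
  assume "\<not> ?thesis"
  then have small: "f z \<le> L1_norm f / 2" for z by (meson less_eq_real_def not_le)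
  have "(LINT z|lborel. f z) \<le> (LINT z|lborel. L1_norm f / 2 * indicator unit_square z)"
    using emeasure_unit_square small outside
    by (intro integral_mono integrable_f integrable_mult_right integrable_real_indicator)
       (auto simp: indicator_def)
  also have "\<dots> = L1_norm f / 2" using emeasure_unit_square by (simp add: measure_def)
  finally show False using L1_pos by (simp add: integral_eq_L1)
qed

end

lemma bounded_C1_lipschitz:
  assumes "bounded_C1 B g"
  shows "\<bar>g z - g z'\<bar> \<le> B * (\<bar>fst z - fst z'\<bar> + \<bar>snd z - snd z'\<bar>)"
proof -
  obtain g1 g2 where d1: "\<And>u v. ((\<lambda>t. g (t, v)) has_real_derivative g1 (u, v)) (at u)"
    and d2: "\<And>u v. ((\<lambda>t. g (u, t)) has_real_derivative g2 (u, v)) (at v)"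
    and B: "\<And>z. \<bar>g1 z\<bar> \<le> B" "\<And>z. \<bar>g2 z\<bar> \<le> B"
    using assms unfolding bounded_C1_def by blast
  have 1: "norm (g (fst z, snd z) - g (fst z', snd z)) \<le> B * norm (fst z - fst z')"
    by (rule field_differentiable_bound[of UNIV "\<lambda>t. g (t, snd z)" "\<lambda>t. g1 (t, snd z)"])
       (use d1 B in auto)
  have 2: "norm (g (fst z', snd z) - g (fst z', snd z')) \<le> B * norm (snd z - snd z')"
    by (rule field_differentiable_bound[of UNIV "\<lambda>t. g (fst z', t)" "\<lambda>t. g2 (fst z', t)"])
       (use d2 B in auto)
  show ?thesis using 1 2 by (simp add: algebra_simps)
qed

locale deformed_template = lipschitz_template +
  fixes A :: deformation and K :: real and R :: "(real \<times> real) set"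
  assumes supp_R: "support f \<subseteq> R" and visible: "R \<subseteq> A ` unit_square"
    and supp_A: "support (f \<circ> A) \<subseteq> unit_square"
    and C1_fst: "bounded_C1 K (fst \<circ> A)" and C1_snd: "bounded_C1 K (snd \<circ> A)"
    and K_ge_1: "1 \<le> K"
begin

text \<open>The factor 2 accounts for the two coordinates of \<open>A\<close>, each moving by up to
  \<open>K\<close> times the displacement.\<close>

definition "\<Lambda> = 2 * C * K"

lemma Lam_pos: "0 < \<Lambda>" using C_pos K_ge_1 by (simp add: \<Lambda>_def)

lemma F_lip: "\<bar>f (A z) - f (A z')\<bar> \<le> \<Lambda> * L1_norm f * (\<bar>fst z - fst z'\<bar> + \<bar>snd z - snd z'\<bar>)"
proof -
  let ?D = "\<bar>fst z - fst z'\<bar> + \<bar>snd z - snd z'\<bar>"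
  have "\<bar>f (A z) - f (A z')\<bar> \<le> C * L1_norm f * (\<bar>fst (A z) - fst (A z')\<bar> + \<bar>snd (A z) - snd (A z')\<bar>)"
    by (rule lip_pair)
  also have "\<dots> \<le> C * L1_norm f * (K * ?D + K * ?D)"
    using bounded_C1_lipschitz[OF C1_fst, of z z'] bounded_C1_lipschitz[OF C1_snd, of z z'] C_pos L1_nonneg
    by (intro mult_left_mono add_mono) auto
  finally show ?thesis by (simp add: \<Lambda>_def algebra_simps)
qed

lemma F_continuous: "continuous_on UNIV (\<lambda>z. f (A z))"
proof -
  have "(2 * \<Lambda> * L1_norm f)-lipschitz_on UNIV (\<lambda>z. f (A z))"
  proof (rule lipschitz_onI)
    fix z z' :: "real \<times> real"
    have "\<bar>fst z - fst z'\<bar> \<le> dist z z'" "\<bar>snd z - snd z'\<bar> \<le> dist z z'"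
      using dist_fst_le[of z z'] dist_snd_le[of z z'] by (auto simp: dist_real_def)
    then have "\<bar>f (A z) - f (A z')\<bar> \<le> \<Lambda> * L1_norm f * (dist z z' + dist z z')"
      using Lam_pos L1_nonneg by (intro order_trans[OF F_lip] mult_left_mono add_mono) auto
    then show "dist (f (A z)) (f (A z')) \<le> 2 * \<Lambda> * L1_norm f * dist z z'" by (simp add: dist_real_def)
  qed (use Lam_pos L1_nonneg in auto)
  then show ?thesis by (rule lipschitz_on_continuous_on)
qed

lemma F_measurable [measurable]: "(\<lambda>z. f (A z)) \<in> borel_measurable borel"
  using F_continuous by (rule borel_measurable_continuous_onI)

text \<open>By continuity the deformed template also vanishes on the boundary of the unit square, which
  matters since the pixels are half open.\<close>

lemma F_outside:
  assumes "\<not> (0 \<le> fst z \<and> fst z < 1 \<and> 0 \<le> snd z \<and> snd z < 1)"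
  shows "f (A z) = 0"
proof (rule ccontr)
  assume nz: "f (A z) \<noteq> 0"
  then have z: "z \<in> unit_square" using supp_A by (auto simp: support_def)
  \<comment> \<open>A step of this length out of the square can lower the value by at most one
    half.\<close>
  define h where "h = f (A z) / (2 * \<Lambda> * L1_norm f)"
  have pos: "0 < f (A z)" using nz nonneg[of "A z"] by simp
  have h: "0 < h" using pos Lam_pos L1_pos by (simp add: h_def)
  define z' where "z' = (if fst z = 1 then (fst z + h, snd z) else (fst z, snd z + h))"
  have z': "z' \<notin> unit_square" using z h assms by (auto simp: z'_def unit_square_def)
  then have "f (A z') = 0" using supp_A by (auto simp: support_def)
  moreover have "\<bar>fst z - fst z'\<bar> + \<bar>snd z - snd z'\<bar> = h" using h by (auto simp: z'_def)
  ultimately have "f (A z) \<le> \<Lambda> * L1_norm f * h" using F_lip[of z z'] pos by simp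
  also have "\<dots> = f (A z) / 2" using Lam_pos L1_pos by (simp add: h_def)
  finally show False using pos by simp
qed

lemma F_integrable: "integrable lborel (\<lambda>z. f (A z))"
  using supp_A
  by (intro integrable_vanishing[of _ "2 * C * L1_norm f"]) (auto simp: le_bound nonneg support_def)

text \<open>No change of variables is needed: the deformed template attains a value that is at least the
  mean of the template up to a factor 2, and by Lipschitz continuity it stays large nearby.\<close>

lemma F_integral_ge: "L1_norm f / (64 * \<Lambda>\<^sup>2) \<le> (LINT z|lborel. f (A z))"
proof -
  let ?N = "L1_norm f"
  obtain x where x: "?N / 2 \<le> f x" using exists_large by blast
  then have "x \<in> R" using L1_pos supp_R by (auto simp: support_def)
  then obtain y where y: "A y = x" using visible by auto
  \<comment> \<open>On a square of half side r the value drops by at most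
    \<open>2 * \<Lambda> * r\<close> times the L1 norm, that is a quarter of the norm. The area
    \<open>4 * r\<^sup>2\<close> contributes 1/16, which together with the remaining 1/4 gives
    1/64.\<close>
  define r where "r = 1 / (8 * \<Lambda>)"
  have r: "0 < r" using Lam_pos by (simp add: r_def)
  define Q where "Q = {fst y - r..fst y + r} \<times> {snd y - r..snd y + r}"
  have Q: "?N / 4 \<le> f (A z)" if "z \<in> Q" for z
  proof -
    have "\<bar>fst y - fst z\<bar> + \<bar>snd y - snd z\<bar> \<le> 2 * r" using that by (auto simp: Q_def)
    then have "\<Lambda> * ?N * (\<bar>fst y - fst z\<bar> + \<bar>snd y - snd z\<bar>) \<le> \<Lambda> * ?N * (2 * r)"
      using Lam_pos L1_pos by (intro mult_left_mono) auto
    then have "f (A y) - f (A z) \<le> \<Lambda> * ?N * (2 * r)"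
      using F_lip[of y z] by linarith
    then show ?thesis using x y Lam_pos by (simp add: r_def)
  qed
  have mQ: "emeasure lborel Q = ennreal (4 * r\<^sup>2)"
    unfolding Q_def lborel_prod[symmetric] using r
    by (subst lborel.emeasure_pair_measure_Times) (auto simp: ennreal_mult[symmetric] power2_eq_square)
  have Qs: "Q \<in> sets borel" unfolding Q_def by (intro borel_closed closed_Times) auto
  have "?N / (64 * \<Lambda>\<^sup>2) = ?N / 4 * (4 * r\<^sup>2)"
    by (simp add: r_def power2_eq_square)
  also have "\<dots> = (LINT z|lborel. ?N / 4 * indicator Q z)"
    using mQ Qs by (simp add: measure_def)
  also have "\<dots> \<le> (LINT z|lborel. f (A z))"
    using Q mQ Qs nonneg
    by (intro integral_mono F_integrable integrable_mult_right integrable_real_indicator)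
       (auto simp: indicator_def)
  finally show ?thesis .
qed

end

section \<open>Pixel approximations\<close>

text \<open>Integer indices make the pixels a tiling of the whole plane that is invariant under
  shifts by whole pixels.\<close>

definition ipixel :: "nat \<Rightarrow> int \<Rightarrow> int \<Rightarrow> (real \<times> real) set" where
  "ipixel d i j = {(real_of_int i - 1) / d ..< i / d} \<times> {(real_of_int j - 1) / d ..< j / d}"

lemma pixel_eq_ipixel: "pixel d j l = ipixel d (int j) (int l)"
  by (simp add: pixel_def ipixel_def)

lemma ipixel_sets [measurable]: "ipixel d i j \<in> sets borel"
  unfolding ipixel_def borel_prod[symmetric] by (intro pair_measureI) auto

lemma emeasure_ipixel:
  assumes "1 \<le> d"
  shows "emeasure lborel (ipixel d i j) = ennreal (1 / (real d)\<^sup>2)"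
proof -
  have "k / d - (real_of_int k - 1) / d = 1 / d" "(real_of_int k - 1) / d \<le> k / d" for k :: int
    using assms by (auto simp: diff_divide_distrib divide_right_mono)
  then show ?thesis
    unfolding ipixel_def lborel_prod[symmetric]
    by (subst lborel.emeasure_pair_measure_Times) (auto simp: ennreal_mult[symmetric] power2_eq_square)
qed

lemma ipixel_iff:
  assumes "1 \<le> d"
  shows "z \<in> ipixel d i j \<longleftrightarrow> i = \<lfloor>d * fst z\<rfloor> + 1 \<and> j = \<lfloor>d * snd z\<rfloor> + 1"
proof -
  have "(real_of_int k - 1) / d \<le> x \<and> x < k / d \<longleftrightarrow> k = \<lfloor>d * x\<rfloor> + 1" for k :: int and x :: real
  proof -
    have "k = \<lfloor>d * x\<rfloor> + 1 \<longleftrightarrow> \<lfloor>d * x\<rfloor> = k - 1" by linarith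
    also have "\<dots> \<longleftrightarrow> real_of_int k - 1 \<le> d * x \<and> d * x < k" by (simp add: floor_eq_iff)
    also have "\<dots> \<longleftrightarrow> (real_of_int k - 1) / d \<le> x \<and> x < k / d"
      using assms by (simp add: field_simps)
    finally show ?thesis ..
  qed
  then show ?thesis unfolding ipixel_def by (cases z) auto
qed

lemma ipixel_shift:
  assumes "1 \<le> d" "z \<in> ipixel d i j"
  shows "(fst z + real_of_int s / d, snd z + real_of_int t / d) \<in> ipixel d (i + s) (j + t)"
  using assms by (simp add: ipixel_iff distrib_left)

lemma corner_in_ipixel: "1 \<le> d \<Longrightarrow> ((real_of_int i - 1) / d, (real_of_int j - 1) / d) \<in> ipixel d i j"
  by (simp add: ipixel_def divide_strict_right_mono)

definition vanishing :: "(real \<times> real \<Rightarrow> real) \<Rightarrow> bool" where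
  "vanishing F \<longleftrightarrow> (\<forall>z. \<not> (0 \<le> fst z \<and> fst z < 1 \<and> 0 \<le> snd z \<and> snd z < 1) \<longrightarrow> F z = 0)"

lemma vanishing_ipixel:
  assumes "1 \<le> d" "vanishing F" "z \<in> ipixel d i j" "\<not> (i \<in> {1..int d} \<and> j \<in> {1..int d})"
  shows "F z = 0"
proof -
  have grid: "\<lfloor>d * x\<rfloor> + 1 \<in> {1..int d}" if "0 \<le> x" "x < 1" for x :: real
  proof -
    have "0 \<le> d * x" "d * x < d" using that assms(1) by auto
    then have "0 \<le> \<lfloor>d * x\<rfloor>" "\<lfloor>d * x\<rfloor> < int d" by (auto simp: floor_less_iff)
    then show ?thesis by auto
  qed
  have "\<not> (0 \<le> fst z \<and> fst z < 1 \<and> 0 \<le> snd z \<and> snd z < 1)"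
    using grid[of "fst z"] grid[of "snd z"] assms(3,4) unfolding ipixel_iff[OF assms(1)] by blast
  then show ?thesis using assms(2) unfolding vanishing_def by blast
qed

lemma integral_le_pixel_sum:
  fixes g :: "real \<times> real \<Rightarrow> real"
  assumes d: "1 \<le> d" and I: "finite I"
    and K: "\<And>i j z. (i, j) \<in> I \<Longrightarrow> z \<in> ipixel d i j \<Longrightarrow> g z \<le> K i j"
    and K0: "\<And>i j. (i, j) \<in> I \<Longrightarrow> 0 \<le> K i j"
    and out: "\<And>i j z. (i, j) \<notin> I \<Longrightarrow> z \<in> ipixel d i j \<Longrightarrow> g z \<le> 0"
  shows "(LINT z|lborel. g z) \<le> (\<Sum>(i, j)\<in>I. K i j) / (real d)\<^sup>2"
proof -
  let ?h = "\<lambda>z. \<Sum>(i, j)\<in>I. K i j * indicator (ipixel d i j) z :: real"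
  have h0: "0 \<le> ?h z" for z using K0 by (intro sum_nonneg) auto
  have gh: "g z \<le> ?h z" for z
  proof -
    define i where "i = \<lfloor>d * fst z\<rfloor> + 1"
    define j where "j = \<lfloor>d * snd z\<rfloor> + 1"
    have z: "z \<in> ipixel d i j" using d by (simp add: ipixel_iff i_def j_def)
    show ?thesis
    proof (cases "(i, j) \<in> I")
      case True
      have "g z \<le> (\<lambda>(i, j). K i j * indicator (ipixel d i j) z) (i, j)" using K[OF True z] z by simp
      also have "\<dots> \<le> ?h z" using K0 I True by (intro member_le_sum) auto
      finally show ?thesis .
    next
      case False
      then show ?thesis using out[OF False z] h0[of z] by linarith
    qed
  qed
  have inth: "integrable lborel ?h"
    unfolding case_prod_beta using emeasure_ipixel[OF d]
    by (intro Bochner_Integration.integrable_sum integrable_mult_right integrable_real_indicator) auto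
  \<comment> \<open>If g is not integrable its integral is 0 by convention, which the nonnegative
    majorant bounds as well.\<close>
  have "(LINT z|lborel. g z) \<le> (LINT z|lborel. ?h z)"
    using inth gh h0 by (intro integral_mono') auto
  also have "\<dots> = (\<Sum>(i, j)\<in>I. K i j * (1 / (real d)\<^sup>2))"
    unfolding case_prod_beta using emeasure_ipixel[OF d]
    by (subst Bochner_Integration.integral_sum)
       (auto simp: measure_def intro!: integrable_mult_right integrable_real_indicator)
  also have "\<dots> = (\<Sum>(i, j)\<in>I. K i j) / (real d)\<^sup>2"
    by (simp add: case_prod_beta sum_divide_distrib)
  finally show ?thesis .
qed

text \<open>Pixels outside the image are included: there the extension is 0 and \<open>F\<close>
  must be small. Pixel averages and block samples both satisfy the condition, so data and filters
  are handled alike.\<close>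

definition pixel_approx :: "nat \<Rightarrow> (real \<times> real \<Rightarrow> real) \<Rightarrow> real \<Rightarrow> image \<Rightarrow> bool" where
  "pixel_approx d F \<delta> y \<longleftrightarrow> (\<forall>i j. \<forall>z\<in>ipixel d i j. \<bar>zero_ext d y i j - F z\<bar> \<le> \<delta>)"

definition image_norm :: "nat \<Rightarrow> image \<Rightarrow> real" where
  "image_norm d y = sqrt (\<Sum>p\<in>{1..d} \<times> {1..d}. (y p)\<^sup>2)"

lemma image_norm_square: "(image_norm d y)\<^sup>2 = (\<Sum>p\<in>{1..d} \<times> {1..d}. (y p)\<^sup>2)"
  unfolding image_norm_def by (intro real_sqrt_pow2 sum_nonneg) auto

lemma image_norm_nonneg: "0 \<le> image_norm d y"
  unfolding image_norm_def by (intro real_sqrt_ge_zero sum_nonneg) auto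

lemma abs_le_image_norm:
  assumes "p \<in> {1..d} \<times> {1..d}"
  shows "\<bar>y p\<bar> \<le> image_norm d y"
proof -
  have "(y p)\<^sup>2 \<le> (image_norm d y)\<^sup>2"
    unfolding image_norm_square using assms by (intro member_le_sum[of p _ "\<lambda>p. (y p)\<^sup>2"]) auto
  then show ?thesis using abs_le_square_iff[of "y p" "image_norm d y"] image_norm_nonneg[of d y] by simp
qed

text \<open>The correlation falls short of the product of the norms by at most half a squared
  distance. Two discretizations and the distance of the functions give \<open>3 * \<delta>\<close>
  per pixel; its square over the \<open>9 * d\<^sup>2\<close> pixels of \<open>big_box\<close> gives
  81. The common lower bound \<open>L\<close> makes the error relative.\<close>

lemma correlation_ge:
  assumes d: "1 \<le> d" and F: "pixel_approx d F \<delta> y" and G: "pixel_approx d G \<delta> w"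
    and FG: "\<And>z. \<bar>G z - F (fst z + real_of_int s / d, snd z + real_of_int t / d)\<bar> \<le> \<delta>"
    and st: "\<bar>s\<bar> \<le> int d" "\<bar>t\<bar> \<le> int d"
    and L: "0 < L" "L \<le> image_norm d w" "L \<le> image_norm d y"
  shows "image_norm d w * image_norm d y * (1 - 81 * (real d)\<^sup>2 * \<delta>\<^sup>2 / (2 * L\<^sup>2)) \<le> correlation d w y s t"
proof -
  let ?W = "image_norm d w" and ?Y = "image_norm d y"
  have diff: "\<bar>zero_ext d w i j - zero_ext d y (i + s) (j + t)\<bar> \<le> 3 * \<delta>" for i j
  proof -
    let ?z = "((real_of_int i - 1) / d, (real_of_int j - 1) / d)"
    have "\<bar>zero_ext d w i j - G ?z\<bar> \<le> \<delta>"
      using G corner_in_ipixel[OF d] by (auto simp: pixel_approx_def)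
    moreover have "\<bar>zero_ext d y (i + s) (j + t) - F (fst ?z + real_of_int s / d, snd ?z + real_of_int t / d)\<bar> \<le> \<delta>"
      using F ipixel_shift[OF d corner_in_ipixel[OF d]] by (auto simp: pixel_approx_def)
    ultimately show ?thesis using FG[of ?z] by linarith
  qed
  have "2 * (?W * ?Y) - 2 * correlation d w y s t \<le> ?W\<^sup>2 + ?Y\<^sup>2 - 2 * correlation d w y s t"
    using sum_squares_bound[of ?W ?Y] by simp
  also have "\<dots> = (\<Sum>(i, j)\<in>big_box d. (zero_ext d w i j - zero_ext d y (i + s) (j + t))\<^sup>2)"
    using sum_square_diff_correlation[OF st, of 1 w 1 y] by (simp add: image_norm_square)
  also have "\<dots> \<le> (\<Sum>(i, j)\<in>big_box d. (3 * \<delta>)\<^sup>2)"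
  proof -
    have "(zero_ext d w i j - zero_ext d y (i + s) (j + t))\<^sup>2 \<le> (3 * \<delta>)\<^sup>2" for i j
      using power_mono[OF diff[of i j], of 2] by simp
    then show ?thesis by (intro sum_mono) auto
  qed
  also have "\<dots> = 81 * (real d)\<^sup>2 * \<delta>\<^sup>2"
    by (simp add: case_prod_beta card_big_box power_mult_distrib)
  finally have 1: "?W * ?Y - correlation d w y s t \<le> 81 * (real d)\<^sup>2 * \<delta>\<^sup>2 / 2" by simp
  have "L\<^sup>2 \<le> ?W * ?Y" unfolding power2_eq_square using L by (intro mult_mono) auto
  then have "81 * (real d)\<^sup>2 * \<delta>\<^sup>2 / 2 \<le> ?W * ?Y * (81 * (real d)\<^sup>2 * \<delta>\<^sup>2 / (2 * L\<^sup>2))"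
    using L(1) mult_right_mono[of "L\<^sup>2" "?W * ?Y" "81 * (real d)\<^sup>2 * \<delta>\<^sup>2 / (2 * L\<^sup>2)"] by simp
  moreover have "?W * ?Y * (1 - 81 * (real d)\<^sup>2 * \<delta>\<^sup>2 / (2 * L\<^sup>2))
      = ?W * ?Y - ?W * ?Y * (81 * (real d)\<^sup>2 * \<delta>\<^sup>2 / (2 * L\<^sup>2))"
    by (simp only: right_diff_distrib mult_1_right)
  ultimately show ?thesis using 1 by linarith
qed

lemma power2_sum_le: "(x + y)\<^sup>2 \<le> 2 * x\<^sup>2 + 2 * y\<^sup>2" for x y :: real
  using sum_squares_bound[of x y] by (simp add: power2_sum)

text \<open>With \<open>a\<close> and \<open>b\<close> the inverse norms, both images have norm 1,
  and their squared distance is 2 minus twice the normalized correlation. Splitting off the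
  discretization error by \<open>power2_sum_le\<close> doubles both terms: hence 4, and 18 = 2 * 9
  from the pixels of \<open>big_box\<close>.\<close>

lemma correlation_le:
  assumes d: "1 \<le> d" and F: "pixel_approx d F \<delta>F y" "vanishing F" and G: "pixel_approx d G \<delta>G w" "vanishing G"
    and st: "\<bar>s\<bar> \<le> int d" "\<bar>t\<bar> \<le> int d"
    and pos: "0 < image_norm d w" "0 < image_norm d y"
    and nonneg: "0 \<le> \<delta>F" "0 \<le> \<delta>G"
  defines "a \<equiv> 1 / image_norm d w" and "b \<equiv> 1 / image_norm d y"
  assumes sep: "\<Delta> \<le> (LINT z|lborel. (a * G z - b * F (fst z + real_of_int s / d, snd z + real_of_int t / d))\<^sup>2)"
  shows "(real d)\<^sup>2 * \<Delta> \<le> 4 * (1 - a * b * correlation d w y s t) + 18 * (real d)\<^sup>2 * (a * \<delta>G + b * \<delta>F)\<^sup>2"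
proof -
  let ?W = "image_norm d w" and ?Y = "image_norm d y"
  let ?z = "\<lambda>z :: real \<times> real. (fst z + real_of_int s / d, snd z + real_of_int t / d)"
  let ?q = "\<lambda>i j. a * zero_ext d w i j - b * zero_ext d y (i + s) (j + t)"
  let ?\<epsilon> = "a * \<delta>G + b * \<delta>F"
  have ab: "0 < a" "0 < b" using pos by (auto simp: a_def b_def)
  have "\<Delta> \<le> (\<Sum>(i, j)\<in>big_box d. 2 * (?q i j)\<^sup>2 + 2 * ?\<epsilon>\<^sup>2) / (real d)\<^sup>2"
  proof (rule order_trans[OF sep], rule integral_le_pixel_sum[OF d finite_big_box])
    fix i j z assume z: "z \<in> ipixel d i j"
    have "\<bar>a * (G z - zero_ext d w i j)\<bar> \<le> a * \<delta>G"
      unfolding abs_mult using G(1) z ab by (intro mult_mono) (auto simp: pixel_approx_def abs_minus_commute)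
    moreover have "\<bar>F (?z z) - zero_ext d y (i + s) (j + t)\<bar> \<le> \<delta>F"
      using F(1) ipixel_shift[OF d z] unfolding pixel_approx_def by (subst abs_minus_commute) blast
    then have "\<bar>b * (F (?z z) - zero_ext d y (i + s) (j + t))\<bar> \<le> b * \<delta>F"
      unfolding abs_mult using ab by (intro mult_mono) auto
    ultimately have "\<bar>a * (G z - zero_ext d w i j) - b * (F (?z z) - zero_ext d y (i + s) (j + t))\<bar> \<le> ?\<epsilon>"
      by linarith
    from power_mono[OF this, of 2]
    have "(a * (G z - zero_ext d w i j) - b * (F (?z z) - zero_ext d y (i + s) (j + t)))\<^sup>2 \<le> ?\<epsilon>\<^sup>2" by simp
    then show "(a * G z - b * F (?z z))\<^sup>2 \<le> 2 * (?q i j)\<^sup>2 + 2 * ?\<epsilon>\<^sup>2"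
      using power2_sum_le[of "?q i j" "a * (G z - zero_ext d w i j) - b * (F (?z z) - zero_ext d y (i + s) (j + t))"]
      by (simp add: algebra_simps)
  next
    fix i j z assume z: "z \<in> ipixel d i j" and out: "(i, j) \<notin> big_box d"
    have "G z = 0" using out by (intro vanishing_ipixel[OF d G(2) z]) (auto simp: big_box_def)
    moreover have "F (?z z) = 0"
      using out st by (intro vanishing_ipixel[OF d F(2) ipixel_shift[OF d z]]) (auto simp: big_box_def)
    ultimately show "(a * G z - b * F (?z z))\<^sup>2 \<le> 0" by simp
  qed auto
  also have "(\<Sum>(i, j)\<in>big_box d. 2 * (?q i j)\<^sup>2 + 2 * ?\<epsilon>\<^sup>2)
      = 2 * (\<Sum>(i, j)\<in>big_box d. (?q i j)\<^sup>2) + 18 * (real d)\<^sup>2 * ?\<epsilon>\<^sup>2"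
    by (simp add: case_prod_beta sum.distrib sum_distrib_left card_big_box power_mult_distrib)
  also have "(\<Sum>(i, j)\<in>big_box d. (?q i j)\<^sup>2) = a\<^sup>2 * ?W\<^sup>2 + b\<^sup>2 * ?Y\<^sup>2 - 2 * a * b * correlation d w y s t"
    by (simp only: sum_square_diff_correlation[OF st] image_norm_square)
  also have "a\<^sup>2 * ?W\<^sup>2 + b\<^sup>2 * ?Y\<^sup>2 = 2"
    using pos by (simp add: a_def b_def power_divide)
  finally show ?thesis using d by (simp add: field_simps)
qed

section \<open>Discretized templates: size and approximation error\<close>

context deformed_template
begin

lemma F_vanishing: "vanishing (\<lambda>z. f (A z))"
  using F_outside by (auto simp: vanishing_def)

text \<open>Discretization may consume half of the integral bound with constant 64, hence 128;
  Cauchy-Schwarz passes from the sum of the entries to the norm.\<close>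

lemma image_norm_ge:
  assumes d: "1 \<le> d" and y: "pixel_approx d (\<lambda>z. f (A z)) (\<epsilon> * L1_norm f) y"
    and \<epsilon>: "0 \<le> \<epsilon>" "\<epsilon> \<le> 1 / (128 * \<Lambda>\<^sup>2)"
  shows "d * L1_norm f / (128 * \<Lambda>\<^sup>2) \<le> image_norm d y"
proof -
  let ?N = "L1_norm f" and ?I = "{1..int d} \<times> {1..int d}"
  let ?S = "\<Sum>(i, j)\<in>?I. \<bar>zero_ext d y i j\<bar>"
  have "?N / (64 * \<Lambda>\<^sup>2) \<le> (LINT z|lborel. f (A z))" by (rule F_integral_ge)
  also have "\<dots> \<le> (\<Sum>(i, j)\<in>?I. \<bar>zero_ext d y i j\<bar> + \<epsilon> * ?N) / (real d)\<^sup>2"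
  proof (rule integral_le_pixel_sum[OF d])
    fix i j z assume z: "z \<in> ipixel d i j"
    show "f (A z) \<le> \<bar>zero_ext d y i j\<bar> + \<epsilon> * ?N"
      using y z by (force simp: pixel_approx_def)
    show "f (A z) \<le> 0" if "(i, j) \<notin> ?I"
      using vanishing_ipixel[OF d F_vanishing z] that by auto
  qed (use \<epsilon> L1_nonneg in auto)
  also have "\<dots> = ?S / (real d)\<^sup>2 + \<epsilon> * ?N"
    using d by (simp add: case_prod_beta sum.distrib add_divide_distrib power2_eq_square)
  also have "\<dots> \<le> ?S / (real d)\<^sup>2 + 1 / (128 * \<Lambda>\<^sup>2) * ?N"
    using \<epsilon> L1_nonneg by (intro add_left_mono mult_right_mono)
  finally have "?N / (128 * \<Lambda>\<^sup>2) \<le> ?S / (real d)\<^sup>2" by simp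
  then have S: "(real d)\<^sup>2 * (?N / (128 * \<Lambda>\<^sup>2)) \<le> ?S" using d by (simp add: field_simps)
  have "?S\<^sup>2 = (\<Sum>p\<in>?I. 1 * \<bar>zero_ext d y (fst p) (snd p)\<bar>)\<^sup>2" by (simp add: case_prod_beta)
  also have "\<dots> \<le> (\<Sum>p\<in>?I. 1\<^sup>2) * (\<Sum>p\<in>?I. \<bar>zero_ext d y (fst p) (snd p)\<bar>\<^sup>2)"
    by (rule Cauchy_Schwarz_ineq_sum)
  also have "\<dots> = (real d)\<^sup>2 * (\<Sum>(i, j)\<in>?I. (zero_ext d y (i + 0) (j + 0))\<^sup>2)"
    by (simp add: case_prod_beta power2_eq_square)
  also have "\<dots> \<le> (real d)\<^sup>2 * (\<Sum>(i, j)\<in>big_box d. (zero_ext d y (i + 0) (j + 0))\<^sup>2)"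
    by (intro mult_left_mono sum_mono2) (auto simp: big_box_def)
  also have "\<dots> = (d * image_norm d y)\<^sup>2"
    by (subst sum_zero_ext_square) (auto simp: image_norm_square power_mult_distrib)
  finally have "?S \<le> d * image_norm d y"
    using image_norm_nonneg by (meson mult_nonneg_nonneg of_nat_0_le_iff power2_le_imp_le)
  then have "real d * (d * ?N / (128 * \<Lambda>\<^sup>2)) \<le> real d * image_norm d y"
    using S by (simp add: power2_eq_square mult.assoc)
  then show ?thesis by (rule mult_left_le_imp_le) (use d in simp)
qed

lemma image_norm_le:
  assumes d: "1 \<le> d" and y: "pixel_approx d (\<lambda>z. f (A z)) (\<epsilon> * L1_norm f) y"
    and \<epsilon>: "0 \<le> \<epsilon>" "\<epsilon> \<le> 1"
  shows "image_norm d y \<le> d * ((2 * C + 1) * L1_norm f)"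
proof -
  let ?N = "L1_norm f"
  have "(y p)\<^sup>2 \<le> ((2 * C + 1) * ?N)\<^sup>2" if p: "p \<in> {1..d} \<times> {1..d}" for p
  proof -
    obtain i j where ij: "p = (i, j)" by force
    let ?z = "((real_of_int (int i) - 1) / d, (real_of_int (int j) - 1) / d)"
    have "y p = zero_ext d y (int i) (int j)" using p by (simp add: ij zero_ext_def)
    moreover have "\<bar>zero_ext d y (int i) (int j) - f (A ?z)\<bar> \<le> \<epsilon> * ?N"
      using y corner_in_ipixel[OF d, of "int i" "int j"] unfolding pixel_approx_def by blast
    moreover have "\<epsilon> * ?N \<le> 1 * ?N" using \<epsilon> L1_nonneg by (intro mult_right_mono)
    ultimately have "\<bar>y p\<bar> \<le> (2 * C + 1) * ?N"
      using le_bound[of "A ?z"] nonneg[of "A ?z"] by (auto simp: distrib_right)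
    then show ?thesis using power_mono[of "\<bar>y p\<bar>" _ 2] by simp
  qed
  then have "(image_norm d y)\<^sup>2 \<le> (\<Sum>p\<in>{1..d} \<times> {1..d}. ((2 * C + 1) * ?N)\<^sup>2)"
    unfolding image_norm_square by (intro sum_mono)
  also have "\<dots> = (d * ((2 * C + 1) * ?N))\<^sup>2" by (simp add: power2_eq_square)
  finally show ?thesis
    using C_pos L1_nonneg by (intro power2_le_imp_le[of "image_norm d y"]) auto
qed

text \<open>The deformed image of brightness 1. Normalization cancels any positive brightness, so no
  other images have to be studied.\<close>

definition pixel_average :: "nat \<Rightarrow> image" where
  "pixel_average d = (\<lambda>(j, l) \<in> {1..d} \<times> {1..d}. (real d)\<^sup>2 * (LINT z:pixel d j l|lborel. f (A z)))"

lemma pixel_average_approx: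
  assumes d: "1 \<le> d"
  shows "pixel_approx d (\<lambda>z. f (A z)) (2 * \<Lambda> / d * L1_norm f) (pixel_average d)"
  unfolding pixel_approx_def
proof (intro allI ballI)
  fix i j z assume z: "z \<in> ipixel d i j"
  let ?N = "L1_norm f" and ?P = "ipixel d i j"
  let ?c = "2 * \<Lambda> / d * ?N"
  have c0: "0 \<le> ?c" using Lam_pos L1_nonneg by simp
  show "\<bar>zero_ext d (pixel_average d) i j - f (A z)\<bar> \<le> ?c"
  proof (cases "i \<in> {1..int d} \<and> j \<in> {1..int d}")
    case False
    then show ?thesis using vanishing_ipixel[OF d F_vanishing z] c0 by (auto simp: zero_ext_def)
  next
    case True
    have close: "\<bar>f (A z') - f (A z)\<bar> \<le> ?c" if z': "z' \<in> ?P" for z'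
    proof -
      have "\<bar>fst z' - fst z\<bar> \<le> 1 / d" "\<bar>snd z' - snd z\<bar> \<le> 1 / d"
        using z z' by (auto simp: ipixel_def diff_divide_distrib)
      then have "\<Lambda> * ?N * (\<bar>fst z' - fst z\<bar> + \<bar>snd z' - snd z\<bar>) \<le> \<Lambda> * ?N * (1 / d + 1 / d)"
        using Lam_pos L1_nonneg by (intro mult_left_mono add_mono) auto
      then show ?thesis using F_lip[of z' z] by (simp add: algebra_simps)
    qed
    have int: "integrable lborel (\<lambda>z'. indicator ?P z' *\<^sub>R f (A z'))"
      by (intro integrable_mult_indicator F_integrable) auto
    have const: "integrable lborel (\<lambda>z'. indicator ?P z' *\<^sub>R x)"
      and const_eq: "(LINT z'|lborel. indicator ?P z' *\<^sub>R x) = x / (real d)\<^sup>2" for x :: real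
      using emeasure_ipixel[OF d]
      by (auto simp: measure_def intro!: integrable_mult_left integrable_real_indicator)
    have "(LINT z':?P|lborel. f (A z')) \<le> (f (A z) + ?c) / (real d)\<^sup>2"
      unfolding set_lebesgue_integral_def const_eq[symmetric] using close
      by (intro integral_mono int const) (force simp: indicator_def)
    moreover have "(f (A z) - ?c) / (real d)\<^sup>2 \<le> (LINT z':?P|lborel. f (A z'))"
      unfolding set_lebesgue_integral_def const_eq[symmetric] using close
      by (intro integral_mono int const) (force simp: indicator_def)
    moreover have "zero_ext d (pixel_average d) i j = (real d)\<^sup>2 * (LINT z':?P|lborel. f (A z'))"
    proof -
      have "nat i \<in> {1..d}" "nat j \<in> {1..d}" using True by auto
      then show ?thesis using True by (simp add: zero_ext_def pixel_average_def pixel_eq_ipixel)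
    qed
    ultimately show ?thesis using d by (auto simp: field_simps abs_le_iff)
  qed
qed

end

text \<open>The first index of the block of width b containing j; the 1 is subtracted because
  indices start at 1.\<close>

definition anchor :: "nat \<Rightarrow> nat \<Rightarrow> nat" where
  "anchor b j = b * ((j - 1) div b) + 1"

lemma anchor_bounds:
  assumes "1 \<le> b" "1 \<le> j"
  shows "anchor b j \<le> j" "j < anchor b j + b"
proof -
  have "b * ((j - 1) div b) + (j - 1) mod b = j - 1" by simp
  moreover have "(j - 1) mod b < b" using assms by simp
  ultimately show "anchor b j \<le> j" "j < anchor b j + b"
    using assms unfolding anchor_def by linarith+
qed

context deformed_template
begin

text \<open>Evaluating at the anchor makes the filter constant on blocks by construction. The
  evaluation point differs from any point of the pixel by at most \<open>b / d\<close> in each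
  coordinate.\<close>

definition block_sample :: "nat \<Rightarrow> nat \<Rightarrow> image" where
  "block_sample d b = (\<lambda>(j, l). f (A (anchor b j / d, anchor b l / d)))"

lemma block_sample_approx:
  assumes d: "1 \<le> d" and b: "1 \<le> b"
  shows "pixel_approx d (\<lambda>z. f (A z)) (2 * \<Lambda> * b / d * L1_norm f) (block_sample d b)"
  unfolding pixel_approx_def
proof (intro allI ballI)
  fix i j z assume z: "z \<in> ipixel d i j"
  let ?N = "L1_norm f"
  show "\<bar>zero_ext d (block_sample d b) i j - f (A z)\<bar> \<le> 2 * \<Lambda> * b / d * ?N"
  proof (cases "i \<in> {1..int d} \<and> j \<in> {1..int d}")
    case False
    then show ?thesis using vanishing_ipixel[OF d F_vanishing z] Lam_pos L1_nonneg by (auto simp: zero_ext_def)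
  next
    case True
    have near: "\<bar>real (anchor b (nat k)) / d - x\<bar> \<le> b / d"
      if k: "1 \<le> k" and x: "(real_of_int k - 1) / d \<le> x" "x < k / d" for k :: int and x :: real
    proof -
      have "anchor b (nat k) \<le> nat k" "nat k < anchor b (nat k) + b"
        using anchor_bounds[of b "nat k"] b k by auto
      then have "real (anchor b (nat k)) \<le> k" "real_of_int k \<le> anchor b (nat k) + b" using k by linarith+
      moreover have "real_of_int k - 1 \<le> x * d" "x * d < k" using x d by (auto simp: field_simps)
      ultimately have "\<bar>real (anchor b (nat k)) - x * d\<bar> \<le> b" using b by linarith
      moreover have "real (anchor b (nat k)) / d - x = (real (anchor b (nat k)) - x * d) / d"
        using d by (simp add: field_simps)
      ultimately show ?thesis using d by (simp add: divide_right_mono)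
    qed
    let ?y = "(real (anchor b (nat i)) / d, real (anchor b (nat j)) / d)"
    have "\<bar>fst ?y - fst z\<bar> \<le> b / d" "\<bar>snd ?y - snd z\<bar> \<le> b / d"
      using near[of i "fst z"] near[of j "snd z"] z True by (auto simp: ipixel_def)
    then have "\<Lambda> * ?N * (\<bar>fst ?y - fst z\<bar> + \<bar>snd ?y - snd z\<bar>) \<le> \<Lambda> * ?N * (b / d + b / d)"
      using Lam_pos L1_nonneg by (intro mult_left_mono add_mono) auto
    then have "\<bar>f (A ?y) - f (A z)\<bar> \<le> \<Lambda> * ?N * (b / d + b / d)"
      using F_lip[of ?y z] by linarith
    then show ?thesis using True by (simp add: zero_ext_def block_sample_def algebra_simps)
  qed
qed

end

lemma block_structure_anchor:
  assumes "\<And>j l j' l'. anchor b j = anchor b j' \<Longrightarrow> anchor b l = anchor b l' \<Longrightarrow> W (j, l) = W (j', l')"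
    and b: "b = nat \<lfloor>real d powr (1 - \<alpha>) + 1\<rfloor>" "1 \<le> b"
  shows "block_structure \<alpha> d W"
proof -
  have eq: "anchor b j = b * (i - 1) + 1" if "1 \<le> i" "j \<in> block \<alpha> d i" for i j
  proof -
    have "j \<in> {b * (i - 1) + 1..b * i}" using that(2) unfolding block_def b(1) Let_def by auto
    moreover have "i = Suc (i - 1)" using that(1) by simp
    ultimately have "(j - 1) div b = i - 1" by (intro div_nat_eqI) auto
    then show ?thesis by (simp add: anchor_def)
  qed
  show ?thesis
    unfolding block_structure_def
  proof (intro disjI2 allI impI ballI)
    fix i i' j j' l l'
    assume "1 \<le> i" "1 \<le> i'" "j \<in> block \<alpha> d i" "j' \<in> block \<alpha> d i" "l \<in> block \<alpha> d i'" "l' \<in> block \<alpha> d i'"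
    then show "W (j, l) = W (j', l')" by (intro assms(1)) (simp_all add: eq)
  qed
qed

section \<open>Margin of the correlations\<close>

text \<open>Supplies \<open>1 \<le> K\<close>: the identity belongs to the deformation class and has
  a partial derivative equal to 1.\<close>

lemma bounded_C1_id:
  assumes "bounded_C1 B (fst \<circ> id)"
  shows "1 \<le> B"
proof -
  define g :: "real \<times> real \<Rightarrow> real" where "g = fst \<circ> id"
  have "bounded_C1 B g" using assms by (simp add: g_def)
  then obtain g1 where g1: "\<And>u v. ((\<lambda>t. g (t, v)) has_real_derivative g1 (u, v)) (at u)"
    and B: "\<And>z. \<bar>g1 z\<bar> \<le> B"
    unfolding bounded_C1_def by blast
  have "((\<lambda>t. t) has_real_derivative g1 (0, 0)) (at 0)" using g1[of 0 0] by (simp add: g_def)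
  then have "g1 (0, 0) = 1" using DERIV_ident DERIV_unique by blast
  then show ?thesis using B[of "(0, 0)"] by simp
qed

lemma shift_apply: "shift s s' A z = A (fst z + s, snd z + s')"
  by (simp add: shift_def case_prod_beta)

lemma separation1_le:
  assumes "A \<in> \<A>" "A' \<in> \<A>"
  shows "separation1 \<A> f g \<le> L2_norm_plane (\<lambda>z. a * f (shift s s' A z) - g (A' z)) / L2_norm_plane g"
  unfolding separation1_def
proof (rule cInf_lower)
  show "bdd_below {L2_norm_plane (\<lambda>z. a * f (shift s s' A z) - g (A' z)) / L2_norm_plane g
          | a s s' A A'. A \<in> \<A> \<and> A' \<in> \<A>}"
    by (intro bdd_belowI[of _ 0]) (auto simp: L2_norm_plane_def)
qed (use assms in blast)

context lipschitz_template
begin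

lemma L2_pos: "0 < L2_norm_plane f"
  using L1_pos L1_le_L2_norm by linarith

text \<open>The scaling a = 0 is admissible and gives the quotient 1. A separation hypothesis with a
  large constant therefore restricts the resolution.\<close>

lemma separation1_le_1:
  assumes "id \<in> \<A>"
  shows "separation1 \<A> g f \<le> 1"
  using separation1_le[OF assms assms, of g f 0] L2_pos by (simp add: L2_norm_plane_def)

text \<open>The infimum runs over all scalings, so the factor b can be divided out. The L2 norm of
  \<open>f\<close> is replaced by the smaller L1 norm, with which the image norms are
  comparable.\<close>

lemma separated_integral:
  assumes sep: "sqrt x \<le> separation1 \<A> g f" and x: "0 \<le> x" and b: "0 < b"
    and A: "A \<in> \<A>" "A' \<in> \<A>"
  shows "x * (b * L1_norm f)\<^sup>2 \<le> (LINT z|lborel. (a * g (shift s s' A z) - b * f (A' z))\<^sup>2)"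
proof -
  let ?h = "\<lambda>z. a / b * g (shift s s' A z) - f (A' z)"
  have "sqrt x \<le> L2_norm_plane ?h / L2_norm_plane f"
    using separation1_le[OF A, of g f "a / b" s s'] sep by linarith
  then have "sqrt x * L2_norm_plane f \<le> L2_norm_plane ?h" using L2_pos by (simp add: field_simps)
  moreover have "sqrt x * L1_norm f \<le> sqrt x * L2_norm_plane f"
    using x L1_le_L2_norm by (intro mult_left_mono) auto
  ultimately have "(sqrt x * L1_norm f)\<^sup>2 \<le> (L2_norm_plane ?h)\<^sup>2"
    using x L1_nonneg by (intro power_mono) auto
  then have "x * (L1_norm f)\<^sup>2 \<le> (LINT z|lborel. (?h z)\<^sup>2)"
    using x by (simp add: power_mult_distrib L2_norm_plane_def)
  then have "b\<^sup>2 * (x * (L1_norm f)\<^sup>2) \<le> b\<^sup>2 * (LINT z|lborel. (?h z)\<^sup>2)"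
    by (intro mult_left_mono) auto
  also have "\<dots> = (LINT z|lborel. b\<^sup>2 * (?h z)\<^sup>2)" by simp
  also have "\<dots> = (LINT z|lborel. (a * g (shift s s' A z) - b * f (A' z))\<^sup>2)"
    using b by (intro Bochner_Integration.integral_cong refl) (simp add: power_mult_distrib[symmetric] right_diff_distrib)
  finally show ?thesis by (simp add: power_mult_distrib mult_ac)
qed

end

lemma integral_translation_plane:
  fixes h :: "real \<times> real \<Rightarrow> real"
  assumes [measurable]: "h \<in> borel_measurable borel"
  shows "(LINT z|lborel. h (fst z + s, snd z + t)) = (LINT z|lborel. h z)"
proof -
  have "(LINT z|lborel. h z) = (LINT z|distr lborel borel ((+) (s, t)). h z)"
    by (simp add: lborel_distr_plus)
  also have "\<dots> = (LINT z|lborel. h ((s, t) + z))"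
    by (subst integral_distr) auto
  finally show ?thesis by (simp add: plus_prod_def add.commute)
qed

lemma sup_norm_ge:
  assumes "bounded_C1 B (fst \<circ> A)" "bounded_C1 B (snd \<circ> A)" "bounded_C1 B (fst \<circ> A')" "bounded_C1 B (snd \<circ> A')"
    and z: "z \<in> unit_square"
  shows "\<bar>fst (A z) - fst (A' z)\<bar> \<le> sup_norm (\<lambda>z. A z - A' z)"
    and "\<bar>snd (A z) - snd (A' z)\<bar> \<le> sup_norm (\<lambda>z. A z - A' z)"
proof -
  \<comment> \<open>A supremum bounds its values only over a bounded set; the derivative bounds
    ensure this on the unit square.\<close>
  have bdd: "bdd_above ((\<lambda>z. \<bar>g z - g' z\<bar>) ` unit_square)" if "bounded_C1 B g" "bounded_C1 B g'" for g g'
  proof (intro bdd_aboveI2)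
    fix z :: "real \<times> real" assume z: "z \<in> unit_square"
    have B: "0 \<le> B" using that unfolding bounded_C1_def by (meson abs_ge_zero order_trans)
    have "B * (\<bar>fst z - fst (0 :: real \<times> real)\<bar> + \<bar>snd z - snd (0 :: real \<times> real)\<bar>) \<le> B * (1 + 1)"
      using z B by (intro mult_left_mono add_mono) (auto simp: unit_square_def)
    then show "\<bar>g z - g' z\<bar> \<le> \<bar>g 0\<bar> + \<bar>g' 0\<bar> + 2 * (B * (1 + 1))"
      using bounded_C1_lipschitz[OF that(1), of z 0] bounded_C1_lipschitz[OF that(2), of z 0] by linarith
  qed
  have "\<bar>fst (A z - A' z)\<bar> \<le> (SUP z\<in>unit_square. \<bar>fst (A z - A' z)\<bar>)"
    using bdd[OF assms(1,3)] by (intro cSUP_upper z) simp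
  then show "\<bar>fst (A z) - fst (A' z)\<bar> \<le> sup_norm (\<lambda>z. A z - A' z)" by (simp add: sup_norm_def)
  have "\<bar>snd (A z - A' z)\<bar> \<le> (SUP z\<in>unit_square. \<bar>snd (A z - A' z)\<bar>)"
    using bdd[OF assms(2,4)] by (intro cSUP_upper z) simp
  then show "\<bar>snd (A z) - snd (A' z)\<bar> \<le> sup_norm (\<lambda>z. A z - A' z)" by (simp add: sup_norm_def)
qed

lemma pixel_approx_mono: "pixel_approx d F \<delta> y \<Longrightarrow> \<delta> \<le> \<delta>' \<Longrightarrow> pixel_approx d F \<delta>' y"
  unfolding pixel_approx_def by (meson order_trans)

lemma correlation_scale:
  assumes "\<And>p. p \<in> {1..d} \<times> {1..d} \<Longrightarrow> X p = y p / v"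
  shows "correlation d (\<lambda>p. w p / u) X s t = correlation d w y s t / (u * v)"
proof -
  have "zero_ext d X i j = zero_ext d y i j / v" for i j
    using assms[of "(nat i, nat j)"] by (auto simp: zero_ext_def nat_le_iff le_nat_iff)
  then show ?thesis
    by (simp add: correlation_def sum_divide_distrib case_prod_beta)
qed

lemma (in deformed_template) normalize_deformed_image:
  assumes "0 < \<eta>" "p \<in> {1..d} \<times> {1..d}"
  shows "normalize_image d (deformed_image d f A \<eta>) p = pixel_average d p / image_norm d (pixel_average d)"
proof -
  have eq: "deformed_image d f A \<eta> q = \<eta> * pixel_average d q" if "q \<in> {1..d} \<times> {1..d}" for q
    using that by (auto simp: deformed_image_def pixel_average_def)
  have "(\<Sum>q\<in>{1..d} \<times> {1..d}. (deformed_image d f A \<eta> q)\<^sup>2) = (\<Sum>q\<in>{1..d} \<times> {1..d}. \<eta>\<^sup>2 * (pixel_average d q)\<^sup>2)"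
    by (intro sum.cong refl) (simp add: eq power_mult_distrib)
  also have "\<dots> = \<eta>\<^sup>2 * (\<Sum>q\<in>{1..d} \<times> {1..d}. (pixel_average d q)\<^sup>2)"
    by (simp add: sum_distrib_left)
  finally have "sqrt (\<Sum>q\<in>{1..d} \<times> {1..d}. (deformed_image d f A \<eta> q)\<^sup>2) = \<eta> * image_norm d (pixel_average d)"
    using assms(1) by (simp add: real_sqrt_mult image_norm_def)
  then show ?thesis using assms eq[OF assms(2)] by (simp add: normalize_image_def)
qed

text \<open>The error of \<open>correlation_ge\<close> with \<open>\<delta>\<close> and
  \<open>L\<close> as in \<open>matching_correlation\<close>: 648 = 81 * 4^2 / 2, and 128^2 stems
  from the lower bound for the norms.\<close>

definition error_const :: "real \<Rightarrow> real \<Rightarrow> real" where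
  "error_const C K = 648 * 128\<^sup>2 * (2 * C * K) ^ 6"

text \<open>The first summand outweighs the loss of matching correlations, the discretization error
  with 4 * 72 * 256^2 = 18 * 4^2 * 256^2, and a further gap. The other summands dominate what
  \<open>eps_le\<close> needs to be small. Absolute values keep the constant positive for all real
  arguments.\<close>

definition separation_const :: "real \<Rightarrow> real \<Rightarrow> real" where
  "separation_const C K = 4 * (2 * C + 1)\<^sup>2 * (error_const C K + 72 * 256\<^sup>2 * (2 * C * K) ^ 6 + 1)
     + error_const C K + 1 + 512 * \<bar>2 * C * K\<bar> ^ 3 + 4 * \<bar>2 * C * K\<bar>"

lemma error_const_nonneg: "0 \<le> error_const C K"
  by (simp add: error_const_def)

lemma separation_const_pos: "0 < separation_const C K"
  unfolding separation_const_def using error_const_nonneg[of C K]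
  by (intro add_pos_nonneg add_nonneg_pos) (auto intro!: mult_nonneg_nonneg)

lemma separation_const_ge:
  "4 * (2 * C + 1)\<^sup>2 * (error_const C K + 72 * 256\<^sup>2 * (2 * C * K) ^ 6 + 1) \<le> separation_const C K"
  "error_const C K + 1 \<le> separation_const C K"
  "512 * (2 * C * K) ^ 3 \<le> separation_const C K"
  "4 * (2 * C * K) \<le> separation_const C K"
proof -
  have "0 \<le> 4 * (2 * C + 1)\<^sup>2 * (error_const C K + 72 * 256\<^sup>2 * (2 * C * K) ^ 6 + 1)"
    using error_const_nonneg[of C K] by (intro mult_nonneg_nonneg add_nonneg_nonneg) auto
  moreover have "(2 * C * K) ^ 3 \<le> \<bar>2 * C * K\<bar> ^ 3" by (metis abs_ge_self power_abs)
  moreover have "0 \<le> \<bar>2 * C * K\<bar> ^ 3" by simp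
  ultimately show "4 * (2 * C + 1)\<^sup>2 * (error_const C K + 72 * 256\<^sup>2 * (2 * C * K) ^ 6 + 1) \<le> separation_const C K"
    "error_const C K + 1 \<le> separation_const C K"
    "512 * (2 * C * K) ^ 3 \<le> separation_const C K"
    "4 * (2 * C * K) \<le> separation_const C K"
    unfolding separation_const_def using error_const_nonneg[of C K] by linarith+
qed

section \<open>Matching and mismatching templates at resolution
  \<open>d powr (- \<alpha>)\<close>\<close>

locale cnn_model =
  fixes f0 f1 :: template and R :: "(real \<times> real) set" and C K :: real and \<A> :: "deformation set"
    and d :: nat and \<alpha> :: real
  assumes template: "lipschitz_template f0 C" "lipschitz_template f1 C"
    and supp_R: "support f0 \<subseteq> R" "support f1 \<subseteq> R"
    and assm2: "assumption2i f0 f1 R K \<A>"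
    and d: "1 \<le> d" and \<alpha>: "0 < \<alpha>" "\<alpha> \<le> 1"
    and sep: "sqrt (separation_const C K / real d powr \<alpha>) \<le> separation \<A> f0 f1"
begin

definition tf :: "bool \<Rightarrow> template" where "tf b = (if b then f1 else f0)"

definition e :: real where "e = real d powr (- \<alpha>)"

definition bw :: nat where "bw = nat \<lfloor>real d powr (1 - \<alpha>) + 1\<rfloor>"

definition lam :: real where "lam = 2 * C * K"

lemma K_ge_1: "1 \<le> K"
  using assm2 bounded_C1_id unfolding assumption2i_def assumption2i_map_def by blast

lemma template_tf: "lipschitz_template (tf b) C"
  using template by (simp add: tf_def)

lemma deformed: "A \<in> \<A> \<Longrightarrow> deformed_template (tf b) C A K R"
  unfolding deformed_template_def deformed_template_axioms_def
  using template_tf[of b] assm2 supp_R K_ge_1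
  by (auto simp: assumption2i_def assumption2i_map_def tf_def split: if_splits)

lemma C_pos: "0 < C" using template(1) by (rule lipschitz_template.C_pos)

lemma lam_pos: "0 < lam" using C_pos K_ge_1 by (simp add: lam_def)

lemma e_pos: "0 < e" using d by (simp add: e_def)

lemma Lam_eq: "A \<in> \<A> \<Longrightarrow> deformed_template.\<Lambda> C K = lam"
  by (simp add: deformed_template.\<Lambda>_def[OF deformed] lam_def)

lemma separation_eq: "separation_const C K / real d powr \<alpha> = separation_const C K * e"
  by (simp add: e_def powr_minus_divide)

lemma separation_e_le_1: "separation_const C K * e \<le> 1"
proof -
  have id: "id \<in> \<A>" using assm2 by (simp add: assumption2i_def)
  have "sqrt (separation_const C K * e) \<le> separation \<A> f0 f1" using sep by (simp only: separation_eq)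
  also have "\<dots> \<le> 1"
    unfolding separation_def using lipschitz_template.separation1_le_1[OF template(2) id]
      lipschitz_template.separation1_le_1[OF template(1) id] by simp
  finally show ?thesis by (simp add: real_sqrt_le_1_iff)
qed

text \<open>Each coefficient of \<open>e\<close> is dominated by
  \<open>separation_const C K\<close>, and the separation quantity being at most 1 forces
  \<open>separation_const C K * e \<le> 1\<close>.\<close>

lemma eps_le: "4 * lam * e \<le> 1" "4 * lam * e \<le> 1 / (128 * lam\<^sup>2)" "(error_const C K + 1) * e \<le> 1" "e \<le> 1"
proof -
  have *: "x * e \<le> 1" if "x \<le> separation_const C K" for x
    using mult_right_mono[OF that less_imp_le[OF e_pos]] separation_e_le_1 by linarith
  show "4 * lam * e \<le> 1" using *[OF separation_const_ge(4)] by (simp add: lam_def)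
  have "512 * lam ^ 3 * e \<le> 1" using *[OF separation_const_ge(3)] by (simp add: lam_def)
  then show "4 * lam * e \<le> 1 / (128 * lam\<^sup>2)"
    using lam_pos by (simp add: field_simps power2_eq_square power3_eq_cube)
  show "(error_const C K + 1) * e \<le> 1" using *[OF separation_const_ge(2)] .
  show "e \<le> 1" using *[of 1] separation_const_ge(2)[of C K] error_const_nonneg[of C K] by simp
qed

lemma bw_bounds: "1 \<le> bw" "real bw / d \<le> 2 * e"
proof -
  have p: "1 \<le> real d powr (1 - \<alpha>)" using d \<alpha> by (intro ge_one_powr_ge_zero) auto
  then show "1 \<le> bw" unfolding bw_def by linarith
  have "real bw \<le> real d powr (1 - \<alpha>) + 1" using p unfolding bw_def by linarith
  also have "\<dots> \<le> 2 * real d powr (1 - \<alpha>)" using p by simp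
  also have "real d powr (1 - \<alpha>) = d * e" using d by (simp add: e_def powr_diff powr_minus_divide)
  finally show "real bw / d \<le> 2 * e" using d by (simp add: field_simps)
qed

abbreviation "w b A \<equiv> deformed_template.block_sample (tf b) A d bw"
abbreviation "y b A \<equiv> deformed_template.pixel_average (tf b) A d"

lemma w_approx:
  assumes "A \<in> \<A>"
  shows "pixel_approx d (\<lambda>z. tf b (A z)) (4 * lam * e * L1_norm (tf b)) (w b A)"
proof (rule pixel_approx_mono[OF deformed_template.block_sample_approx[OF deformed[OF assms] d bw_bounds(1)]])
  have "2 * lam * (real bw / d) * L1_norm (tf b) \<le> 2 * lam * (2 * e) * L1_norm (tf b)"
    using lam_pos bw_bounds(2) lipschitz_template.L1_nonneg[OF template_tf]
    by (intro mult_right_mono mult_left_mono) auto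
  then show "2 * deformed_template.\<Lambda> C K * bw / d * L1_norm (tf b) \<le> 4 * lam * e * L1_norm (tf b)"
    by (simp add: Lam_eq[OF assms])
qed

lemma y_approx:
  assumes "A \<in> \<A>"
  shows "pixel_approx d (\<lambda>z. tf b (A z)) (4 * lam * e * L1_norm (tf b)) (y b A)"
proof (rule pixel_approx_mono[OF deformed_template.pixel_average_approx[OF deformed[OF assms] d]])
  have "1 / d \<le> real bw / d" using bw_bounds(1) by (simp add: divide_right_mono)
  then have "2 * lam * (1 / d) * L1_norm (tf b) \<le> 2 * lam * (2 * e) * L1_norm (tf b)"
    using lam_pos bw_bounds(2) lipschitz_template.L1_nonneg[OF template_tf]
    by (intro mult_right_mono mult_left_mono) auto
  then show "2 * deformed_template.\<Lambda> C K / d * L1_norm (tf b) \<le> 4 * lam * e * L1_norm (tf b)"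
    by (simp add: Lam_eq[OF assms])
qed

lemma norm_bounds:
  assumes "A \<in> \<A>" "pixel_approx d (\<lambda>z. tf b (A z)) (4 * lam * e * L1_norm (tf b)) x"
  shows "d * L1_norm (tf b) / (128 * lam\<^sup>2) \<le> image_norm d x"
    and "image_norm d x \<le> d * ((2 * C + 1) * L1_norm (tf b))"
    and "0 < image_norm d x"
proof -
  show ge: "d * L1_norm (tf b) / (128 * lam\<^sup>2) \<le> image_norm d x"
    using deformed_template.image_norm_ge[OF deformed[OF assms(1)] d assms(2)] eps_le lam_pos e_pos
    by (simp add: Lam_eq[OF assms(1)])
  show "image_norm d x \<le> d * ((2 * C + 1) * L1_norm (tf b))"
    using deformed_template.image_norm_le[OF deformed[OF assms(1)] d assms(2)] eps_le lam_pos e_pos by simp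
  have "0 < d * L1_norm (tf b) / (128 * lam\<^sup>2)"
    using d lam_pos lipschitz_template.L1_pos[OF template_tf[of b]] by simp
  then show "0 < image_norm d x" using ge by linarith
qed

lemma inverse_d_le: "1 / d \<le> e"
proof -
  have "real d powr (- 1) \<le> real d powr (- \<alpha>)" using d \<alpha> by (intro powr_mono) auto
  then show ?thesis using d by (simp add: e_def powr_minus_divide)
qed

text \<open>The shifts \<^term>\<open>j\<close> and \<^term>\<open>l\<close> of \<^const>\<open>assumption3\<close> are real numbers, so they are rounded to
  the pixel grid here; this costs an error of order \<^term>\<open>1 / d\<close> only.\<close>

lemma matching_correlation:
  fixes j l :: real
  assumes A: "A \<in> \<A>" "A' \<in> \<A>" and j: "j \<in> {1..real d}" "l \<in> {1..real d}"
    and map: "assumption2i_map f0 f1 R K (shift (j / d) (l / d) A')"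
    and close: "sup_norm (\<lambda>z. shift (j / d) (l / d) A' z - A z) \<le> e"
  shows "image_norm d (w b A') * image_norm d (y b A) * (1 - error_const C K * e)
    \<le> correlation d (w b A') (y b A) (- \<lfloor>j\<rfloor>) (- \<lfloor>l\<rfloor>)"
proof -
  let ?N = "L1_norm (tf b)" and ?B = "shift (j / d) (l / d) A'"
  have N: "0 < ?N" by (rule lipschitz_template.L1_pos[OF template_tf])
  have mapA: "assumption2i_map f0 f1 R K A" using assm2 A(1) by (simp add: assumption2i_def)
  have "\<bar>tf b (A' z) - tf b (A (fst z + real_of_int (- \<lfloor>j\<rfloor>) / d, snd z + real_of_int (- \<lfloor>l\<rfloor>) / d))\<bar>
      \<le> 4 * lam * e * ?N" for z
  proof -
    \<comment> \<open>With this choice \<open>?B z'\<close> evaluates \<open>A'\<close> within one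
      pixel width of \<open>z\<close> in each coordinate.\<close>
    define z' where "z' = (fst z + real_of_int (- \<lfloor>j\<rfloor>) / d, snd z + real_of_int (- \<lfloor>l\<rfloor>) / d)"
    have "\<bar>tf b (?B z') - tf b (A z')\<bar> \<le> lam * e * ?N"
    proof (cases "z' \<in> unit_square")
      case True
      have "\<bar>fst (?B z') - fst (A z')\<bar> \<le> e" "\<bar>snd (?B z') - snd (A z')\<bar> \<le> e"
        using sup_norm_ge[of K ?B A, OF _ _ _ _ True] map mapA close
        unfolding assumption2i_map_def by (meson order_trans)+
      then have "C * ?N * (\<bar>fst (?B z') - fst (A z')\<bar> + \<bar>snd (?B z') - snd (A z')\<bar>) \<le> C * ?N * (e + e)"
        using C_pos N by (intro mult_left_mono add_mono) auto
      then have "\<bar>tf b (?B z') - tf b (A z')\<bar> \<le> C * ?N * (e + e)"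
        using lipschitz_template.lip_pair[OF template_tf, of b "?B z'" "A z'"] by linarith
      also have "\<dots> = 2 * (C * 1) * e * ?N" by simp
      also have "\<dots> \<le> 2 * (C * K) * e * ?N"
        using C_pos N e_pos K_ge_1 by (intro mult_right_mono mult_mono) auto
      finally show ?thesis by (simp add: lam_def)
    next
      \<comment> \<open>The sup norm gives no control here, but full visibility makes both deformed
        templates vanish.\<close>
      case False
      then have "tf b (?B z') = 0" "tf b (A z') = 0"
        using map mapA by (auto simp: assumption2i_map_def support_def tf_def)
      then show ?thesis using lam_pos e_pos N by simp
    qed
    moreover have "\<bar>tf b (A' z) - tf b (?B z')\<bar> \<le> 2 * lam * e * ?N"
    proof -
      let ?z = "(fst z' + j / d, snd z' + l / d)"
      have round: "\<bar>x - (x + real_of_int (- \<lfloor>r\<rfloor>) / d + r / d)\<bar> \<le> e" for x r :: real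
      proof -
        have "x - (x + real_of_int (- \<lfloor>r\<rfloor>) / d + r / d) = (\<lfloor>r\<rfloor> - r) / d"
          by (simp add: diff_divide_distrib)
        moreover have "\<bar>\<lfloor>r\<rfloor> - r\<bar> \<le> 1" by linarith
        then have "\<bar>(\<lfloor>r\<rfloor> - r) / d\<bar> \<le> 1 / d" by (simp add: divide_right_mono)
        ultimately show ?thesis using inverse_d_le by linarith
      qed
      have "\<bar>tf b (A' z) - tf b (A' ?z)\<bar> \<le> lam * ?N * (\<bar>fst z - fst ?z\<bar> + \<bar>snd z - snd ?z\<bar>)"
        using deformed_template.F_lip[OF deformed[OF A(2)], of b z ?z] by (simp only: Lam_eq[OF A(2)])
      also have "\<dots> \<le> lam * ?N * (e + e)"
        using round lam_pos N by (intro mult_left_mono add_mono) (auto simp: z'_def)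
      finally show ?thesis by (simp add: shift_apply algebra_simps)
    qed
    moreover have "0 \<le> lam * e * ?N" using lam_pos e_pos N by simp
    \<comment> \<open>The contributions \<open>lam\<close> and \<open>2 * lam\<close> stay below the
      \<open>4 * lam\<close> already spent on the discretizations.\<close>
    ultimately show ?thesis unfolding z'_def[symmetric] by linarith
  qed
  moreover have floor_bounds: "\<bar>- \<lfloor>j\<rfloor>\<bar> \<le> int d" "\<bar>- \<lfloor>l\<rfloor>\<bar> \<le> int d"
    using j by (auto simp: abs_le_iff floor_le_iff le_floor_iff)
  ultimately have "image_norm d (w b A') * image_norm d (y b A)
      * (1 - 81 * (real d)\<^sup>2 * (4 * lam * e * ?N)\<^sup>2 / (2 * (d * ?N / (128 * lam\<^sup>2))\<^sup>2))
    \<le> correlation d (w b A') (y b A) (- \<lfloor>j\<rfloor>) (- \<lfloor>l\<rfloor>)"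
    using floor_bounds d N lam_pos
    by (intro correlation_ge[OF d y_approx[OF A(1)] w_approx[OF A(2)] _ _ _ _
          norm_bounds(1)[OF A(2) w_approx[OF A(2)]] norm_bounds(1)[OF A(1) y_approx[OF A(1)]]]) auto
  moreover have "81 * (real d)\<^sup>2 * (4 * lam * e * ?N)\<^sup>2 / (2 * (d * ?N / (128 * lam\<^sup>2))\<^sup>2) = error_const C K * e\<^sup>2"
    using d N lam_pos unfolding error_const_def lam_def[symmetric]
    by (simp add: field_simps power_mult_distrib power2_eq_square eval_nat_numeral)
  moreover have "error_const C K * e\<^sup>2 \<le> error_const C K * e"
    using eps_le(4) e_pos error_const_nonneg by (intro mult_left_mono) (auto simp: power2_eq_square)
  then have "image_norm d (w b A') * image_norm d (y b A) * (1 - error_const C K * e)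
      \<le> image_norm d (w b A') * image_norm d (y b A) * (1 - error_const C K * e\<^sup>2)"
    by (intro mult_left_mono) (auto simp: image_norm_nonneg)
  ultimately show ?thesis by simp
qed

text \<open>The separation quantity is a maximum, so either direction may be the large one; the
  minimum of the scaled norms is safe for both. In the second case the shift sits on the other
  function, and a translation of the plane moves it back.\<close>

lemma mismatch_integral:
  assumes A: "A \<in> \<A>" "A' \<in> \<A>" and c: "0 < c" "0 < c'"
  shows "separation_const C K * e * (min (c * L1_norm (tf (\<not> b))) (c' * L1_norm (tf b)))\<^sup>2
    \<le> (LINT z|lborel. (c * tf (\<not> b) (A' z) - c' * tf b (A (fst z + s, snd z + t)))\<^sup>2)" (is "?x * ?min\<^sup>2 \<le> ?int")
proof -
  have x: "0 \<le> ?x" using separation_const_pos e_pos by (simp add: less_imp_le)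
  have min: "?x * ?min\<^sup>2 \<le> ?x * (c * L1_norm (tf (\<not> b)))\<^sup>2" "?x * ?min\<^sup>2 \<le> ?x * (c' * L1_norm (tf b))\<^sup>2"
    using x c lipschitz_template.L1_nonneg[OF template_tf] by (auto intro!: mult_left_mono power_mono)
  have "sqrt ?x \<le> separation \<A> f0 f1" using sep by (simp only: separation_eq)
  then have "sqrt ?x \<le> separation1 \<A> (tf b) (tf (\<not> b)) \<or> sqrt ?x \<le> separation1 \<A> (tf (\<not> b)) (tf b)"
    by (cases b) (auto simp: separation_def tf_def)
  then show ?thesis
  proof
    assume "sqrt ?x \<le> separation1 \<A> (tf b) (tf (\<not> b))"
    from lipschitz_template.separated_integral[OF template_tf this x c(1) A, of c' s t]
    have "?x * (c * L1_norm (tf (\<not> b)))\<^sup>2 \<le> ?int"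
      by (simp add: shift_apply power2_commute)
    then show ?thesis using min by linarith
  next
    assume "sqrt ?x \<le> separation1 \<A> (tf (\<not> b)) (tf b)"
    from lipschitz_template.separated_integral[OF template_tf this x c(2) A(2,1), of c "- s" "- t"]
    have "?x * (c' * L1_norm (tf b))\<^sup>2
        \<le> (LINT z|lborel. (c * tf (\<not> b) (A' (fst z - s, snd z - t)) - c' * tf b (A z))\<^sup>2)"
      by (simp add: shift_apply)
    also have "\<dots> = ?int"
    proof -
      have [measurable]: "(\<lambda>z. tf b (A z)) \<in> borel_measurable borel" "(\<lambda>z. tf (\<not> b) (A' z)) \<in> borel_measurable borel"
        using deformed_template.F_measurable[OF deformed] A by auto
      have [measurable]: "(\<lambda>z. tf (\<not> b) (A' (fst z - s, snd z - t))) \<in> borel_measurable borel"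
        by (rule measurable_compose[of "\<lambda>z. (fst z - s, snd z - t)" borel borel])
           (auto intro!: borel_measurable_continuous_onI continuous_intros)
      show ?thesis
        by (subst integral_translation_plane[symmetric, of _ s t]) (simp_all, measurable)
    qed
    finally show ?thesis using min by linarith
  qed
qed

text \<open>After normalization the scales \<open>?a * ?M\<close> and \<open>?b * ?N\<close> lie
  between \<open>1 / (d * (2 * C + 1))\<close> and \<open>128 * lam\<^sup>2 / d\<close>. Separation
  thus contributes \<open>?\<kappa> / (2 * C + 1)\<^sup>2 * e\<close>, discretization costs only
  order \<open>e\<^sup>2\<close>, and the constant leaves a surplus of \<open>e\<close> over the
  loss of matching correlations.\<close>

lemma mismatching_correlation:
  assumes A: "A \<in> \<A>" "A' \<in> \<A>" and st: "\<bar>s\<bar> \<le> int d" "\<bar>t\<bar> \<le> int d"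
  shows "correlation d (w (\<not> b) A') (y b A) s t
    \<le> image_norm d (w (\<not> b) A') * image_norm d (y b A) * (1 - (error_const C K + 1) * e)"
proof -
  let ?W = "image_norm d (w (\<not> b) A')" and ?Y = "image_norm d (y b A)"
  let ?M = "L1_norm (tf (\<not> b))" and ?N = "L1_norm (tf b)"
  let ?a = "1 / ?W" and ?b = "1 / ?Y" and ?c = "correlation d (w (\<not> b) A') (y b A) s t"
  let ?\<kappa> = "separation_const C K" and ?L = "128 * lam\<^sup>2"
  have MN: "0 < ?M" "0 < ?N" using lipschitz_template.L1_pos[OF template_tf] by auto
  note W = norm_bounds[OF A(2) w_approx[OF A(2)], of "\<not> b"]
  note Y = norm_bounds[OF A(1) y_approx[OF A(1)], of b]
  have C1: "0 < 2 * C + 1" using C_pos by simp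
  have low: "1 / (d * q) \<le> 1 / x * L" if "x \<le> d * (q * L)" "0 < x" "0 < q" for x q L :: real
    using that d by (simp add: field_simps)
  have lower: "1 / (d * (2 * C + 1)) \<le> ?a * ?M" "1 / (d * (2 * C + 1)) \<le> ?b * ?N"
    using low W Y C1 by blast+
  have upper: "?a * ?M \<le> ?L / d" "?b * ?N \<le> ?L / d"
    using W Y MN d lam_pos by (auto simp: field_simps)
  have "?\<kappa> * e * (1 / (d * (2 * C + 1)))\<^sup>2 \<le> ?\<kappa> * e * (min (?a * ?M) (?b * ?N))\<^sup>2"
    using lower separation_const_pos[of C K] e_pos C1 by (intro mult_left_mono power_mono) auto
  also have "\<dots> \<le> (LINT z|lborel. (?a * tf (\<not> b) (A' z) - ?b * tf b (A (fst z + real_of_int s / d, snd z + real_of_int t / d)))\<^sup>2)"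
    using W Y by (intro mismatch_integral[OF A]) auto
  finally have sep_int: "?\<kappa> * e * (1 / (d * (2 * C + 1)))\<^sup>2 \<le> \<dots>" .
  let ?Q = "(?a * (4 * lam * e * ?M) + ?b * (4 * lam * e * ?N))\<^sup>2"
  have 1: "(real d)\<^sup>2 * (?\<kappa> * e * (1 / (d * (2 * C + 1)))\<^sup>2) \<le>
      4 * (1 - ?a * ?b * ?c) + 18 * (real d)\<^sup>2 * ?Q"
    using lam_pos e_pos MN W Y
    by (intro correlation_le[OF d y_approx[OF A(1)] deformed_template.F_vanishing[OF deformed[OF A(1)]]
          w_approx[OF A(2)] deformed_template.F_vanishing[OF deformed[OF A(2)]] st _ _ _ _ sep_int]) auto
  have "?Q \<le> (4 * lam * e * (?L / d + ?L / d))\<^sup>2"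
  proof (rule power_mono)
    have "4 * lam * e * (?a * ?M + ?b * ?N) \<le> 4 * lam * e * (?L / d + ?L / d)"
      using upper lam_pos e_pos by (intro mult_left_mono add_mono) auto
    then show "?a * (4 * lam * e * ?M) + ?b * (4 * lam * e * ?N) \<le> 4 * lam * e * (?L / d + ?L / d)"
      by (simp add: algebra_simps)
    show "0 \<le> ?a * (4 * lam * e * ?M) + ?b * (4 * lam * e * ?N)"
      using MN W Y lam_pos e_pos by (intro add_nonneg_nonneg mult_nonneg_nonneg) auto
  qed
  then have 2: "18 * (real d)\<^sup>2 * ?Q \<le> 18 * (real d)\<^sup>2 * (4 * lam * e * (?L / d + ?L / d))\<^sup>2"
    by (intro mult_left_mono) auto
  have 3: "18 * (real d)\<^sup>2 * (4 * lam * e * (?L / d + ?L / d))\<^sup>2 = 4 * (72 * 256\<^sup>2 * lam ^ 6) * e\<^sup>2"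
    using d by (simp add: field_simps power2_eq_square eval_nat_numeral)
  have 4: "(real d)\<^sup>2 * (?\<kappa> * e * (1 / (d * (2 * C + 1)))\<^sup>2) = ?\<kappa> / (2 * C + 1)\<^sup>2 * e"
    using d by (simp add: power_divide power_mult_distrib)
  have *: "?\<kappa> / (2 * C + 1)\<^sup>2 * e \<le> 4 * (1 - ?a * ?b * ?c) + 4 * (72 * 256\<^sup>2 * lam ^ 6) * e\<^sup>2"
    using 1 2 unfolding 3 4 by linarith
  have "4 * (error_const C K + 72 * 256\<^sup>2 * lam ^ 6 + 1) \<le> ?\<kappa> / (2 * C + 1)\<^sup>2"
    using separation_const_ge(1)[of C K] C1 by (simp add: lam_def field_simps)
  then have "4 * (error_const C K + 72 * 256\<^sup>2 * lam ^ 6 + 1) * e \<le> ?\<kappa> / (2 * C + 1)\<^sup>2 * e"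
    using e_pos by (intro mult_right_mono) auto
  moreover have "72 * 256\<^sup>2 * lam ^ 6 * e\<^sup>2 \<le> 72 * 256\<^sup>2 * lam ^ 6 * e"
    using eps_le(4) e_pos by (intro mult_left_mono) (auto simp: power2_eq_square)
  ultimately have "?a * ?b * ?c \<le> 1 - (error_const C K + 1) * e"
    using * by (simp add: algebra_simps)
  then have "?W * ?Y * (?a * ?b * ?c) \<le> ?W * ?Y * (1 - (error_const C K + 1) * e)"
    using W Y by (intro mult_left_mono) auto
  then show ?thesis using W Y by simp
qed

end

text \<open>Filters \<open>2 * t\<close> and \<open>2 * t - 1\<close> belong to the t-th deformation
  of the cover, for classes 1 and 0. Parity thus encodes the class, as the thresholding network
  expects, and \<open>(s + 1) div 2\<close> recovers t.\<close>

lemma (in cnn_model) perfect_network: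
  fixes \<D> :: "deformation set"
  assumes \<D>: "finite \<D>" "\<D> \<subseteq> \<A>" and m: "2 \<le> card \<D>" "real d powr \<alpha> \<le> card \<D>"
    and cover: "\<And>A. A \<in> \<A> \<Longrightarrow> \<exists>A'\<in>\<D>. \<exists>j\<in>{1..real d}. \<exists>l\<in>{1..real d}.
      assumption2i_map f0 f1 R K (shift (j / d) (l / d) A') \<and>
      sup_norm (\<lambda>z. shift (j / d) (l / d) A' z - A z) \<le> real d powr (- \<alpha>)"
  obtains g where "(\<lambda>X. (1 - g X, g X)) \<in> cnn_class d \<alpha> (card \<D>)"
    and "\<And>A \<eta>. A \<in> \<A> \<Longrightarrow> 0 < \<eta> \<Longrightarrow> rho (-1) \<le> g (normalize_image d (deformed_image d f1 A \<eta>))"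
    and "\<And>A \<eta>. A \<in> \<A> \<Longrightarrow> 0 < \<eta> \<Longrightarrow> g (normalize_image d (deformed_image d f0 A \<eta>)) \<le> rho 1"
proof -
  define m where "m = card \<D>"
  obtain h where h: "bij_betw h {1..m} \<D>" unfolding m_def using ex_bij_betw_nat_finite_1[OF \<D>(1)] by blast
  define nw where "nw s = image_norm d (w (even s) (h ((s + 1) div 2)))" for s
  \<comment> \<open>Dividing by the norm bounds the entries by 1 and makes the scores of different
    filters comparable.\<close>
  define V where "V s = (\<lambda>p. w (even s) (h ((s + 1) div 2)) p / nw s)" for s
  define q where "q s = (SOME q. quadratic_support d (V s) q)" for s
  have q: "quadratic_support d (V s) (q s)" for s
    unfolding q_def using quadratic_support_exists[OF d] by (metis someI_ex)
  define l a b where "l s = fst (q s)" and "a s = fst (snd (q s))" and "b s = snd (snd (q s))" for s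
  have lab: "q s = (l s, a s, b s)" for s by (simp add: l_def a_def b_def)
  have cov: "covers_support d (V s) (l s, a s, b s)" for s
    using q[of s] by (simp add: lab quadratic_support_def)
  have half: "(s + 1) div 2 \<in> {1..m}" if "s \<in> {1..2 * m}" for s using that by auto
  have hA: "h ((s + 1) div 2) \<in> \<A>" if "s \<in> {1..2 * m}" for s
    using bij_betwE[OF h] half[OF that] \<D>(2) by blast
  have nw_pos: "0 < nw s" if "s \<in> {1..2 * m}" for s
    unfolding nw_def by (rule norm_bounds(3)[OF hA[OF that] w_approx[OF hA[OF that]]])
  have V: "quadratic_support d (V s) (q s) \<and> block_structure \<alpha> d (V s) \<and> (\<forall>p\<in>{1..d} \<times> {1..d}. \<bar>V s p\<bar> \<le> 1)"
    if s: "s \<in> {1..2 * m}" for s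
  proof (intro conjI q ballI)
    show "block_structure \<alpha> d (V s)"
      by (rule block_structure_anchor[of bw, OF _ bw_def bw_bounds(1)])
         (simp only: V_def deformed_template.block_sample_def[OF deformed[OF hA[OF s]]] case_prod_conv)
    show "\<bar>V s p\<bar> \<le> 1" if "p \<in> {1..d} \<times> {1..d}" for p
      using abs_le_image_norm[OF that, of "w (even s) (h ((s + 1) div 2))"] nw_pos[OF s]
      by (simp add: V_def nw_def)
  qed
  \<comment> \<open>The upper bound for the wrong class; adding \<open>e\<close> gives exactly the
    lower bound for a matching filter. The size condition on the cover says that this gap is at
    least \<open>1 / m\<close>.\<close>
  define \<tau> where "\<tau> = 1 - (error_const C K + 1) * e"
  have \<tau>: "0 \<le> \<tau>" "\<tau> \<le> 1" "\<tau> + e = 1 - error_const C K * e"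
    using eps_le(3) e_pos error_const_nonneg[of C K] by (auto simp: \<tau>_def algebra_simps)
  have e_ge: "1 / real m \<le> e"
  proof -
    have "0 < real d powr \<alpha>" using d by simp
    then show ?thesis using m(2) m(1) unfolding e_def powr_minus_divide m_def by (intro divide_left_mono) auto
  qed
  let ?X = "\<lambda>b A \<eta>. normalize_image d (deformed_image d (tf b) A \<eta>)"
  have corr: "correlation d (V s) (?X b A \<eta>) i j
      = correlation d (w (even s) (h ((s + 1) div 2))) (y b A) i j / (nw s * image_norm d (y b A))"
    if "A \<in> \<A>" "0 < \<eta>" for b A \<eta> s i j
    unfolding V_def by (rule correlation_scale) (rule deformed_template.normalize_deformed_image[OF deformed that(2)], use that in auto)
  have mismatch: "conv_feature d (V s) (q s) (?X b A \<eta>) \<le> \<tau>"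
    if A: "A \<in> \<A>" "0 < \<eta>" and s: "s \<in> {1..2 * m}" "even s = (\<not> b)" for b A \<eta> s
    unfolding lab
  proof (rule conv_feature_le[OF cov \<tau>(1)])
    fix i j :: int assume ij: "\<bar>i\<bar> \<le> int d" "\<bar>j\<bar> \<le> int d"
    have "0 < nw s * image_norm d (y b A)"
      using nw_pos[OF s(1)] norm_bounds(3)[OF A(1) y_approx[OF A(1)]] by simp
    moreover have "correlation d (w (even s) (h ((s + 1) div 2))) (y b A) i j \<le> nw s * image_norm d (y b A) * \<tau>"
      using mismatching_correlation[OF A(1) hA[OF s(1)] ij, of b] unfolding nw_def \<tau>_def s(2) .
    ultimately show "correlation d (V s) (?X b A \<eta>) i j \<le> \<tau>"
      unfolding corr[OF A] by (simp add: pos_divide_le_eq mult.commute)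
  qed
  have match: "\<exists>s\<in>{1..2 * m}. even s = b \<and> \<tau> + e \<le> conv_feature d (V s) (q s) (?X b A \<eta>)"
    if A: "A \<in> \<A>" "0 < \<eta>" for b A \<eta>
  proof -
    obtain A' i j where A': "A' \<in> \<D>" and ij: "i \<in> {1..real d}" "j \<in> {1..real d}"
      and map: "assumption2i_map f0 f1 R K (shift (i / d) (j / d) A')"
      and close: "sup_norm (\<lambda>z. shift (i / d) (j / d) A' z - A z) \<le> e"
      using cover[OF A(1)] unfolding e_def by blast
    obtain t where t: "t \<in> {1..m}" "h t = A'" using h A' by (auto simp: bij_betw_def)
    define s where "s = (if b then 2 * t else 2 * t - 1)"
    have s: "s \<in> {1..2 * m}" "even s = b" "(s + 1) div 2 = t" using t(1) by (auto simp: s_def)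
    have pos: "0 < nw s * image_norm d (y b A)"
      using nw_pos[OF s(1)] norm_bounds(3)[OF A(1) y_approx[OF A(1)]] by simp
    have "nw s * image_norm d (y b A) * (\<tau> + e) \<le> correlation d (w b A') (y b A) (- \<lfloor>i\<rfloor>) (- \<lfloor>j\<rfloor>)"
      unfolding nw_def s(2,3) t(2) \<tau>(3)
      by (rule matching_correlation[OF A(1) _ ij map close]) (use A' \<D>(2) in blast)
    then have "\<tau> + e \<le> correlation d (V s) (?X b A \<eta>) (- \<lfloor>i\<rfloor>) (- \<lfloor>j\<rfloor>)"
      unfolding corr[OF A] s(2,3) t(2) using pos by (simp add: pos_le_divide_eq mult.commute)
    also have "\<dots> \<le> conv_feature d (V s) (q s) (?X b A \<eta>)" unfolding lab by (rule conv_feature_ge[OF cov])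
    finally show ?thesis using s by blast
  qed
  show ?thesis
  proof (rule cnn_class_threshold[of m \<tau> e d V q \<alpha>])
    fix g
    assume g: "(\<lambda>X. (1 - g X, g X)) \<in> cnn_class d \<alpha> m"
      and g1: "\<And>X. (\<And>s. s \<in> {1..2 * m} \<Longrightarrow> odd s \<Longrightarrow> conv_feature d (V s) (q s) X \<le> \<tau>) \<Longrightarrow>
          \<exists>s\<in>{1..2 * m}. even s \<and> \<tau> + e \<le> conv_feature d (V s) (q s) X \<Longrightarrow> rho (-1) \<le> g X"
      and g0: "\<And>X. (\<And>s. s \<in> {1..2 * m} \<Longrightarrow> even s \<Longrightarrow> conv_feature d (V s) (q s) X \<le> \<tau>) \<Longrightarrow>
          \<exists>s\<in>{1..2 * m}. odd s \<and> \<tau> + e \<le> conv_feature d (V s) (q s) X \<Longrightarrow> g X \<le> rho 1"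
    show ?thesis
    proof (rule that)
      show "(\<lambda>X. (1 - g X, g X)) \<in> cnn_class d \<alpha> (card \<D>)" using g by (simp only: m_def)
      show "rho (-1) \<le> g (normalize_image d (deformed_image d f1 A \<eta>))" if "A \<in> \<A>" "0 < \<eta>" for A \<eta>
        using mismatch[OF that, of _ True] match[OF that, of True] by (intro g1) (auto simp: tf_def)
      show "g (normalize_image d (deformed_image d f0 A \<eta>)) \<le> rho 1" if "A \<in> \<A>" "0 < \<eta>" for A \<eta>
        using mismatch[OF that, of _ False] match[OF that, of False] by (intro g0) (auto simp: tf_def)
    qed
  next
    show "2 \<le> m" using m(1) by (simp only: m_def)
  qed (use \<tau>(1,2) e_ge V in auto)
qed

section \<open>Measurability\<close>

lemma conv_feature_measurable [measurable]:
  "conv_feature d W q \<in> borel_measurable (image_space d)"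
proof -
  obtain l a b where q: "q = (l, a, b)" by (cases q)
  have pad: "(\<lambda>X. pad d l X (i, j)) \<in> borel_measurable (image_space d)" for i j
  proof (cases "i \<in> {l+1..l+d} \<and> j \<in> {l+1..l+d}")
    case True
    then have "(i - l, j - l) \<in> {1..d} \<times> {1..d}" by auto
    then show ?thesis using True unfolding pad_def image_space_def by simp
  qed (auto simp: pad_def)
  then show ?thesis
    unfolding conv_feature_def q case_prod_conv convolution_def relu_def
    by (intro borel_measurable_Max) (auto simp: case_prod_beta)
qed

lemma relu_net_measurable:
  assumes "\<And>j. j \<in> {1..m 0} \<Longrightarrow> (\<lambda>X. x X j) \<in> borel_measurable M" "i \<in> {1..m k}"
  shows "(\<lambda>X. relu_net m W v k (x X) i) \<in> borel_measurable M"
  using assms(2)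
proof (induction k arbitrary: i)
  case (Suc k)
  then show ?case by (auto simp: relu_def intro!: borel_measurable_max borel_measurable_diff borel_measurable_sum borel_measurable_times)
qed (use assms(1) in simp)

lemma cnn_class_measurable:
  assumes g: "(\<lambda>X. (1 - g X, g X)) \<in> cnn_class d \<alpha> m"
  shows "g \<in> borel_measurable (image_space d)"
proof -
  let ?w = "cnn_widths m" and ?L = "cnn_depth m + 1"
  obtain F G where FG: "(\<lambda>X. (1 - g X, g X)) = F \<circ> G"
    "F \<in> fc_class softmax (cnn_depth m) ?w" "G \<in> conv_class d \<alpha> (2 * m)"
    using g unfolding cnn_class_def by auto
  obtain W v where F: "F = (\<lambda>x. softmax (relu_net ?w W v ?L x))"
    using FG(2) unfolding fc_class_def by auto
  obtain V q where G: "G = (\<lambda>X. \<lambda>s\<in>{1..2*m}. conv_feature d (V s) (q s) X)"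
    using FG(3) unfolding conv_class_def by blast
  have G_meas: "(\<lambda>X. G X s) \<in> borel_measurable (image_space d)" if "s \<in> {1..?w 0}" for s
    using that by (simp add: G cnn_widths_def)
  define y where "y i X = relu_net ?w W v ?L (G X) i" for i X
  have "y i \<in> borel_measurable (image_space d)" if "i \<in> {1, 2}" for i
    unfolding y_def using that G_meas by (intro relu_net_measurable) (auto simp: cnn_widths_def)
  then have [measurable]: "y 1 \<in> borel_measurable (image_space d)" "y 2 \<in> borel_measurable (image_space d)" by auto
  have "g X = rho (y 1 X - y 2 X)" for X
  proof -
    have "g X = snd ((F \<circ> G) X)" unfolding FG(1)[symmetric] by simp
    then show ?thesis by (simp add: F snd_softmax y_def)
  qed
  then have "g = (\<lambda>X. rho (y 1 X - y 2 X))" by blast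
  also have "\<dots> \<in> borel_measurable (image_space d)"
    unfolding rho_def by measurable
  finally show ?thesis .
qed

lemma normalize_image_measurable [measurable]:
  "normalize_image d \<in> image_space d \<rightarrow>\<^sub>M image_space d"
proof -
  have [measurable]: "(\<lambda>X. X p) \<in> borel_measurable (image_space d)" if "p \<in> {1..d} \<times> {1..d}" for p
    using that unfolding image_space_def by simp
  show ?thesis
    unfolding normalize_image_def
    by (subst (2) image_space_def) (intro measurable_restrict borel_measurable_divide borel_measurable_sqrt
      measurable_compose[OF _ borel_measurable_sqrt] borel_measurable_sum borel_measurable_power, auto)
qed

lemma floor_approx_tendsto: "(\<lambda>n. \<lfloor>real (Suc n) * x\<rfloor> / real (Suc n)) \<longlonglongrightarrow> x"
proof -
  have "(\<lambda>n. \<lfloor>real (Suc n) * x\<rfloor> / real (Suc n) - x) \<longlonglongrightarrow> 0"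
  proof (rule Lim_null_comparison[OF always_eventually LIMSEQ_inverse_real_of_nat], rule allI)
    fix n
    have "\<lfloor>real (Suc n) * x\<rfloor> / real (Suc n) - x = (\<lfloor>real (Suc n) * x\<rfloor> - real (Suc n) * x) / real (Suc n)"
      by (simp add: diff_divide_distrib)
    moreover have "\<bar>\<lfloor>real (Suc n) * x\<rfloor> - real (Suc n) * x\<bar> \<le> 1" by linarith
    ultimately show "norm (\<lfloor>real (Suc n) * x\<rfloor> / real (Suc n) - x) \<le> inverse (real (Suc n))"
      by (simp only: real_norm_def abs_divide inverse_eq_divide abs_of_nat) (intro divide_right_mono, auto)
  qed
  then show ?thesis by (simp add: LIM_zero_iff)
qed

text \<open>Only the point evaluations are measurable in A, so joint measurability in (A, z) comes
  from continuity: z is rounded to ever finer grids. A rounded map uses countably many evaluations,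
  each of them measurable.\<close>

lemma pixel_integral_measurable:
  fixes f :: "real \<times> real \<Rightarrow> real" and P :: "(real \<times> real) set"
  assumes QA: "\<And>z. (\<lambda>A. A z) \<in> QA \<rightarrow>\<^sub>M borel"
    and f [measurable]: "f \<in> borel_measurable borel" and P [measurable]: "P \<in> sets borel"
    and cont: "\<And>A. A \<in> space QA \<Longrightarrow> continuous_on UNIV (\<lambda>z. f (A z))"
  shows "(\<lambda>A. LINT z:P|lborel. f (A z)) \<in> borel_measurable QA"
proof -
  define r where "r n x = \<lfloor>real (Suc n) * x\<rfloor> / real (Suc n)" for n and x :: real
  have joint: "(\<lambda>(A, z). f (A z)) \<in> borel_measurable (QA \<Otimes>\<^sub>M lborel)"
  proof (rule borel_measurable_LIMSEQ_real)
    fix x assume "x \<in> space (QA \<Otimes>\<^sub>M (lborel :: (real \<times> real) measure))"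
    then have A: "fst x \<in> space QA" by (auto simp: space_pair_measure)
    have "(\<lambda>n. f (fst x (r n (fst (snd x)), r n (snd (snd x))))) \<longlonglongrightarrow> f (fst x (fst (snd x), snd (snd x)))"
      unfolding r_def using cont[OF A]
      by (intro isCont_tendsto_compose[of _ "\<lambda>z. f (fst x z)"] tendsto_Pair floor_approx_tendsto)
         (simp add: continuous_on_eq_continuous_at del: split_paired_All)
    then show "(\<lambda>n. case x of (A, z) \<Rightarrow> f (A (r n (fst z), r n (snd z)))) \<longlonglongrightarrow> (case x of (A, z) \<Rightarrow> f (A z))"
      by (simp add: case_prod_beta)
  next
    fix n
    let ?c = "\<lambda>x :: deformation \<times> real \<times> real. (\<lfloor>real (Suc n) * fst (snd x)\<rfloor>, \<lfloor>real (Suc n) * snd (snd x)\<rfloor>)"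
    have 1: "(\<lambda>x. f (fst x z)) \<in> borel_measurable (QA \<Otimes>\<^sub>M lborel)" for z
      by (rule measurable_compose[OF _ f]) (rule measurable_compose[OF measurable_fst QA])
    have 2: "?c \<in> QA \<Otimes>\<^sub>M lborel \<rightarrow>\<^sub>M count_space UNIV"
      by (subst lborel_prod[symmetric]) measurable
    have "(\<lambda>x. (\<lambda>i x. f (fst x (real_of_int (fst i) / real (Suc n), real_of_int (snd i) / real (Suc n)))) (?c x) x)
        \<in> borel_measurable (QA \<Otimes>\<^sub>M lborel)"
      by (rule measurable_compose_countable[OF 1 2])
    then show "(\<lambda>(A, z). f (A (r n (fst z), r n (snd z)))) \<in> borel_measurable (QA \<Otimes>\<^sub>M lborel)"
      by (simp add: r_def case_prod_beta)
  qed
  have "(\<lambda>(A, z). indicator P z *\<^sub>R f (A z)) \<in> borel_measurable (QA \<Otimes>\<^sub>M lborel)"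
    using joint unfolding case_prod_beta by measurable
  then show ?thesis
    unfolding set_lebesgue_integral_def by (intro lborel.borel_measurable_lebesgue_integral)
qed

text \<open>Makes \<open>data_law\<close> a genuine push-forward, so that almost sure statements can
  be checked on the latent variables.\<close>

lemma data_map_measurable:
  assumes QA: "\<And>z. (\<lambda>A. A z) \<in> QA \<rightarrow>\<^sub>M borel" and Q\<eta>: "sets Q\<eta> = sets borel"
    and f: "f0 \<in> borel_measurable borel" "f1 \<in> borel_measurable borel"
    and cont: "\<And>A. A \<in> space QA \<Longrightarrow> continuous_on UNIV (\<lambda>z. f0 (A z))"
      "\<And>A. A \<in> space QA \<Longrightarrow> continuous_on UNIV (\<lambda>z. f1 (A z))"
  shows "(\<lambda>(k, A, \<eta>). (deformed_image d (if k then f1 else f0) A \<eta>, k))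
    \<in> label_space \<Otimes>\<^sub>M (QA \<Otimes>\<^sub>M Q\<eta>) \<rightarrow>\<^sub>M image_space d \<Otimes>\<^sub>M label_space"
proof -
  let ?M = "label_space \<Otimes>\<^sub>M (QA \<Otimes>\<^sub>M Q\<eta>)"
  have pix: "pixel d j l \<in> sets borel" for j l by (simp add: pixel_eq_ipixel)
  have k: "(\<lambda>x. fst x) \<in> ?M \<rightarrow>\<^sub>M count_space UNIV"
    using measurable_fst[of label_space "QA \<Otimes>\<^sub>M Q\<eta>"] by (simp add: label_space_def)
  have A: "(\<lambda>x. fst (snd x)) \<in> ?M \<rightarrow>\<^sub>M QA" by (rule measurable_compose[OF measurable_snd measurable_fst])
  have "(\<lambda>x. snd (snd x)) \<in> ?M \<rightarrow>\<^sub>M Q\<eta>" by (rule measurable_compose[OF measurable_snd measurable_snd])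
  then have \<eta>: "(\<lambda>x. snd (snd x)) \<in> borel_measurable ?M"
    using measurable_cong_sets[OF refl Q\<eta>, of ?M] by simp
  have int: "(\<lambda>x. LINT z:pixel d j l|lborel. (if fst x then f1 else f0) (fst (snd x) z)) \<in> borel_measurable ?M" for j l
  proof -
    have "(\<lambda>x. if fst x then (LINT z:pixel d j l|lborel. f1 (fst (snd x) z))
        else (LINT z:pixel d j l|lborel. f0 (fst (snd x) z))) \<in> borel_measurable ?M"
      using k by (intro measurable_If measurable_compose[OF A] pixel_integral_measurable QA f pix cont) 
        (auto simp: pred_def dest: measurable_sets)
    also have "(\<lambda>x. if fst x then (LINT z:pixel d j l|lborel. f1 (fst (snd x) z))
        else (LINT z:pixel d j l|lborel. f0 (fst (snd x) z)))
      = (\<lambda>x. LINT z:pixel d j l|lborel. (if fst x then f1 else f0) (fst (snd x) z))" by auto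
    finally show ?thesis .
  qed
  have "(\<lambda>x. deformed_image d (if fst x then f1 else f0) (fst (snd x)) (snd (snd x))) \<in> ?M \<rightarrow>\<^sub>M image_space d"
    unfolding deformed_image_def image_space_def case_prod_beta
    using \<eta> int by (intro measurable_restrict borel_measurable_times) auto
  then show ?thesis
    unfolding case_prod_beta using measurable_fst[of label_space "QA \<Otimes>\<^sub>M Q\<eta>"] by (intro measurable_Pair)
qed

section \<open>Empirical risk minimizers\<close>

lemma clip_bounds: "rho 1 \<le> clip t" "clip t \<le> rho (-1)"
  using rho_le_iff[of 1 "-1"] by (auto simp: clip_def)

lemma rho_pos: "0 < rho x" by (simp add: rho_def add_pos_pos)

lemma clip_eq_upper: "clip t = rho (-1) \<longleftrightarrow> rho (-1) \<le> t"
  using rho_le_iff[of "-1" 1] by (auto simp: clip_def)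

lemma clip_eq_lower: "clip t = rho 1 \<longleftrightarrow> t \<le> rho 1"
  using rho_le_iff[of "-1" 1] by (auto simp: clip_def)

lemma clip_rho_gt_half: "z < 0 \<Longrightarrow> 1 / 2 < clip (rho z)"
  unfolding rho_0[symmetric] using rho_le_iff[of z 0] rho_le_iff[of "-1" 0] by (auto simp: clip_def)

lemma clip_rho_lt_half: "0 < z \<Longrightarrow> clip (rho z) < 1 / 2"
  unfolding rho_0[symmetric] using rho_le_iff[of 0 z] rho_le_iff[of 0 1] by (auto simp: clip_def)

text \<open>As \<open>1 - rho 1 = rho (-1)\<close>, the clipping interval is symmetric and both
  labels share the same best value, attained only at the endpoint that belongs to the label.\<close>

lemma cross_entropy_term_le:
  assumes "k \<in> {0, 1}"
  shows "k * ln (clip t) + (1 - k) * ln (1 - clip t) \<le> ln (rho (-1))"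
    and "k * ln (clip t) + (1 - k) * ln (1 - clip t) = ln (rho (-1)) \<longleftrightarrow>
      clip t = (if k = 1 then rho (-1) else rho 1)"
proof -
  have "0 < clip t" "1 - clip t \<le> rho (-1)" "0 < 1 - clip t"
    using clip_bounds[of t] rho_pos[of 1] one_minus_rho[of 1] one_minus_rho[of "-1"] by auto
  then show "k * ln (clip t) + (1 - k) * ln (1 - clip t) \<le> ln (rho (-1))"
    "k * ln (clip t) + (1 - k) * ln (1 - clip t) = ln (rho (-1)) \<longleftrightarrow>
      clip t = (if k = 1 then rho (-1) else rho 1)"
    using assms clip_bounds(2)[of t] rho_pos[of "-1"] one_minus_rho[of 1] by (auto simp: ln_inj_iff)
qed

text \<open>If some network in the class is perfect on the sample, the empirical risk attains the smallest
  value that the clipping permits, so every minimizer interpolates the clipped labels.\<close>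

lemma ce_minimizer_interpolates:
  assumes g: "(\<lambda>X. (1 - g X, g X)) \<in> cnn_class d \<alpha> m"
    and good: "\<And>i. i \<in> {1..n} \<Longrightarrow>
      (if snd (S i) then rho (-1) \<le> g (normalize_image d (fst (S i))) else g (normalize_image d (fst (S i))) \<le> rho 1)"
    and min: "is_arg_min (ce_risk d n S) (\<lambda>q. q \<in> clipped_cnn_class d \<alpha> m) (\<lambda>X. (1 - clip (h X), clip (h X)))"
    and i: "i \<in> {1..n}"
  shows "clip (h (normalize_image d (fst (S i)))) = (if snd (S i) then rho (-1) else rho 1)"
proof -
  define loss where "loss h i = of_bool (snd (S i)) * ln (clip (h (normalize_image d (fst (S i)))))
    + (1 - of_bool (snd (S i))) * ln (1 - clip (h (normalize_image d (fst (S i)))))" for h :: "image \<Rightarrow> real" and i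
  have le: "loss h i \<le> ln (rho (-1))" for h i
    unfolding loss_def by (rule cross_entropy_term_le) auto
  have eq: "loss h i = ln (rho (-1)) \<longleftrightarrow>
      clip (h (normalize_image d (fst (S i)))) = (if snd (S i) then rho (-1) else rho 1)" for h i
    unfolding loss_def by (subst cross_entropy_term_le(2)) auto
  have risk: "ce_risk d n S (\<lambda>X. (1 - clip (h X), clip (h X))) = - (1 / real n) * (\<Sum>i=1..n. loss h i)" for h
    by (simp add: ce_risk_def loss_def Let_def)
  have n: "0 < n" using i by auto
  have "(\<lambda>X. (1 - clip (g X), clip (g X))) \<in> clipped_cnn_class d \<alpha> m"
    unfolding clipped_cnn_class_def using g by blast
  then have "\<not> ce_risk d n S (\<lambda>X. (1 - clip (g X), clip (g X))) < ce_risk d n S (\<lambda>X. (1 - clip (h X), clip (h X)))"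
    using min unfolding is_arg_min_def by blast
  then have "(\<Sum>i=1..n. loss g i) \<le> (\<Sum>i=1..n. loss h i)"
    unfolding risk using n by (simp add: field_simps)
  moreover have "loss g i = ln (rho (-1))" if "i \<in> {1..n}" for i
    using good[OF that] unfolding eq by (auto simp: clip_eq_upper clip_eq_lower split: if_splits)
  ultimately have "(\<Sum>i=1..n. ln (rho (-1)) - loss h i) \<le> 0"
    by (simp add: sum_subtractf)
  moreover have "0 \<le> (\<Sum>i=1..n. ln (rho (-1)) - loss h i)" using le by (intro sum_nonneg) auto
  ultimately have "(\<Sum>i=1..n. ln (rho (-1)) - loss h i) = 0" by linarith
  then have "ln (rho (-1)) - loss h i = 0"
    using le i by (subst (asm) sum_nonneg_eq_0_iff) auto
  then have "loss h i = ln (rho (-1))" by simp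
  then show ?thesis unfolding eq .
qed

section \<open>Partition of the normalized images into cells\<close>

definition cell :: "nat \<Rightarrow> nat \<Rightarrow> image \<Rightarrow> nat \<times> nat \<Rightarrow> int" where
  "cell d N X = (\<lambda>p\<in>{1..d} \<times> {1..d}. \<lfloor>real N * normalize_image d X p\<rfloor>)"

definition cells :: "nat \<Rightarrow> nat \<Rightarrow> (nat \<times> nat \<Rightarrow> int) set" where
  "cells d N = ({1..d} \<times> {1..d} \<rightarrow>\<^sub>E {- int N..int N})"

lemma finite_cells: "finite (cells d N)"
  unfolding cells_def by (intro finite_PiE) auto

lemma abs_normalize_image_le_1:
  assumes "p \<in> {1..d} \<times> {1..d}"
  shows "\<bar>normalize_image d X p\<bar> \<le> 1"
proof -
  have "normalize_image d X p = X p / image_norm d X"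
    using assms by (simp add: normalize_image_def image_norm_def)
  \<comment> \<open>An image of norm 0 is normalized to 0, since division by 0 gives 0.\<close>
  then show ?thesis
    using abs_le_image_norm[OF assms, of X] image_norm_nonneg[of d X]
    by (cases "image_norm d X = 0") (auto simp: divide_le_eq_1 abs_divide)
qed

lemma cell_in_cells: "cell d N X \<in> cells d N"
proof -
  have "\<lfloor>real N * normalize_image d X p\<rfloor> \<in> {- int N..int N}" if "p \<in> {1..d} \<times> {1..d}" for p
  proof -
    have "\<bar>real N * normalize_image d X p\<bar> \<le> real N * 1"
      unfolding abs_mult using abs_normalize_image_le_1[OF that, of X] by (intro mult_mono) auto
    then have "- real N \<le> real N * normalize_image d X p" "real N * normalize_image d X p \<le> real N" by auto
    then show ?thesis by (auto simp: le_floor_iff floor_le_iff)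
  qed
  then show ?thesis unfolding cell_def cells_def by (intro PiE_I) (simp_all only: restrict_apply if_True if_False)
qed

lemma cell_eq_close:
  assumes "cell d N X = cell d N X'" "p \<in> {1..d} \<times> {1..d}" "1 \<le> N"
  shows "\<bar>normalize_image d X p - normalize_image d X' p\<bar> \<le> 1 / real N"
proof -
  have "\<lfloor>real N * normalize_image d X p\<rfloor> = \<lfloor>real N * normalize_image d X' p\<rfloor>"
    using fun_cong[OF assms(1), of p] assms(2) by (simp add: cell_def)
  then have "\<bar>real N * normalize_image d X p - real N * normalize_image d X' p\<bar> \<le> 1" by linarith
  then have "real N * \<bar>normalize_image d X p - normalize_image d X' p\<bar> \<le> 1"
    by (simp add: right_diff_distrib[symmetric] abs_mult)
  then show ?thesis using assms(3) by (simp add: field_simps)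
qed

lemma cell_measurable: "cell d N \<in> image_space d \<rightarrow>\<^sub>M count_space (cells d N)"
proof (subst measurable_count_space_eq2[OF finite_cells], intro conjI ballI)
  show "cell d N \<in> space (image_space d) \<rightarrow> cells d N" using cell_in_cells by blast
  fix a assume a: "a \<in> cells d N"
  have [measurable]: "(\<lambda>X. normalize_image d X p) \<in> borel_measurable (image_space d)" if "p \<in> {1..d} \<times> {1..d}" for p
    using measurable_compose[OF normalize_image_measurable, of "\<lambda>X. X p" d borel] that
    by (simp add: image_space_def)
  have "cell d N -` {a} \<inter> space (image_space d)
      = {X \<in> space (image_space d). \<forall>p\<in>{1..d} \<times> {1..d}. \<lfloor>real N * normalize_image d X p\<rfloor> = a p}"
  proof (intro set_eqI iffI; clarsimp)
    fix X assume "\<forall>i\<in>{Suc 0..d}. \<forall>j\<in>{Suc 0..d}. \<lfloor>real N * normalize_image d X (i, j)\<rfloor> = a (i, j)"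
    then show "cell d N X = a"
      using a by (intro PiE_ext[OF cell_in_cells[unfolded cells_def] a[unfolded cells_def]]) (auto simp: cell_def)
  qed (auto simp: cell_def)
  also have "\<dots> \<in> sets (image_space d)" by measurable
  finally show "cell d N -` {a} \<inter> space (image_space d) \<in> sets (image_space d)" .
qed

text \<open>\<open>c\<close> is the number of cells, fixed before \<open>n\<close> and
  \<open>p\<close>. For the perfect network, a logit variation below 1 makes the label constant on a
  cell up to a null set, as logits of opposite labels are at least 2 apart. For the minimizer it
  carries the sign of the logit from a sample point to a new point in the same cell.\<close>

lemma misclassification_prob_le:
  assumes \<mu>: "prob_space \<mu>" "sets \<mu> = sets (image_space d \<Otimes>\<^sub>M label_space)"
    and g: "(\<lambda>X. (1 - g X, g X)) \<in> cnn_class d \<alpha> m"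
    and good: "AE x in \<mu>. if snd x then rho (-1) \<le> g (normalize_image d (fst x)) else g (normalize_image d (fst x)) \<le> rho 1"
  obtains c where "\<And>n p. ce_minimizer d \<alpha> m n p \<Longrightarrow> misclassification_prob d \<mu> n p \<le> c / (real n + 1)"
proof -
  obtain \<Lambda> where \<Lambda>: "0 \<le> \<Lambda>" and logit: "\<And>g. (\<lambda>X. (1 - g X, g X)) \<in> cnn_class d \<alpha> m \<Longrightarrow>
      \<exists>z. (\<forall>X. g X = rho (z X)) \<and>
        (\<forall>X X' \<delta>. 0 \<le> \<delta> \<longrightarrow> (\<forall>p\<in>{1..d} \<times> {1..d}. \<bar>X p - X' p\<bar> \<le> \<delta>) \<longrightarrow> \<bar>z X - z X'\<bar> \<le> \<Lambda> * \<delta>)"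
    using cnn_class_logit_lipschitz[of d \<alpha> m] by blast
  \<comment> \<open>Mesh \<open>1 / N\<close> is fine enough for every logit of the class to vary by
    less than 1 on a cell.\<close>
  obtain N :: nat where N: "\<Lambda> < real N" using reals_Archimedean2 by blast
  have N1: "1 \<le> N" using N \<Lambda> by (cases N) auto
  have small: "\<Lambda> * (1 / real N) < 1" using N N1 by simp
  have logit_cell: "\<exists>z. (\<forall>X. g X = rho (z X)) \<and>
      (\<forall>X X'. cell d N X = cell d N X' \<longrightarrow> \<bar>z (normalize_image d X) - z (normalize_image d X')\<bar> < 1)"
    if g: "(\<lambda>X. (1 - g X, g X)) \<in> cnn_class d \<alpha> m" for g
  proof -
    obtain z where z: "\<forall>X. g X = rho (z X)"
      and lip: "\<And>X X' \<delta>. 0 \<le> \<delta> \<Longrightarrow> (\<forall>p\<in>{1..d} \<times> {1..d}. \<bar>X p - X' p\<bar> \<le> \<delta>) \<Longrightarrow> \<bar>z X - z X'\<bar> \<le> \<Lambda> * \<delta>"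
      using logit[OF g] by blast
    have "\<bar>z (normalize_image d X) - z (normalize_image d X')\<bar> < 1" if "cell d N X = cell d N X'" for X X'
      using lip[of "1 / real N" "normalize_image d X" "normalize_image d X'"] cell_eq_close[OF that _ N1] small
      by fastforce
    then show ?thesis using z by blast
  qed
  obtain z where z: "\<And>X. g X = rho (z X)"
    and z_cell: "\<And>X X'. cell d N X = cell d N X' \<Longrightarrow> \<bar>z (normalize_image d X) - z (normalize_image d X')\<bar> < 1"
    using logit_cell[OF g] by blast
  have sp: "space \<mu> = space (image_space d \<Otimes>\<^sub>M label_space)" using sets_eq_imp_space_eq[OF \<mu>(2)] .
  have cell_\<mu>: "(\<lambda>x. cell d N (fst x)) \<in> \<mu> \<rightarrow>\<^sub>M count_space (cells d N)"
    unfolding measurable_cong_sets[OF \<mu>(2) refl] by (rule measurable_compose[OF measurable_fst cell_measurable])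
  have "misclassification_prob d \<mu> n p \<le> card (cells d N) / (real n + 1)"
    if p: "ce_minimizer d \<alpha> m n p" for n p
  proof -
    let ?M = "(\<Pi>\<^sub>M i\<in>{1..n}. \<mu>) \<Otimes>\<^sub>M \<mu>"
    let ?U = "{\<omega> \<in> space ?M. \<forall>i\<in>{1..n}. cell d N (fst (fst \<omega> i)) \<noteq> cell d N (fst (snd \<omega>))}"
    note U = missing_mass[OF \<mu>(1) finite_cells cell_\<mu>, of n]
    interpret \<mu>: prob_space \<mu> by (rule \<mu>)
    interpret PP: prob_space "\<Pi>\<^sub>M i\<in>{1..n}. \<mu>" by (intro prob_space_PiM \<mu>)
    interpret pair_prob_space "\<Pi>\<^sub>M i\<in>{1..n}. \<mu>" \<mu> by standard
    have "AE \<omega> in ?M. \<omega> \<in> {(S, X, k). (S, X, k) \<in> space ?M \<and> plug_in_classifier d p S X \<noteq> k} \<longrightarrow> \<omega> \<in> ?U"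
      using AE_sample_and_new[OF \<mu>(1) good, of n]
    proof eventually_elim
      case (elim \<omega>)
      obtain S X k where \<omega>: "\<omega> = (S, X, k)" by (cases \<omega>)
      have new: "if k then rho (-1) \<le> g (normalize_image d X) else g (normalize_image d X) \<le> rho 1"
        and old: "\<And>i. i \<in> {1..n} \<Longrightarrow>
          (if snd (S i) then rho (-1) \<le> g (normalize_image d (fst (S i))) else g (normalize_image d (fst (S i))) \<le> rho 1)"
        using elim unfolding \<omega> fst_conv snd_conv by blast+
      have "plug_in_classifier d p S X = k"
        if sp_\<omega>: "\<omega> \<in> space ?M" and i: "i \<in> {1..n}" and same: "cell d N (fst (S i)) = cell d N X" for i
      proof -
        have "S \<in> space (sample_space d n)"
          using sp_\<omega> unfolding \<omega> sample_space_def space_pair_measure[of "\<Pi>\<^sub>M i\<in>{1..n}. \<mu>"] space_PiM sp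
          by blast
        then have min: "is_arg_min (ce_risk d n S) (\<lambda>q. q \<in> clipped_cnn_class d \<alpha> m) (p S)"
          using p by (auto simp: ce_minimizer_def)
        then obtain h where h: "(\<lambda>X. (1 - h X, h X)) \<in> cnn_class d \<alpha> m" and pS: "p S = (\<lambda>X. (1 - clip (h X), clip (h X)))"
          unfolding is_arg_min_def clipped_cnn_class_def by blast
        obtain zh where zh: "\<And>X. h X = rho (zh X)"
          and zh_cell: "\<And>X X'. cell d N X = cell d N X' \<Longrightarrow> \<bar>zh (normalize_image d X) - zh (normalize_image d X')\<bar> < 1"
          using logit_cell[OF h] by blast
        have fit: "clip (h (normalize_image d (fst (S i)))) = (if snd (S i) then rho (-1) else rho 1)"
          using ce_minimizer_interpolates[OF g old min[unfolded pS] i] .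
        have label: "snd (S i) = k"
          using new old[OF i] z_cell[OF same] unfolding z by (auto simp: rho_le_iff split: if_splits)
        have "if k then zh (normalize_image d (fst (S i))) \<le> -1 else 1 \<le> zh (normalize_image d (fst (S i)))"
          using fit unfolding label zh by (auto simp: clip_eq_upper clip_eq_lower rho_le_iff split: if_splits)
        then have "if k then zh (normalize_image d X) < 0 else 0 < zh (normalize_image d X)"
          using zh_cell[OF same] by (auto split: if_splits)
        then show ?thesis
          using clip_rho_gt_half[of "zh (normalize_image d X)"] clip_rho_lt_half[of "zh (normalize_image d X)"]
          unfolding plug_in_classifier_def pS zh by (cases k) auto
      qed
      then have "\<forall>i\<in>{1..n}. cell d N (fst (S i)) \<noteq> cell d N X"
        if "\<omega> \<in> space ?M" "plug_in_classifier d p S X \<noteq> k" using that by blast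
      then show ?case by (simp add: \<omega>)
    qed
    then have "misclassification_prob d \<mu> n p \<le> measure ?M ?U"
      unfolding misclassification_prob_def using U(1) by (intro finite_measure_mono_AE)
    then show ?thesis using U(2) by linarith
  qed
  then show ?thesis by (rule that)
qed

text \<open>Once \<open>ln n\<close> is at least 1 and at least \<open>c / a\<close>, its power
  \<open>1 + \<gamma>\<close> absorbs the constant.\<close>

lemma eventually_rate:
  fixes a c \<gamma> :: real
  assumes a: "0 < a" and \<gamma>: "0 < \<gamma>"
  shows "\<forall>\<^sub>F n in sequentially. c / (real n + 1) \<le> a / real n * ln (real n) powr (1 + \<gamma>)"
proof -
  define L where "L = max 1 (c / a)"
  show ?thesis
    using eventually_ge_at_top[of "nat \<lceil>exp L\<rceil>"]
  proof eventually_elim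
    case (elim n)
    then have n: "exp L \<le> real n" by linarith
    then have n0: "0 < real n" using exp_gt_zero[of L] by linarith
    have "L \<le> ln (real n)" using n n0 by (simp add: ln_ge_iff)
    then have l: "1 \<le> ln (real n)" "c / a \<le> ln (real n)" by (auto simp: L_def)
    have "ln (real n) \<le> ln (real n) powr (1 + \<gamma>)"
      using powr_mono[of 1 "1 + \<gamma>" "ln (real n)"] l(1) \<gamma> by simp
    then have "a * ln (real n) \<le> a * ln (real n) powr (1 + \<gamma>)" using a by (intro mult_left_mono) auto
    moreover have "c \<le> a * ln (real n)" using l(2) a by (simp add: field_simps)
    ultimately have c: "c \<le> a * ln (real n) powr (1 + \<gamma>)" by linarith
    have "c / (real n + 1) \<le> a * ln (real n) powr (1 + \<gamma>) / (real n + 1)"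
      using c by (intro divide_right_mono) auto
    also have "\<dots> \<le> a * ln (real n) powr (1 + \<gamma>) / real n"
      using n0 a by (intro divide_left_mono) auto
    finally show ?case by simp
  qed
qed

theorem theorem4p4:
  shows "\<exists>(\<kappa> :: real \<Rightarrow> real \<Rightarrow> real) (C :: real).
    (\<forall>C\<^sub>L C\<^sub>A. 0 < \<kappa> C\<^sub>L C\<^sub>A) \<and> 0 < C \<and>
    (\<forall>(C\<^sub>L :: real) (C\<^sub>A :: real) (\<beta>left :: real) (\<beta>right :: real) (\<beta>down :: real) (\<beta>up :: real)
       (f0 :: template) (f1 :: template) (\<A> :: deformation set) (d :: nat)
       (Ad :: real \<Rightarrow> deformation set) (\<pi> :: real) (QA :: deformation measure)
       (Q\<eta> :: real measure) (J :: (bool \<times> deformation \<times> real) measure) (\<alpha> :: real).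
      let R = {\<beta>left..\<beta>right} \<times> {\<beta>down..\<beta>up}; m = card (Ad \<alpha>) in
      1 \<le> d \<longrightarrow>
      is_template f0 \<longrightarrow> is_template f1 \<longrightarrow>
      0 \<le> \<pi> \<longrightarrow> \<pi> \<le> 1 \<longrightarrow>
      deformation_distribution \<A> QA \<longrightarrow> brightness_distribution Q\<eta> \<longrightarrow> latent_law \<pi> QA Q\<eta> J \<longrightarrow>
      assumption1 f0 f1 \<beta>left \<beta>right \<beta>down \<beta>up C\<^sub>L \<longrightarrow>
      assumption2i f0 f1 R C\<^sub>A \<A> \<longrightarrow>
      assumption3 f0 f1 R C\<^sub>A d \<A> Ad \<longrightarrow>
      0 < \<alpha> \<longrightarrow> \<alpha> \<le> 1 \<longrightarrow>
      max (real d powr \<alpha>) 2 \<le> real m \<longrightarrow>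
      sqrt (\<kappa> C\<^sub>L C\<^sub>A / real d powr \<alpha>) \<le> separation \<A> f0 f1 \<longrightarrow>
      (\<forall>\<gamma>>0. \<forall>\<^sub>F n in sequentially. \<forall>p.
        ce_minimizer d \<alpha> m n p \<longrightarrow>
        misclassification_prob d (data_law d f0 f1 J) n p
          \<le> C * (real m * (real d powr (2 * \<alpha>) + real m) / real n)
              * ln (real m) * ln (real n) powr (1 + \<gamma>)))"
proof (rule exI[of _ separation_const], rule exI[of _ 1], unfold Let_def, intro conjI allI impI)
  fix C\<^sub>L C\<^sub>A \<beta>left \<beta>right \<beta>down \<beta>up :: real and f0 f1 :: template and \<A> :: "deformation set" and d :: nat
    and Ad :: "real \<Rightarrow> deformation set" and \<pi> :: real and QA :: "deformation measure"
    and Q\<eta> :: "real measure" and J :: "(bool \<times> deformation \<times> real) measure" and \<alpha> \<gamma> :: real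
  let ?R = "{\<beta>left..\<beta>right} \<times> {\<beta>down..\<beta>up}" and ?m = "card (Ad \<alpha>)" and ?\<mu> = "data_law d f0 f1 J"
  assume d: "1 \<le> d" and f: "is_template f0" "is_template f1"
    and QA: "deformation_distribution \<A> QA" and Q\<eta>: "brightness_distribution Q\<eta>" and J: "latent_law \<pi> QA Q\<eta> J"
    and A1: "assumption1 f0 f1 \<beta>left \<beta>right \<beta>down \<beta>up C\<^sub>L"
    and A2: "assumption2i f0 f1 ?R C\<^sub>A \<A>" and A3: "assumption3 f0 f1 ?R C\<^sub>A d \<A> Ad"
    and \<alpha>: "0 < \<alpha>" "\<alpha> \<le> 1" and m: "max (real d powr \<alpha>) 2 \<le> real ?m"
    and sep: "sqrt (separation_const C\<^sub>L C\<^sub>A / real d powr \<alpha>) \<le> separation \<A> f0 f1" and \<gamma>: "0 < \<gamma>"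
  have "lipschitz_template f C\<^sub>L" if "f \<in> {f0, f1}" for f
    using that f A1 unfolding lipschitz_template_def is_template_def assumption1_def by blast
  then have "cnn_model f0 f1 ?R C\<^sub>L C\<^sub>A \<A> d \<alpha>"
    unfolding cnn_model_def using d \<alpha> sep A1 A2 by (simp add: assumption1_def)
  then interpret cnn_model f0 f1 ?R C\<^sub>L C\<^sub>A \<A> d \<alpha> .
  have m2: "2 \<le> ?m" and dm: "real d powr \<alpha> \<le> ?m" using m by auto
  have fin: "finite (Ad \<alpha>)" "Ad \<alpha> \<subseteq> \<A>"
    and cover: "\<And>A. A \<in> \<A> \<Longrightarrow> \<exists>A'\<in>Ad \<alpha>. \<exists>j\<in>{1..real d}. \<exists>l\<in>{1..real d}.
           assumption2i_map f0 f1 ?R C\<^sub>A (shift (j / d) (l / d) A') \<and>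
           sup_norm (\<lambda>z. shift (j / d) (l / d) A' z - A z) \<le> real d powr (- \<alpha>)"
    using A3 \<alpha> unfolding assumption3_def by blast+
  obtain g where g: "(\<lambda>X. (1 - g X, g X)) \<in> cnn_class d \<alpha> ?m"
    and g1: "\<And>A \<eta>. A \<in> \<A> \<Longrightarrow> 0 < \<eta> \<Longrightarrow> rho (-1) \<le> g (normalize_image d (deformed_image d f1 A \<eta>))"
    and g0: "\<And>A \<eta>. A \<in> \<A> \<Longrightarrow> 0 < \<eta> \<Longrightarrow> g (normalize_image d (deformed_image d f0 A \<eta>)) \<le> rho 1"
    using perfect_network[OF fin m2 dm cover] by blast
  have J_sets: "sets J = sets (label_space \<Otimes>\<^sub>M (QA \<Otimes>\<^sub>M Q\<eta>))" and J_prob: "prob_space J"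
    and J_snd: "distr J (QA \<Otimes>\<^sub>M Q\<eta>) snd = QA \<Otimes>\<^sub>M Q\<eta>"
    using J by (auto simp: latent_law_def)
  have space_QA: "space QA = \<A>" and eval: "\<And>z. (\<lambda>A. A z) \<in> borel_measurable QA" and QA_prob: "prob_space QA"
    using QA by (auto simp: deformation_distribution_def)
  have Q\<eta>_prob: "prob_space Q\<eta>" and Q\<eta>_sets: "sets Q\<eta> = sets borel" and Q\<eta>_pos: "AE \<eta> in Q\<eta>. 0 < \<eta>"
    using Q\<eta> by (auto simp: brightness_distribution_def)
  let ?F = "\<lambda>(k, A, \<eta>). (deformed_image d (if k then f1 else f0) A \<eta>, k)"
  have cont: "continuous_on UNIV (\<lambda>z. f0 (A z))" "continuous_on UNIV (\<lambda>z. f1 (A z))" if "A \<in> \<A>" for A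
    using deformed_template.F_continuous[OF deformed[OF that, of False]]
      deformed_template.F_continuous[OF deformed[OF that, of True]] by (auto simp: tf_def)
  have F: "?F \<in> J \<rightarrow>\<^sub>M image_space d \<Otimes>\<^sub>M label_space"
    unfolding measurable_cong_sets[OF J_sets refl]
    using template[THEN lipschitz_template.measurable_f] cont
    by (intro data_map_measurable eval Q\<eta>_sets) (auto simp: space_QA)
  have \<mu>: "prob_space ?\<mu>" "sets ?\<mu> = sets (image_space d \<Otimes>\<^sub>M label_space)"
    using prob_space.prob_space_distr[OF J_prob F] by (auto simp: data_law_def)
  have [measurable]: "g \<in> borel_measurable (image_space d)" using g by (rule cnn_class_measurable)
  have good: "AE x in ?\<mu>. if snd x then rho (-1) \<le> g (normalize_image d (fst x)) else g (normalize_image d (fst x)) \<le> rho 1"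
  proof -
    let ?good = "\<lambda>x. if snd x then rho (-1) \<le> g (normalize_image d (fst x)) else g (normalize_image d (fst x)) \<le> rho 1"
    have meas: "{x \<in> space (image_space d \<Otimes>\<^sub>M label_space). ?good x} \<in> sets (image_space d \<Otimes>\<^sub>M label_space)"
      unfolding label_space_def by measurable
    interpret Q\<eta>: prob_space Q\<eta> by (rule Q\<eta>_prob)
    interpret QA: prob_space QA by (rule QA_prob)
    interpret pair_prob_space QA Q\<eta> by standard
    obtain Z where Z: "Z \<in> sets Q\<eta>" "emeasure Q\<eta> Z = 0" "{\<eta> \<in> space Q\<eta>. \<not> 0 < \<eta>} \<subseteq> Z"
      using AE_E[OF Q\<eta>_pos] by metis
    have "AE x in QA \<Otimes>\<^sub>M Q\<eta>. 0 < snd x"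
    proof (rule AE_I[where N = "space QA \<times> Z"])
      show "emeasure (QA \<Otimes>\<^sub>M Q\<eta>) (space QA \<times> Z) = 0" using Z by (simp add: Q\<eta>.emeasure_pair_measure_Times)
    qed (use Z in \<open>auto simp: space_pair_measure\<close>)
    \<comment> \<open>Positive brightness is a property of the marginal law of (A, \<eta>), so it
      passes to \<open>J\<close> whatever the dependence on the label.\<close>
    then have "AE x in distr J (QA \<Otimes>\<^sub>M Q\<eta>) snd. 0 < snd x" by (simp only: J_snd)
    then have pos: "AE x in J. 0 < snd (snd x)"
      by (rule AE_distrD[rotated]) (simp only: measurable_cong_sets[OF J_sets refl] measurable_snd)
    have "AE x in J. ?good (?F x)"
      using pos
    proof (rule AE_mp, intro AE_I2 impI)
      fix x assume x: "x \<in> space J" "0 < snd (snd x)"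
      obtain k A \<eta> where x_eq: "x = (k, A, \<eta>)" by (cases x)
      have "A \<in> \<A>"
        using x(1) unfolding sets_eq_imp_space_eq[OF J_sets] by (auto simp: x_eq space_pair_measure space_QA)
      then show "?good (?F x)" using g1 g0 x(2) by (simp add: x_eq)
    qed
    then show ?thesis unfolding data_law_def by (subst AE_distr_iff[OF F meas])
  qed
  obtain c where c: "\<And>n p. ce_minimizer d \<alpha> ?m n p \<Longrightarrow> misclassification_prob d ?\<mu> n p \<le> c / (real n + 1)"
    using misclassification_prob_le[OF \<mu> g good] by blast
  let ?a = "real ?m * (real d powr (2 * \<alpha>) + real ?m) * ln (real ?m)"
  have "0 < ?a" using m2 by (intro mult_pos_pos add_nonneg_pos) auto
  \<comment> \<open>The factor \<open>?a\<close> is positive because \<open>2 \<le> ?m\<close> makes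
    its logarithm positive. The threshold for \<open>n\<close> depends on \<open>c\<close>, which is
    independent of \<open>p\<close>, so it serves all minimizers at once.\<close>
  from eventually_rate[OF this \<gamma>, of c]
  show "\<forall>\<^sub>F n in sequentially. \<forall>p. ce_minimizer d \<alpha> ?m n p \<longrightarrow>
      misclassification_prob d ?\<mu> n p
        \<le> 1 * (real ?m * (real d powr (2 * \<alpha>) + real ?m) / real n) * ln (real ?m) * ln (real n) powr (1 + \<gamma>)"
  proof eventually_elim
    case (elim n)
    show ?case
    proof (intro allI impI)
      fix p assume "ce_minimizer d \<alpha> ?m n p"
      from order_trans[OF c[OF this] elim]
      show "misclassification_prob d ?\<mu> n p
          \<le> 1 * (real ?m * (real d powr (2 * \<alpha>) + real ?m) / real n) * ln (real ?m) * ln (real n) powr (1 + \<gamma>)"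
        by simp
    qed
  qed
qed (rule separation_const_pos, rule zero_less_one)

end
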